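(* Let $H$ be a real Hilbert space with scalar product $\langle\cdot,\cdot\rangle$ and norm $|\cdot|$, and let $A$ be a self-adjoint nonnegative linear operator on $H$ with dense domain. Assume that $H$ admits a countable complete orthonormal system $\{e_k\}_{k\ge1}$ of eigenvectors of $A$, with $Ae_k=\lambda_k^2e_k$ and $\lambda_k\ge0$. For $u\in H$ write $u_k=\langle u,e_k\rangle$. Let $\omega$ be a continuity modulus, let $m:[0,+\infty)\to[0,+\infty)$ be $\omega$-continuous, and let $\varphi:[0,+\infty)\to(0,+\infty)$. Assume that one of the following holds: (i) (strictly hyperbolic case) there is $\nu>0$ with $m(\sigma)\ge\nu$ for all $\sigma\ge0$, and there is a constant $\Lambda$ with $\sigma\,\omega(1/\sigma)\le\Lambda\varphi(\sigma)$ for all $\sigma>0$; (ii) (weakly hyperbolic case) there is a constant $\Lambda$ with $\sigma\le\Lambda\,\varphi\big(\sigma/\sqrt{\omega(1/\sigma)}\big)$ for all $\sigma>0$. Let $(u_0,u_1)\in\mathcal{G}_{\varphi,r_0,3/2}(A)\times\mathcal{G}_{\varphi,r_0,1}(A)$ for some $r_0>0$, and assume $$\big|\langle Au_0,u_1\rangle\big|+\Big||A^{1/2}u_1|^2-m\big(|A^{1/2}u_0|^2\big)|Au_0|^2\Big|\neq0.$$ Assume that the Cauchy problem $$u''(t)+m\big(|A^{1/2}u(t)|^2\big)Au(t)=0,\qquad u(0)=u_0,\quad u'(0)=u_1,$$ admits two solutions $v_1,v_2$ on $[0,T]$ for some $T>0$, both belonging to $$C^2\big([0,T];\mathcal{G}_{\varphi,r(t),1/2}(A)\big)\cap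 C^1\big([0,T];\mathcal{G}_{\varphi,r(t),1}(A)\big)\cap C^0\big([0,T];\mathcal{G}_{\varphi,r(t),3/2}(A)\big)$$ for some nonincreasing function $r:[0,T]\to(0,r_0]$. Then: (1) there exists $T_1\in(0,T]$ such that $v_1(t)=v_2(t)$ for all $t\in[0,T_1]$; (2) letting $T_*$ be the supremum of all $T_1\in(0,T]$ for which $v_1=v_2$ on $[0,T_1]$, and $v$ the common value of $v_1,v_2$ on $[0,T_*]$, either $T_*=T$ or $$\big|\langle Av(T_* ),v'(T_* )\rangle\big|+\Big||A^{1/2}v'(T_* )|^2-m\big(|A^{1/2}v(T_* )|^2\big)|Av(T_* )|^2\Big|=0.$$
   Context: A continuity modulus is a continuous increasing function $\omega:[0,+\infty)\to[0,+\infty)$ with $\omega(0)=0$ and $\omega(a+b)\le\omega(a)+\omega(b)$ for all $a,b\ge0$. A function $m$ is $\omega$-continuous if there is a constant $L$ with $|m(a)-m(b)|\le L\,\omega(|a-b|)$ for all $a,b\ge0$. For $\alpha\ge0$, $D(A^\alpha)=\{u\in H:\sum_k\lambda_k^{4\alpha}u_k^2<\infty\}$. For $\varphi:[0,+\infty)\to(0,+\infty)$, $r>0$, $\alpha\ge0$, set $\|u\|_{\varphi,r,\alpha}^2=\sum_{k\ge1}\lambda_k^{4\alpha}u_k^2\exp(r\varphi(\lambda_k))$ and $\mathcal{G}_{\varphi,r,\alpha}(A)=\{u\in H:\|u\|_{\varphi,r,\alpha}<\infty\}$, a Hilbert space with norm $(|u|^2+\|u\|^2_{\varphi,r,\alpha})^{1/2}$.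 The notation $C^j([0,T];\mathcal{G}_{\varphi,r(t),\alpha}(A))$ is as used in the paper for solutions whose value at time $t$ lies in the space with parameter $r(t)$, with the corresponding continuity/differentiability in time. *)

theory Defs
  imports "HOL-Analysis.Analysis"
begin

text \<open>Spectral setting: H is a real Hilbert space (type 'a), e is a complete orthonormal
  system of eigenvectors, A e_k = (lam k)^2 e_k. Powers of A are defined spectrally.\<close>

definition lampow :: "real \<Rightarrow> real \<Rightarrow> real" where
  "lampow l a = (if a = 0 then 1 else l powr a)"

definition hilbert_basis :: "(nat \<Rightarrow> 'a::real_inner) \<Rightarrow> bool" where
  "hilbert_basis e \<longleftrightarrow>
     (\<forall>j k. inner (e j) (e k) = (if j = k then 1 else 0)) \<and>
     (\<forall>u. (\<lambda>n. \<Sum>k<n. inner u (e k) *\<^sub>R e k) \<longlonglongrightarrow> u)"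

definition DA_seminorm :: "(nat \<Rightarrow> 'a::real_inner) \<Rightarrow> (nat \<Rightarrow> real) \<Rightarrow> real \<Rightarrow> 'a \<Rightarrow> real" where
  "DA_seminorm e lam \<alpha> u = sqrt (\<Sum>k. lampow (lam k) (4 * \<alpha>) * (inner u (e k))\<^sup>2)"

definition DA_norm :: "(nat \<Rightarrow> 'a::real_inner) \<Rightarrow> (nat \<Rightarrow> real) \<Rightarrow> real \<Rightarrow> 'a \<Rightarrow> real" where
  "DA_norm e lam \<alpha> u = norm u + DA_seminorm e lam \<alpha> u"

definition in_G :: "(nat \<Rightarrow> 'a::real_inner) \<Rightarrow> (nat \<Rightarrow> real) \<Rightarrow> (real \<Rightarrow> real) \<Rightarrow> real \<Rightarrow> real \<Rightarrow> 'a \<Rightarrow> bool" where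
  "in_G e lam \<phi> r \<alpha> u \<longleftrightarrow>
     summable (\<lambda>k. lampow (lam k) (4 * \<alpha>) * (inner u (e k))\<^sup>2 * exp (r * \<phi> (lam k)))"

definition Apow :: "(nat \<Rightarrow> 'a::{real_inner,complete_space}) \<Rightarrow> (nat \<Rightarrow> real) \<Rightarrow> real \<Rightarrow> 'a \<Rightarrow> 'a" where
  "Apow e lam \<alpha> u = (\<Sum>k. (lampow (lam k) (2 * \<alpha>) * inner u (e k)) *\<^sub>R e k)"

definition cont_modulus :: "(real \<Rightarrow> real) \<Rightarrow> bool" where
  "cont_modulus \<omega> \<longleftrightarrow> continuous_on {0..} \<omega> \<and> strict_mono_on {0..} \<omega> \<and> \<omega> 0 = 0 \<and>
     (\<forall>x\<ge>0. \<omega> x \<ge> 0) \<and> (\<forall>a\<ge>0. \<forall>b\<ge>0. \<omega> (a + b) \<le> \<omega> a + \<omega> b)"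

definition omega_continuous :: "(real \<Rightarrow> real) \<Rightarrow> (real \<Rightarrow> real) \<Rightarrow> bool" where
  "omega_continuous \<omega> m \<longleftrightarrow> (\<exists>L. \<forall>a\<ge>0. \<forall>b\<ge>0. \<bar>m a - m b\<bar> \<le> L * \<omega> \<bar>a - b\<bar>)"

definition cont_DA :: "(nat \<Rightarrow> 'a::real_inner) \<Rightarrow> (nat \<Rightarrow> real) \<Rightarrow> real \<Rightarrow> real \<Rightarrow> (real \<Rightarrow> 'a) \<Rightarrow> bool" where
  "cont_DA e lam \<alpha> T v \<longleftrightarrow>
     (\<forall>t\<in>{0..T}. ((\<lambda>s. DA_norm e lam \<alpha> (v s - v t)) \<longlongrightarrow> 0) (at t within {0..T}))"

definition deriv_DA :: "(nat \<Rightarrow> 'a::real_inner) \<Rightarrow> (nat \<Rightarrow> real) \<Rightarrow> real \<Rightarrow> real \<Rightarrow> (real \<Rightarrow> 'a) \<Rightarrow> (real \<Rightarrow> 'a) \<Rightarrow> bool" where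
  "deriv_DA e lam \<alpha> T v w \<longleftrightarrow>
     (\<forall>t\<in>{0..T}. ((\<lambda>s. DA_norm e lam \<alpha> ((1 / (s - t)) *\<^sub>R (v s - v t) - w t)) \<longlongrightarrow> 0)
                    (at t within {0..T}))"

text \<open>v (with first and second derivatives v1, v2) belongs to
  C^2([0,T];G_{phi,r(t),1/2}) \<inter> C^1([0,T];G_{phi,r(t),1}) \<inter> C^0([0,T];G_{phi,r(t),3/2}):
  C^j([0,T];G_{phi,r(t),alpha}) = C^j([0,T];D(A^alpha)) with every derivative of order <= j
  lying in G_{phi,r(t),alpha} at time t.\<close>
definition sol_class :: "(nat \<Rightarrow> 'a::real_inner) \<Rightarrow> (nat \<Rightarrow> real) \<Rightarrow> (real \<Rightarrow> real) \<Rightarrow> (real \<Rightarrow> real) \<Rightarrow> real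
     \<Rightarrow> (real \<Rightarrow> 'a) \<Rightarrow> (real \<Rightarrow> 'a) \<Rightarrow> (real \<Rightarrow> 'a) \<Rightarrow> bool" where
  "sol_class e lam \<phi> r T v v1 v2 \<longleftrightarrow>
     (\<forall>t\<in>{0..T}. in_G e lam \<phi> (r t) (1/2) (v t) \<and> in_G e lam \<phi> (r t) (1/2) (v1 t) \<and>
                   in_G e lam \<phi> (r t) (1/2) (v2 t) \<and>
                   in_G e lam \<phi> (r t) 1 (v t) \<and> in_G e lam \<phi> (r t) 1 (v1 t) \<and>
                   in_G e lam \<phi> (r t) (3/2) (v t)) \<and>
     deriv_DA e lam (1/2) T v v1 \<and> deriv_DA e lam (1/2) T v1 v2 \<and> cont_DA e lam (1/2) T v2 \<and>
     deriv_DA e lam 1 T v v1 \<and> cont_DA e lam 1 T v1 \<and>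
     cont_DA e lam (3/2) T v"

definition kirchhoff_sol :: "(nat \<Rightarrow> 'a::{real_inner,complete_space}) \<Rightarrow> (nat \<Rightarrow> real) \<Rightarrow> (real \<Rightarrow> real)
     \<Rightarrow> real \<Rightarrow> 'a \<Rightarrow> 'a \<Rightarrow> (real \<Rightarrow> 'a) \<Rightarrow> (real \<Rightarrow> 'a) \<Rightarrow> (real \<Rightarrow> 'a) \<Rightarrow> bool" where
  "kirchhoff_sol e lam m T u0 u1 v v1 v2 \<longleftrightarrow>
     v 0 = u0 \<and> v1 0 = u1 \<and>
     (\<forall>t\<in>{0..T}. v2 t + m ((norm (Apow e lam (1/2) (v t)))\<^sup>2) *\<^sub>R Apow e lam 1 (v t) = 0)"

definition degen_quantity :: "(nat \<Rightarrow> 'a::{real_inner,complete_space}) \<Rightarrow> (nat \<Rightarrow> real) \<Rightarrow> (real \<Rightarrow> real)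
     \<Rightarrow> 'a \<Rightarrow> 'a \<Rightarrow> real" where
  "degen_quantity e lam m u w =
     \<bar>inner (Apow e lam 1 u) w\<bar> +
     \<bar>(norm (Apow e lam (1/2) w))\<^sup>2 - m ((norm (Apow e lam (1/2) u))\<^sup>2) * (norm (Apow e lam 1 u))\<^sup>2\<bar>"

end

theory Submission
  imports Defs
begin

text \<open>Along a solution put \<open>\<psi>(t) = |A\<^sup>1\<^sup>/\<^sup>2u(t)|\<^sup>2\<close>. Nondegeneracy says that \<open>\<psi>'\<close> or \<open>\<psi>''\<close> is
  nonzero at the initial time, so \<open>\<psi>\<close> is strictly monotone shortly afterwards, and two solutions
  can be compared at times \<open>t\<close> and \<open>h(t)\<close> at which \<open>\<psi>\<^sub>1(t) = \<psi>\<^sub>2(h(t))\<close>. There the coefficient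
  \<open>m(\<psi>)\<close> is the same for both, so \<open>v\<^sub>1 - v\<^sub>2 \<circ> h\<close> solves a linear equation whose forcing is
  proportional to \<open>1 - h'\<close>; no Lipschitz dependence on \<open>m\<close> enters. The linear theory in
  \<open>\<G>\<close>-spaces (approximate energies mode by mode) bounds the difference by
  \<open>\<surd>\<delta> sup |1 - h'|\<close> on \<open>[0,\<delta>]\<close>. Conversely
  \<open>(\<psi>\<^sub>1'\<^sup>2 - (\<psi>\<^sub>2' \<circ> h)\<^sup>2)' = 2\<psi>\<^sub>1'(\<psi>\<^sub>1'' - \<psi>\<^sub>2'' \<circ> h)\<close> bounds \<open>1 - h'\<close> by the difference, even where
  \<open>\<psi>'\<close> vanishes. For small \<open>\<delta>\<close> this is a contraction, hence \<open>h' = 1\<close> and the solutions agree.\<close>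

section \<open>Continuity moduli and energy estimates for a single mode\<close>

text \<open>Subtracting the two equations at equal times leaves a difference of values of
  \<open>m\<close>, controlled only through \<open>\<omega>\<close> of the distance of the
  solutions; Gronwall breaks down there, and this forces the comparison at equal values of
  \<open>\<psi>\<close>. The price is weight and derivatives. Each use of the linear estimate loses
  a factor \<open>exp (\<eta> * \<phi>)\<close>, with \<open>\<eta>\<close> as small as wanted on a
  short time interval. It is used at two levels: for each solution, and then for the difference,
  whose forcing already contains the first bound times \<open>(lam k)\<^sup>2\<close>. With
  \<open>\<eta> = r / 2\<close> the two losses add up to the weight \<open>r\<close> of the data,
  and the powers of \<open>lam k\<close> add up to 4 on the velocity and 6 on the position, which
  are the indices 1 and 3/2. The contraction acts on the scalar supremum of
  \<open>\<bar>1 - h'\<bar>\<close>, so iterating it costs no further weight.\<close>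

lemma cont_modulus_mono:
  assumes "cont_modulus \<omega>" "0 \<le> a" "a \<le> b"
  shows "\<omega> a \<le> \<omega> b"
proof -
  have "strict_mono_on {0..} \<omega>" using assms by (simp add: cont_modulus_def)
  then show ?thesis using assms(2,3) unfolding strict_mono_on_def
    by (metis atLeast_iff dual_order.trans less_eq_real_def)
qed

lemma cont_modulus_pos:
  assumes "cont_modulus \<omega>" "0 < a"
  shows "0 < \<omega> a"
proof -
  have "strict_mono_on {0..} \<omega>" "\<omega> 0 = 0" using assms by (auto simp: cont_modulus_def)
  then show ?thesis using assms(2) strict_mono_onD[of "{0..}" \<omega> 0 a] by simp
qed

lemma cont_modulus_nat_mult:
  assumes "cont_modulus \<omega>" "0 \<le> a"
  shows "\<omega> (real n * a) \<le> real n * \<omega> a"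
proof (induction n)
  case 0
  then show ?case using assms by (simp add: cont_modulus_def)
next
  case (Suc n)
  have "\<omega> (real n * a + a) \<le> \<omega> (real n * a) + \<omega> a"
    using assms by (simp add: cont_modulus_def)
  with Suc show ?case by (simp add: algebra_simps)
qed

text \<open>Subadditivity handles integer multiples; rounding \<open>s\<close> up costs the extra 1.
  It serves twice: to absorb a Lipschitz constant inside \<open>\<omega>\<close>, and to bound
  \<open>\<omega> (1 / \<sigma>)\<close> from below by
  \<open>\<omega> 1 / (\<sigma> + 1)\<close>.\<close>

lemma cont_modulus_mult:
  assumes "cont_modulus \<omega>" "0 \<le> a" "0 \<le> s"
  shows "\<omega> (s * a) \<le> (s + 1) * \<omega> a"
proof -
  define n where "n = nat \<lceil>s\<rceil>"
  have n: "s \<le> real n" "real n \<le> s + 1"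
    unfolding n_def using assms(3) by linarith+
  have "\<omega> (s * a) \<le> \<omega> (real n * a)"
    using assms n by (intro cont_modulus_mono[OF assms(1)] mult_right_mono) auto
  also have "\<dots> \<le> real n * \<omega> a" by (rule cont_modulus_nat_mult) fact+
  also have "\<dots> \<le> (s + 1) * \<omega> a"
    using n assms by (intro mult_right_mono) (auto simp: cont_modulus_def)
  finally show ?thesis .
qed

lemma omega_continuous_imp_continuous:
  assumes "cont_modulus \<omega>" "\<And>s t. \<bar>c s - c t\<bar> \<le> L * \<omega> \<bar>s - t\<bar>"
  shows "continuous_on UNIV (c :: real \<Rightarrow> real)"
proof -
  have "isCont c x" for x
  proof -
    have "(\<omega> \<longlongrightarrow> \<omega> 0) (at 0 within {0..})"
      using assms(1) unfolding cont_modulus_def continuous_on_def by (meson atLeast_iff order_refl)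
    then have w: "(\<omega> \<longlongrightarrow> 0) (at 0 within {0..})" using assms(1) by (simp add: cont_modulus_def)
    have "filterlim (\<lambda>t. \<bar>t - x\<bar>) (at 0 within {0..}) (at x)"
      unfolding filterlim_at
      by (auto intro!: tendsto_eq_intros simp: eventually_at_filter)
    from filterlim_compose[OF w this] have "((\<lambda>t. L * \<omega> \<bar>t - x\<bar>) \<longlongrightarrow> 0) (at x)"
      by (auto intro: tendsto_eq_intros)
    then have "((\<lambda>t. c t - c x) \<longlongrightarrow> 0) (at x)"
      by (rule Lim_null_comparison[rotated]) (use assms(2) in auto)
    then show ?thesis by (simp add: isCont_def LIM_zero_iff)
  qed
  then show ?thesis by (simp add: continuous_at_imp_continuous_on)
qed

text \<open>\<open>a t\<close> is the mean of \<open>c\<close> over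
  \<open>[t, t + \<epsilon>]\<close>, a differentiable substitute for a merely continuous
  coefficient. By the mean value theorem each mean is a value of \<open>c\<close>, so pointwise
  bounds on \<open>c\<close> are inherited.\<close>

lemma moving_average:
  fixes c :: "real \<Rightarrow> real"
  assumes c: "continuous_on UNIV c" and "\<epsilon> > 0"
  obtains a where "\<And>t. t \<in> {0..\<delta>} \<Longrightarrow> (a has_real_derivative (c (t + \<epsilon>) - c t) / \<epsilon>) (at t)"
    and "\<And>t. t \<in> {0..\<delta>} \<Longrightarrow> \<exists>\<xi>\<in>{t..t + \<epsilon>}. a t = c \<xi>"
proof -
  \<comment> \<open>The margin of 1 on both sides makes \<open>t\<close> and
    \<open>t + \<epsilon>\<close> interior points, where two-sided derivatives exist.\<close>
  obtain g where g: "\<And>x. x \<in> {-1..\<delta> + \<epsilon> + 1} \<Longrightarrow>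
      (g has_vector_derivative c x) (at x within {-1..\<delta> + \<epsilon> + 1})"
    using antiderivative_continuous[of "-1" "\<delta> + \<epsilon> + 1" c] continuous_on_subset[OF c] by blast
  have g': "(g has_real_derivative c x) (at x)" if "-1 < x" "x < \<delta> + \<epsilon> + 1" for x
    using g[of x] that at_within_interior[of x "{-1..\<delta> + \<epsilon> + 1}"]
    by (simp add: has_real_derivative_iff_has_vector_derivative)
  show ?thesis
  proof (rule that[of "\<lambda>t. (g (t + \<epsilon>) - g t) / \<epsilon>"])
    fix t assume t: "t \<in> {0..\<delta>}"
    have "((\<lambda>t. g (t + \<epsilon>)) has_real_derivative c (t + \<epsilon>)) (at t)"
      using g'[of "t + \<epsilon>"] t \<open>\<epsilon> > 0\<close> by (simp add: DERIV_shift)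
    then show "((\<lambda>t. (g (t + \<epsilon>) - g t) / \<epsilon>) has_real_derivative (c (t + \<epsilon>) - c t) / \<epsilon>) (at t)"
      using g'[of t] t \<open>\<epsilon> > 0\<close> by (auto intro!: DERIV_cdivide DERIV_diff)
    have "\<exists>z. t < z \<and> z < t + \<epsilon> \<and> g (t + \<epsilon>) - g t = (t + \<epsilon> - t) * c z"
      using t \<open>\<epsilon> > 0\<close> by (intro MVT2 g') auto
    then obtain z where z: "t < z" "z < t + \<epsilon>" "g (t + \<epsilon>) - g t = (t + \<epsilon> - t) * c z" by blast
    then show "\<exists>\<xi>\<in>{t..t + \<epsilon>}. (g (t + \<epsilon>) - g t) / \<epsilon> = c \<xi>"
      using \<open>\<epsilon> > 0\<close> by (intro bexI[of _ z]) auto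
  qed
qed

text \<open>An oscillator \<open>p' = q + F\<close>, \<open>q' = G - c \<mu>\<^sup>2 p\<close>. The
  forcing is hidden behind an existential at each time because only its size in the energy matters.
  Derivatives are asked for at interior times only, since the change of time need not be
  differentiable at 0.\<close>

definition forced_mode :: "real \<Rightarrow> (real \<Rightarrow> real) \<Rightarrow> real \<Rightarrow> real \<Rightarrow> (real \<Rightarrow> real) \<Rightarrow> (real \<Rightarrow> real) \<Rightarrow> bool"
  where "forced_mode \<mu> c \<delta> B p q \<longleftrightarrow>
    continuous_on {0..\<delta>} p \<and> continuous_on {0..\<delta>} q \<and>
    (\<forall>t\<in>{0<..<\<delta>}. \<exists>F G. (p has_real_derivative q t + F) (at t) \<and>
       (q has_real_derivative G - c t * \<mu>\<^sup>2 * p t) (at t) \<and> \<mu>\<^sup>2 * F\<^sup>2 \<le> B \<and> G\<^sup>2 \<le> B)"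

text \<open>Gronwall for the approximate energy
  \<open>q\<^sup>2 + a \<mu>\<^sup>2 p\<^sup>2\<close>, with a differentiable \<open>a\<close> in
  place of \<open>c\<close>. Its derivative has an error from \<open>a - c\<close> and one from
  \<open>a'\<close>, each at most \<open>\<kappa>\<close> times the energy; the forcing contributes
  the energy once more and \<open>(1 + A) * B\<close>. Hence the rate
  \<open>2 * \<kappa> + 1\<close>.\<close>

lemma energy_growth:
  fixes a a' c p q :: "real \<Rightarrow> real"
  assumes mode: "forced_mode \<mu> c \<delta> B p q" and "0 \<le> \<mu>"
    and a: "\<And>t. t \<in> {0..\<delta>} \<Longrightarrow> (a has_real_derivative a' t) (at t)"
    and ac: "\<And>t. t \<in> {0..\<delta>} \<Longrightarrow> \<bar>a t - c t\<bar> * \<mu> \<le> \<kappa> * sqrt (a t)"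
    and a': "\<And>t. t \<in> {0..\<delta>} \<Longrightarrow> \<bar>a' t\<bar> \<le> \<kappa> * a t"
    and ab: "\<And>t. t \<in> {0..\<delta>} \<Longrightarrow> b \<le> a t" "\<And>t. t \<in> {0..\<delta>} \<Longrightarrow> a t \<le> A"
    and "0 < b" "b \<le> 1" "1 \<le> A" "0 \<le> \<kappa>" "0 \<le> B" and t: "t \<in> {0..\<delta>}"
  shows "b * ((q t)\<^sup>2 + \<mu>\<^sup>2 * (p t)\<^sup>2) \<le>
    2 * A * exp ((2 * \<kappa> + 1) * t) * ((q 0)\<^sup>2 + \<mu>\<^sup>2 * (p 0)\<^sup>2 + t * B)"
proof -
  define K where "K = 2 * \<kappa> + 1"
  define E where "E s = (q s)\<^sup>2 + a s * (\<mu>\<^sup>2 * (p s)\<^sup>2)" for s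
  \<comment> \<open>With the integrating factor and the accumulated forcing subtracted,
    \<open>W\<close> is nonincreasing.\<close>
  define W where "W s = exp (- (K * s)) * E s - s * ((1 + A) * B)" for s
  have K: "0 \<le> K" using \<open>0 \<le> \<kappa>\<close> by (simp add: K_def)
  have "W t \<le> W 0"
  proof (rule DERIV_nonpos_imp_decreasing_open[where f = W])
    show "0 \<le> t" using t by simp
    have sub: "{0..t} \<subseteq> {0..\<delta>}" using t by auto
    have "continuous_on {0..\<delta>} a"
      using a by (meson DERIV_isCont continuous_at_imp_continuous_on)
    then show "continuous_on {0..t} W" using mode continuous_on_subset[OF _ sub]
      unfolding forced_mode_def W_def E_def by (auto intro!: continuous_intros)
    fix s assume s: "0 < s" "s < t"
    then have s': "s \<in> {0<..<\<delta>}" "s \<in> {0..\<delta>}" using t by auto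
    obtain F G where p: "(p has_real_derivative q s + F) (at s)"
      and q: "(q has_real_derivative G - c s * \<mu>\<^sup>2 * p s) (at s)"
      and F: "\<mu>\<^sup>2 * F\<^sup>2 \<le> B" and G: "G\<^sup>2 \<le> B"
      using mode s'(1) unfolding forced_mode_def by blast
    define E' where "E' = 2 * q s * (G - c s * \<mu>\<^sup>2 * p s) + (a' s * (\<mu>\<^sup>2 * (p s)\<^sup>2)
        + a s * (\<mu>\<^sup>2 * (2 * p s * (q s + F))))"
    have dE: "(E has_real_derivative E') (at s)"
    proof -
      have q2: "((\<lambda>s. (q s)\<^sup>2) has_real_derivative 2 * q s * (G - c s * \<mu>\<^sup>2 * p s)) (at s)"
        using DERIV_power[OF q, of 2] by (simp add: mult_ac)
      have p2: "((\<lambda>s. \<mu>\<^sup>2 * (p s)\<^sup>2) has_real_derivative \<mu>\<^sup>2 * (2 * p s * (q s + F))) (at s)"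
        using DERIV_cmult[OF DERIV_power[OF p, of 2], of "\<mu>\<^sup>2"] by (simp add: mult_ac)
      show ?thesis unfolding E_def E'_def
        using DERIV_add[OF q2 DERIV_mult[OF a[OF s'(2)] p2]] by (simp add: add_ac mult_ac)
    qed
    have as: "0 \<le> a s" using ab(1)[OF s'(2)] \<open>0 < b\<close> by simp
    \<comment> \<open>Once the potential energy is the square of \<open>r * (\<mu> * p s)\<close>,
      the cross term with \<open>q s\<close> costs only one factor \<open>sqrt (a s)\<close>. This
      is why the hypothesis on \<open>a - c\<close> carries a square root, while the one on
      \<open>a'\<close> does not.\<close>
    define r where "r = sqrt (a s)"
    have r: "0 \<le> r" "r\<^sup>2 = a s" using as by (auto simp: r_def)
    have E: "E s = (q s)\<^sup>2 + (r * (\<mu> * p s))\<^sup>2"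
      unfolding E_def r(2)[symmetric] by (simp add: power_mult_distrib)
    have "2 * ((a s - c s) * \<mu>\<^sup>2 * p s * q s) \<le> 2 * (\<bar>a s - c s\<bar> * \<mu>) * (\<bar>\<mu> * p s\<bar> * \<bar>q s\<bar>)"
    proof -
      have "2 * ((a s - c s) * \<mu>\<^sup>2 * p s * q s) \<le> 2 * \<bar>(a s - c s) * \<mu>\<^sup>2 * p s * q s\<bar>" by simp
      also have "\<dots> = 2 * (\<bar>a s - c s\<bar> * \<mu>) * (\<bar>\<mu> * p s\<bar> * \<bar>q s\<bar>)"
        using \<open>0 \<le> \<mu>\<close> by (simp add: abs_mult power2_eq_square)
      finally show ?thesis .
    qed
    also have "\<dots> \<le> 2 * (\<kappa> * r) * (\<bar>\<mu> * p s\<bar> * \<bar>q s\<bar>)"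
      using ac[OF s'(2)] unfolding r_def by (intro mult_right_mono mult_left_mono) auto
    also have "\<dots> = \<kappa> * (2 * \<bar>q s\<bar> * \<bar>r * (\<mu> * p s)\<bar>)"
      using r by (simp add: abs_mult)
    also have "\<dots> \<le> \<kappa> * E s"
      unfolding E using sum_squares_bound[of "\<bar>q s\<bar>" "\<bar>r * (\<mu> * p s)\<bar>"] \<open>0 \<le> \<kappa>\<close>
      by (intro mult_left_mono) auto
    finally have 1: "2 * ((a s - c s) * \<mu>\<^sup>2 * p s * q s) \<le> \<kappa> * E s" .
    have "a' s * (\<mu>\<^sup>2 * (p s)\<^sup>2) \<le> \<kappa> * a s * (\<mu>\<^sup>2 * (p s)\<^sup>2)"
      using a'[OF s'(2)] by (intro mult_right_mono) auto
    also have "\<dots> \<le> \<kappa> * E s"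
      unfolding E_def using \<open>0 \<le> \<kappa>\<close> by (simp add: algebra_simps)
    finally have 2: "a' s * (\<mu>\<^sup>2 * (p s)\<^sup>2) \<le> \<kappa> * E s" .
    have 3: "2 * q s * G \<le> (q s)\<^sup>2 + B"
      using sum_squares_bound[of "q s" G] G by simp
    have "2 * (r * (\<mu> * p s)) * (r * (\<mu> * F)) \<le> (r * (\<mu> * p s))\<^sup>2 + (r * (\<mu> * F))\<^sup>2"
      by (rule sum_squares_bound)
    also have "(r * (\<mu> * F))\<^sup>2 = a s * (\<mu>\<^sup>2 * F\<^sup>2)" by (simp add: power_mult_distrib r(2))
    also have "\<dots> \<le> A * B"
      using F ab(2)[OF s'(2)] as \<open>1 \<le> A\<close> by (intro mult_mono) auto
    finally have 4: "2 * (r * (\<mu> * p s)) * (r * (\<mu> * F)) \<le> (r * (\<mu> * p s))\<^sup>2 + A * B" by simp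
    have 5: "a s * (\<mu>\<^sup>2 * (2 * p s * F)) \<le> (r * (\<mu> * p s))\<^sup>2 + A * B"
    proof -
      have "a s * (\<mu>\<^sup>2 * (2 * p s * F)) = 2 * (r * (\<mu> * p s)) * (r * (\<mu> * F))"
        unfolding r(2)[symmetric] by (simp add: power2_eq_square mult_ac)
      then show ?thesis using 4 by presburger
    qed
    have "E' = 2 * ((a s - c s) * \<mu>\<^sup>2 * p s * q s) + a' s * (\<mu>\<^sup>2 * (p s)\<^sup>2) + 2 * q s * G
        + a s * (\<mu>\<^sup>2 * (2 * p s * F))"
      unfolding E'_def by (simp add: algebra_simps)
    also have "\<dots> \<le> K * E s + (1 + A) * B"
    proof -
      have "K * E s = 2 * (\<kappa> * E s) + E s" "(1 + A) * B = B + A * B"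
        unfolding K_def by (simp_all add: algebra_simps)
      with 1 2 3 5 E show ?thesis by linarith
    qed
    finally have E'_le: "E' - K * E s \<le> (1 + A) * B" by simp
    have "exp (- (K * s)) * (E' - K * E s) \<le> exp (- (K * s)) * ((1 + A) * B)"
      using E'_le by (intro mult_left_mono) auto
    also have "\<dots> \<le> 1 * ((1 + A) * B)"
      using K s \<open>1 \<le> A\<close> \<open>0 \<le> B\<close> by (intro mult_right_mono) auto
    finally have "exp (- (K * s)) * (E' - K * E s) - (1 + A) * B \<le> 0" by simp
    moreover have "(W has_real_derivative exp (- (K * s)) * (E' - K * E s) - (1 + A) * B) (at s)"
    proof -
      have "((\<lambda>s. exp (- (K * s))) has_real_derivative exp (- (K * s)) * - K) (at s)"
        by (auto intro!: derivative_eq_intros)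
      from DERIV_diff[OF DERIV_mult[OF this dE] DERIV_cmult_right[OF DERIV_ident, of "(1 + A) * B"]]
      show ?thesis unfolding W_def by (rule DERIV_cong) (simp add: algebra_simps)
    qed
    ultimately show "\<exists>y. (W has_real_derivative y) (at s) \<and> y \<le> 0" by blast
  qed
  then have "exp (- (K * t)) * E t \<le> E 0 + t * ((1 + A) * B)" by (simp add: W_def)
  then have "E t = exp (K * t) * (exp (- (K * t)) * E t)"
    by (simp add: exp_minus)
  also have "\<dots> \<le> exp (K * t) * (E 0 + t * ((1 + A) * B))"
    using \<open>exp (- (K * t)) * E t \<le> _\<close> by (intro mult_left_mono) auto
  finally have Et: "E t \<le> exp (K * t) * (E 0 + t * ((1 + A) * B))" .
  have "b * ((q t)\<^sup>2 + \<mu>\<^sup>2 * (p t)\<^sup>2) = b * (q t)\<^sup>2 + b * (\<mu>\<^sup>2 * (p t)\<^sup>2)"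
    by (simp add: algebra_simps)
  also have "\<dots> \<le> 1 * (q t)\<^sup>2 + a t * (\<mu>\<^sup>2 * (p t)\<^sup>2)"
    using ab(1)[OF t] \<open>b \<le> 1\<close> by (intro add_mono mult_right_mono) auto
  also have "\<dots> = E t" by (simp add: E_def)
  also have "\<dots> \<le> exp (K * t) * (E 0 + t * ((1 + A) * B))" by (rule Et)
  also have "\<dots> \<le> exp (K * t) * (2 * A * ((q 0)\<^sup>2 + \<mu>\<^sup>2 * (p 0)\<^sup>2 + t * B))"
  proof -
    have "E 0 + t * ((1 + A) * B) \<le> 2 * A * ((q 0)\<^sup>2 + \<mu>\<^sup>2 * (p 0)\<^sup>2 + t * B)"
    proof -
      have "E 0 \<le> 1 * (q 0)\<^sup>2 + A * (\<mu>\<^sup>2 * (p 0)\<^sup>2)"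
        unfolding E_def using ab(2)[of 0] t by (intro add_mono mult_right_mono) auto
      also have "\<dots> \<le> 2 * A * (q 0)\<^sup>2 + 2 * A * (\<mu>\<^sup>2 * (p 0)\<^sup>2)"
        using \<open>1 \<le> A\<close> by (intro add_mono mult_right_mono) auto
      finally have E0: "E 0 \<le> 2 * A * (q 0)\<^sup>2 + 2 * A * (\<mu>\<^sup>2 * (p 0)\<^sup>2)" .
      have "t * ((1 + A) * B) \<le> t * (2 * A * B)"
        using t \<open>1 \<le> A\<close> \<open>0 \<le> B\<close> by (intro mult_left_mono mult_right_mono) auto
      moreover have "2 * A * ((q 0)\<^sup>2 + \<mu>\<^sup>2 * (p 0)\<^sup>2 + t * B) =
          2 * A * (q 0)\<^sup>2 + 2 * A * (\<mu>\<^sup>2 * (p 0)\<^sup>2) + t * (2 * A * B)"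
        by (simp add: algebra_simps)
      ultimately show ?thesis using E0 by linarith
    qed
    then show ?thesis by (intro mult_left_mono) auto
  qed
  finally show ?thesis unfolding K_def by (simp only: mult_ac)
qed

text \<open>At bounded frequency the constant coefficient 1 is a good enough approximation, as
  \<open>\<bar>1 - c s\<bar> * \<mu>\<close> is at most \<open>(1 + M) * \<mu>0\<close>;
  \<open>c\<close> may vanish here.\<close>

lemma mode_bound_low:
  assumes "forced_mode \<mu> c \<delta> B p q" "0 \<le> \<mu>" "\<mu> \<le> \<mu>0"
    and "\<And>s. 0 \<le> c s \<and> c s \<le> M" "0 \<le> B" "t \<in> {0..\<delta>}"
  shows "(q t)\<^sup>2 + \<mu>\<^sup>2 * (p t)\<^sup>2 \<le>
    2 * exp ((2 * ((1 + M) * \<mu>0) + 1) * t) * ((q 0)\<^sup>2 + \<mu>\<^sup>2 * (p 0)\<^sup>2 + t * B)"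
proof -
  have M: "0 \<le> M" using assms(4)[of 0] by linarith
  have "\<bar>1 - c s\<bar> * \<mu> \<le> (1 + M) * \<mu>0" for s
    using assms(2,3) assms(4)[of s] M by (intro mult_mono) auto
  then show ?thesis
    using energy_growth[of \<mu> c \<delta> B p q "\<lambda>_. 1" "\<lambda>_. 0" "(1 + M) * \<mu>0" 1 1 t] assms M by simp
qed

text \<open>A longer averaging window lowers the bound on the slope but raises the one on the error.
  The best window depends on the frequency, and its choice is what separates the strict from the
  weak case.\<close>

lemma moving_average_modulus:
  assumes \<omega>: "cont_modulus \<omega>" and "0 \<le> L" and c: "\<And>s t. \<bar>c s - c t\<bar> \<le> L * \<omega> \<bar>s - t\<bar>"
    and "0 < \<epsilon>"
  obtains a a' where "\<And>t. t \<in> {0..\<delta>} \<Longrightarrow> (a has_real_derivative a' t) (at t)"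
    and "\<And>t. t \<in> {0..\<delta>} \<Longrightarrow> \<bar>a' t\<bar> \<le> L * \<omega> \<epsilon> / \<epsilon>"
    and "\<And>t. t \<in> {0..\<delta>} \<Longrightarrow> \<bar>a t - c t\<bar> \<le> L * \<omega> \<epsilon>"
    and "\<And>t. t \<in> {0..\<delta>} \<Longrightarrow> \<exists>\<xi>. a t = c \<xi>"
proof -
  obtain a where a: "\<And>t. t \<in> {0..\<delta>} \<Longrightarrow> (a has_real_derivative (c (t + \<epsilon>) - c t) / \<epsilon>) (at t)"
    and \<xi>: "\<And>t. t \<in> {0..\<delta>} \<Longrightarrow> \<exists>\<xi>\<in>{t..t + \<epsilon>}. a t = c \<xi>"
    using moving_average[OF omega_continuous_imp_continuous[OF \<omega> c] \<open>0 < \<epsilon>\<close>, where \<delta> = \<delta>]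
    by blast
  show ?thesis
  proof (rule that[of a "\<lambda>t. (c (t + \<epsilon>) - c t) / \<epsilon>"])
    fix t assume t: "t \<in> {0..\<delta>}"
    show "(a has_real_derivative (c (t + \<epsilon>) - c t) / \<epsilon>) (at t)" by (rule a[OF t])
    have "\<bar>c (t + \<epsilon>) - c t\<bar> \<le> L * \<omega> \<epsilon>" using c[of "t + \<epsilon>" t] \<open>0 < \<epsilon>\<close> by simp
    then show "\<bar>(c (t + \<epsilon>) - c t) / \<epsilon>\<bar> \<le> L * \<omega> \<epsilon> / \<epsilon>"
      using \<open>0 < \<epsilon>\<close> by (simp add: divide_right_mono)
    obtain x where x: "x \<in> {t..t + \<epsilon>}" "a t = c x" using \<xi>[OF t] by blast
    have "\<bar>c x - c t\<bar> \<le> L * \<omega> \<bar>x - t\<bar>" by (rule c)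
    also have "\<dots> \<le> L * \<omega> \<epsilon>"
      using x \<open>0 \<le> L\<close> by (intro mult_left_mono cont_modulus_mono[OF \<omega>]) auto
    finally show "\<bar>a t - c t\<bar> \<le> L * \<omega> \<epsilon>" using x by simp
    show "\<exists>\<xi>. a t = c \<xi>" using x by blast
  qed
qed

text \<open>With window \<open>1 / \<mu>\<close> the error times \<open>\<mu>\<close> and the slope
  have the same bound \<open>L * (\<mu> * \<omega> (1 / \<mu>))\<close>. The lower bound
  \<open>b\<close> on \<open>c\<close> turns it into a multiple of the energy, at the cost of
  dividing by \<open>b\<close>.\<close>

lemma mode_bound_strict:
  assumes \<omega>: "cont_modulus \<omega>" and "0 \<le> L" and c: "\<And>s t. \<bar>c s - c t\<bar> \<le> L * \<omega> \<bar>s - t\<bar>"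
    and mode: "forced_mode \<mu> c \<delta> B p q" and "0 < \<mu>" "0 < b" "b \<le> 1" "1 \<le> A"
    and cb: "\<And>s. b \<le> c s \<and> c s \<le> A"
    and X: "L * (\<mu> * \<omega> (1 / \<mu>)) \<le> X" and "0 \<le> B" and t: "t \<in> {0..\<delta>}"
  shows "b * ((q t)\<^sup>2 + \<mu>\<^sup>2 * (p t)\<^sup>2) \<le>
    2 * A * exp ((2 * (X / b) + 1) * t) * ((q 0)\<^sup>2 + \<mu>\<^sup>2 * (p 0)\<^sup>2 + t * B)"
proof -
  obtain a a' where a: "\<And>t. t \<in> {0..\<delta>} \<Longrightarrow> (a has_real_derivative a' t) (at t)"
    and a': "\<And>t. t \<in> {0..\<delta>} \<Longrightarrow> \<bar>a' t\<bar> \<le> L * \<omega> (1 / \<mu>) / (1 / \<mu>)"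
    and ac: "\<And>t. t \<in> {0..\<delta>} \<Longrightarrow> \<bar>a t - c t\<bar> \<le> L * \<omega> (1 / \<mu>)"
    and \<xi>: "\<And>t. t \<in> {0..\<delta>} \<Longrightarrow> \<exists>\<xi>. a t = c \<xi>"
    using moving_average_modulus[OF \<omega> \<open>0 \<le> L\<close> c, of "1 / \<mu>" \<delta>] \<open>0 < \<mu>\<close> by auto
  have ab: "b \<le> a t \<and> a t \<le> A" if "t \<in> {0..\<delta>}" for t
    using \<xi>[OF that] cb by metis
  have "0 \<le> L * (\<mu> * \<omega> (1 / \<mu>))"
    using \<open>0 \<le> L\<close> \<open>0 < \<mu>\<close> cont_modulus_pos[OF \<omega>, of "1 / \<mu>"] by simp
  then have X0: "0 \<le> X" using X by linarith
  show ?thesis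
  proof (rule energy_growth[OF mode _ a])
    fix s assume s: "s \<in> {0..\<delta>}"
    \<comment> \<open>As \<open>b \<le> 1\<close>, also \<open>b \<le> sqrt b\<close>, so one
      constant \<open>X / b\<close> serves both the \<open>sqrt (a s)\<close> and the
      \<open>a s\<close> estimate.\<close>
    have "b * b \<le> b * 1" using \<open>0 < b\<close> \<open>b \<le> 1\<close> by (intro mult_left_mono) auto
    then have "b \<le> sqrt b" using \<open>0 < b\<close> by (intro real_le_rsqrt) (simp add: power2_eq_square)
    then have sb: "b \<le> sqrt (a s)" using ab[OF s] real_sqrt_le_mono[of b "a s"] by linarith
    have "\<bar>a s - c s\<bar> * \<mu> \<le> L * \<omega> (1 / \<mu>) * \<mu>"
      using ac[OF s] \<open>0 < \<mu>\<close> by (intro mult_right_mono) auto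
    also have "\<dots> \<le> X" using X by (simp add: mult_ac)
    also have "X = X / b * b" using \<open>0 < b\<close> by simp
    also have "\<dots> \<le> X / b * sqrt (a s)" using sb X0 \<open>0 < b\<close> by (intro mult_left_mono) auto
    finally show "\<bar>a s - c s\<bar> * \<mu> \<le> X / b * sqrt (a s)" .
    have "\<bar>a' s\<bar> \<le> X" using a'[OF s] X by (simp add: mult_ac)
    also have "X = X / b * b" using \<open>0 < b\<close> by simp
    also have "\<dots> \<le> X / b * a s" using ab[OF s] X0 \<open>0 < b\<close> by (intro mult_left_mono) auto
    finally show "\<bar>a' s\<bar> \<le> X / b * a s" .
  qed (use assms ab X0 in auto)
qed

text \<open>The energy uses \<open>c\<close> averaged over length \<open>1/\<sigma>\<close> plus \<open>\<omega>(1/\<sigma>)\<close>; the relation between \<open>\<mu>\<close>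
  and \<open>\<sigma>\<close> balances the approximation error \<open>\<mu> \<surd>\<omega>(1/\<sigma>)\<close> against the logarithmic derivative \<open>\<sigma>\<close>.\<close>

lemma mode_bound_weak:
  assumes \<omega>: "cont_modulus \<omega>" and "0 \<le> L" and c: "\<And>s t. \<bar>c s - c t\<bar> \<le> L * \<omega> \<bar>s - t\<bar>"
    and mode: "forced_mode \<mu> c \<delta> B p q" and "1 \<le> \<sigma>" and \<mu>: "\<mu> = \<sigma> / sqrt (\<omega> (1 / \<sigma>))"
    and cb: "\<And>s. 0 \<le> c s \<and> c s \<le> M" and "0 \<le> B" and t: "t \<in> {0..\<delta>}"
  shows "min 1 (\<omega> (1 / \<sigma>)) * ((q t)\<^sup>2 + \<mu>\<^sup>2 * (p t)\<^sup>2) \<le>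
    2 * (1 + M + \<omega> 1) * exp ((2 * ((L + 1) * \<sigma>) + 1) * t) * ((q 0)\<^sup>2 + \<mu>\<^sup>2 * (p 0)\<^sup>2 + t * B)"
proof -
  define w where "w = \<omega> (1 / \<sigma>)"
  have w: "0 < w" unfolding w_def using \<open>1 \<le> \<sigma>\<close> by (intro cont_modulus_pos[OF \<omega>]) auto
  have w1: "w \<le> \<omega> 1" unfolding w_def using \<open>1 \<le> \<sigma>\<close> by (intro cont_modulus_mono[OF \<omega>]) auto
  have M: "0 \<le> M" using cb[of 0] by linarith
  obtain a a' where a: "\<And>t. t \<in> {0..\<delta>} \<Longrightarrow> (a has_real_derivative a' t) (at t)"
    and a': "\<And>t. t \<in> {0..\<delta>} \<Longrightarrow> \<bar>a' t\<bar> \<le> L * w / (1 / \<sigma>)"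
    and ac: "\<And>t. t \<in> {0..\<delta>} \<Longrightarrow> \<bar>a t - c t\<bar> \<le> L * w"
    and \<xi>: "\<And>t. t \<in> {0..\<delta>} \<Longrightarrow> \<exists>\<xi>. a t = c \<xi>"
    using moving_average_modulus[OF \<omega> \<open>0 \<le> L\<close> c, of "1 / \<sigma>" \<delta>] \<open>1 \<le> \<sigma>\<close>
    unfolding w_def by auto
  have ab: "0 \<le> a t \<and> a t \<le> M" if "t \<in> {0..\<delta>}" for t
    using \<xi>[OF that] cb by metis
  \<comment> \<open>The balance: the error \<open>(L + 1) * w * \<mu>\<close> becomes
    \<open>(L + 1) * \<sigma>\<close> times \<open>sqrt w\<close>. Since the average may vanish, the
    shift by \<open>w\<close> alone provides this root.\<close>
  have \<mu>w: "w * \<mu> = \<sigma> * sqrt w"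
    unfolding \<mu> w_def[symmetric] using w by (simp add: field_simps)
  show ?thesis unfolding w_def[symmetric]
  proof (rule energy_growth[OF mode, where a = "\<lambda>s. a s + w" and a' = a'])
    show "0 \<le> \<mu>" unfolding \<mu> w_def[symmetric] using w \<open>1 \<le> \<sigma>\<close> by simp
    fix s assume s: "s \<in> {0..\<delta>}"
    show "((\<lambda>s. a s + w) has_real_derivative a' s) (at s)"
      using DERIV_add[OF a[OF s] DERIV_const[of w]] by simp
    have "\<bar>a s + w - c s\<bar> \<le> (L + 1) * w" using ac[OF s] w by (simp add: algebra_simps)
    then have "\<bar>a s + w - c s\<bar> * \<mu> \<le> (L + 1) * w * \<mu>"
      using \<open>0 \<le> \<mu>\<close> by (rule mult_right_mono)
    also have "\<dots> = (L + 1) * \<sigma> * sqrt w" using \<mu>w by (simp add: mult.assoc)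
    also have "\<dots> \<le> (L + 1) * \<sigma> * sqrt (a s + w)"
      using ab[OF s] \<open>0 \<le> L\<close> \<open>1 \<le> \<sigma>\<close> by (intro mult_left_mono) auto
    finally show "\<bar>a s + w - c s\<bar> * \<mu> \<le> (L + 1) * \<sigma> * sqrt (a s + w)" .
    have "\<bar>a' s\<bar> \<le> L * \<sigma> * w" using a'[OF s] by (simp add: mult_ac)
    also have "\<dots> \<le> (L + 1) * \<sigma> * (a s + w)"
      using ab[OF s] w \<open>0 \<le> L\<close> \<open>1 \<le> \<sigma>\<close> by (intro mult_mono) auto
    finally show "\<bar>a' s\<bar> \<le> (L + 1) * \<sigma> * (a s + w)" .
    show "min 1 w \<le> a s + w" "a s + w \<le> 1 + M + \<omega> 1" using ab[OF s] w w1 by auto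
  qed (use assms w M w1 in auto)
qed

text \<open>Only solvability for \<open>\<sigma>\<close> matters, so the intermediate value theorem
  replaces an inversion. At \<open>\<sigma> = 1\<close> the right-hand side is the threshold
  \<open>1 / sqrt (\<omega> 1)\<close>.\<close>

lemma weak_frequency:
  assumes \<omega>: "cont_modulus \<omega>" and \<mu>: "1 / sqrt (\<omega> 1) \<le> \<mu>"
  obtains \<sigma> where "1 \<le> \<sigma>" "\<mu> = \<sigma> / sqrt (\<omega> (1 / \<sigma>))"
proof -
  have w: "0 < \<omega> 1" by (rule cont_modulus_pos[OF \<omega>]) simp
  \<comment> \<open>Since \<open>\<omega> (1 / X) \<le> \<omega> 1\<close>, the value at
    \<open>X\<close> is at least \<open>X / sqrt (\<omega> 1)\<close>, hence at least
    \<open>\<mu>\<close>.\<close>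
  define X where "X = max 1 (\<mu> * sqrt (\<omega> 1))"
  have X: "1 \<le> X" by (simp add: X_def)
  have c\<omega>: "continuous_on {0..} \<omega>" using \<omega> by (simp add: cont_modulus_def)
  have "continuous_on {1..X} (\<lambda>\<sigma>. \<omega> (1 / \<sigma>))"
    by (rule continuous_on_compose2[OF c\<omega>]) (auto intro!: continuous_intros)
  moreover have "\<omega> (1 / \<sigma>) \<noteq> 0" if "\<sigma> \<in> {1..X}" for \<sigma>
    using cont_modulus_pos[OF \<omega>, of "1 / \<sigma>"] that by auto
  ultimately have "continuous_on {1..X} (\<lambda>\<sigma>. \<sigma> / sqrt (\<omega> (1 / \<sigma>)))"
    by (intro continuous_intros) auto
  moreover have "\<mu> \<le> X / sqrt (\<omega> (1 / X))"
  proof -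
    have wX: "0 < \<omega> (1 / X)" using X by (intro cont_modulus_pos[OF \<omega>]) auto
    have wX1: "\<omega> (1 / X) \<le> \<omega> 1" using X by (intro cont_modulus_mono[OF \<omega>]) auto
    have "\<mu> \<le> X / sqrt (\<omega> 1)" unfolding X_def using w by (simp add: pos_le_divide_eq)
    also have "\<dots> \<le> X / sqrt (\<omega> (1 / X))"
      using wX wX1 X by (intro divide_left_mono) auto
    finally show ?thesis .
  qed
  ultimately have "\<exists>\<sigma>\<ge>1. \<sigma> \<le> X \<and> \<sigma> / sqrt (\<omega> (1 / \<sigma>)) = \<mu>"
    using \<mu> X by (intro IVT') auto
  with that show ?thesis by blast
qed

text \<open>Low frequencies get weight \<open>0\<close>: \<open>\<phi>\<close> may be unbounded there, and membership in \<open>\<G>\<close>, whose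
  norm carries the factor \<open>\<lambda>\<^sub>k\<^sup>4\<^sup>\<alpha>\<close>, does not control \<open>exp (r \<phi>(\<lambda>\<^sub>k)) u\<^sub>k\<^sup>2\<close> for small \<open>\<lambda>\<^sub>k\<close>.\<close>

definition growth_weight :: "(real \<Rightarrow> real) \<Rightarrow> real \<Rightarrow> real \<Rightarrow> real"
  where "growth_weight \<phi> \<mu>0 \<mu> = (if \<mu> \<le> \<mu>0 then 0 else \<phi> \<mu>)"

text \<open>The sign of \<open>\<nu>\<close> records the case. With the bound
  \<open>\<nu> \<le> m\<close> stated separately, everything after the high-frequency estimate
  treats both cases at once.\<close>

definition hyperbolicity :: "(real \<Rightarrow> real) \<Rightarrow> (real \<Rightarrow> real) \<Rightarrow> real \<Rightarrow> bool"
  where "hyperbolicity \<omega> \<phi> \<nu> \<longleftrightarrow>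
    \<nu> > 0 \<and> (\<exists>\<Lambda>. \<forall>\<sigma>>0. \<sigma> * \<omega> (1 / \<sigma>) \<le> \<Lambda> * \<phi> \<sigma>) \<or>
    \<nu> = 0 \<and> (\<exists>\<Lambda>. \<forall>\<sigma>>0. \<sigma> \<le> \<Lambda> * \<phi> (\<sigma> / sqrt (\<omega> (1 / \<sigma>))))"

text \<open>Both cases give the exponential rate \<open>K * \<phi> \<mu>\<close>. The factor
  \<open>1 + \<phi> \<mu>\<close> comes from the weak case, where the energy controls the modes only
  after division by \<open>min 1 (\<omega> (1 / \<sigma>))\<close>.\<close>

lemma mode_bound_high:
  assumes \<omega>: "cont_modulus \<omega>" and "0 \<le> L" "0 \<le> M" and \<phi>: "\<forall>\<sigma>\<ge>0. \<phi> \<sigma> > 0"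
    and hyp: "hyperbolicity \<omega> \<phi> \<nu>"
  obtains C K \<mu>0 where "0 < C" "0 \<le> K" "1 \<le> \<mu>0"
    "\<And>\<mu> c \<delta> B p q t. \<lbrakk>forced_mode \<mu> c \<delta> B p q; \<mu>0 < \<mu>; \<And>s. \<nu> \<le> c s \<and> c s \<le> M;
      \<And>s t. \<bar>c s - c t\<bar> \<le> L * \<omega> \<bar>s - t\<bar>; 0 \<le> B; t \<in> {0..\<delta>}\<rbrakk> \<Longrightarrow>
      (q t)\<^sup>2 + \<mu>\<^sup>2 * (p t)\<^sup>2 \<le>
        C * (1 + \<phi> \<mu>) * exp ((2 * (K * \<phi> \<mu>) + 1) * t) * ((q 0)\<^sup>2 + \<mu>\<^sup>2 * (p 0)\<^sup>2 + t * B)"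
  using hyp unfolding hyperbolicity_def
proof (elim disjE conjE exE)
  fix \<Lambda> assume \<nu>: "0 < \<nu>" and \<Lambda>: "\<forall>\<sigma>>0. \<sigma> * \<omega> (1 / \<sigma>) \<le> \<Lambda> * \<phi> \<sigma>"
  define b where "b = min 1 \<nu>"
  have b: "0 < b" "b \<le> 1" using \<nu> by (auto simp: b_def)
  show ?thesis
  proof (rule that[of "2 * (1 + M) / b" "L * \<bar>\<Lambda>\<bar> / b" 1])
    show "0 < 2 * (1 + M) / b" "0 \<le> L * \<bar>\<Lambda>\<bar> / b" using b assms by auto
    fix \<mu> c \<delta> B p q t
    assume mode: "forced_mode \<mu> c \<delta> B p q" and \<mu>: "1 < \<mu>" and cb: "\<And>s. \<nu> \<le> c s \<and> c s \<le> M"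
      and c: "\<And>s t. \<bar>c s - c t\<bar> \<le> L * \<omega> \<bar>s - t\<bar>" and B: "0 \<le> B" and t: "t \<in> {0..\<delta>}"
    define R where "R = exp ((2 * (L * \<bar>\<Lambda>\<bar> / b * \<phi> \<mu>) + 1) * t) *
      ((q 0)\<^sup>2 + \<mu>\<^sup>2 * (p 0)\<^sup>2 + t * B)"
    have R: "0 \<le> R" unfolding R_def using B t by auto
    have \<phi>\<mu>: "0 < \<phi> \<mu>" using \<phi> \<mu> by simp
    have "L * (\<mu> * \<omega> (1 / \<mu>)) \<le> L * (\<bar>\<Lambda>\<bar> * \<phi> \<mu>)"
    proof (rule mult_left_mono)
      have "\<mu> * \<omega> (1 / \<mu>) \<le> \<Lambda> * \<phi> \<mu>" using \<Lambda> \<mu> by simp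
      also have "\<dots> \<le> \<bar>\<Lambda>\<bar> * \<phi> \<mu>" using \<phi>\<mu> by (intro mult_right_mono) auto
      finally show "\<mu> * \<omega> (1 / \<mu>) \<le> \<bar>\<Lambda>\<bar> * \<phi> \<mu>" .
    qed fact
    then have "b * ((q t)\<^sup>2 + \<mu>\<^sup>2 * (p t)\<^sup>2) \<le> 2 * (1 + M) *
        exp ((2 * (L * (\<bar>\<Lambda>\<bar> * \<phi> \<mu>) / b) + 1) * t) * ((q 0)\<^sup>2 + \<mu>\<^sup>2 * (p 0)\<^sup>2 + t * B)"
      using \<mu> b \<open>0 \<le> M\<close>
    proof (intro mode_bound_strict[OF \<omega> \<open>0 \<le> L\<close> c mode _ _ _ _ _ _ B t])
      show "b \<le> c s \<and> c s \<le> 1 + M" for s using cb[of s] by (auto simp: b_def)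
    qed auto
    then have "b * ((q t)\<^sup>2 + \<mu>\<^sup>2 * (p t)\<^sup>2) \<le> 2 * (1 + M) * R"
      unfolding R_def by (simp add: mult_ac)
    then have "(q t)\<^sup>2 + \<mu>\<^sup>2 * (p t)\<^sup>2 \<le> 2 * (1 + M) / b * 1 * R"
      using b by (simp add: field_simps)
    also have "\<dots> \<le> 2 * (1 + M) / b * (1 + \<phi> \<mu>) * R"
      using R \<phi>\<mu> b \<open>0 \<le> M\<close> by (intro mult_right_mono mult_left_mono) auto
    finally show "(q t)\<^sup>2 + \<mu>\<^sup>2 * (p t)\<^sup>2 \<le> 2 * (1 + M) / b * (1 + \<phi> \<mu>) *
        exp ((2 * (L * \<bar>\<Lambda>\<bar> / b * \<phi> \<mu>) + 1) * t) * ((q 0)\<^sup>2 + \<mu>\<^sup>2 * (p 0)\<^sup>2 + t * B)"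
      unfolding R_def by (simp only: mult.assoc)
  qed simp
next
  fix \<Lambda> assume \<nu>: "\<nu> = 0" and \<Lambda>: "\<forall>\<sigma>>0. \<sigma> \<le> \<Lambda> * \<phi> (\<sigma> / sqrt (\<omega> (1 / \<sigma>)))"
  have w: "0 < \<omega> 1" by (rule cont_modulus_pos[OF \<omega>]) simp
  define D where "D = 1 + (\<bar>\<Lambda>\<bar> + 1) / \<omega> 1"
  have D: "0 < D" using w unfolding D_def by (intro add_pos_nonneg) auto
  define A where "A = 1 + M + \<omega> 1"
  have A: "0 < A" using w \<open>0 \<le> M\<close> by (simp add: A_def)
  show ?thesis
  proof (rule that[of "2 * A * D" "(L + 1) * \<bar>\<Lambda>\<bar>" "max 1 (1 / sqrt (\<omega> 1))"])
    show "0 < 2 * A * D" "0 \<le> (L + 1) * \<bar>\<Lambda>\<bar>" using D A assms by auto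
    fix \<mu> c \<delta> B p q t
    assume mode: "forced_mode \<mu> c \<delta> B p q" and \<mu>: "max 1 (1 / sqrt (\<omega> 1)) < \<mu>"
      and cb: "\<And>s. \<nu> \<le> c s \<and> c s \<le> M"
      and c: "\<And>s t. \<bar>c s - c t\<bar> \<le> L * \<omega> \<bar>s - t\<bar>" and B: "0 \<le> B" and t: "t \<in> {0..\<delta>}"
    obtain \<sigma> where \<sigma>: "1 \<le> \<sigma>" and \<mu>\<sigma>: "\<mu> = \<sigma> / sqrt (\<omega> (1 / \<sigma>))"
      using weak_frequency[OF \<omega>, of \<mu>] \<mu> by auto
    define b where "b = min 1 (\<omega> (1 / \<sigma>))"
    define R where "R = (q 0)\<^sup>2 + \<mu>\<^sup>2 * (p 0)\<^sup>2 + t * B"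
    have R: "0 \<le> R" unfolding R_def using B t by auto
    have \<phi>\<mu>: "0 < \<phi> \<mu>" using \<phi> \<mu> by simp
    have "\<sigma> \<le> \<Lambda> * \<phi> \<mu>" using \<Lambda> \<sigma> \<mu>\<sigma> by simp
    also have "\<dots> \<le> \<bar>\<Lambda>\<bar> * \<phi> \<mu>" using \<phi>\<mu> by (intro mult_right_mono) auto
    finally have \<sigma>\<phi>: "\<sigma> \<le> \<bar>\<Lambda>\<bar> * \<phi> \<mu>" .
    have w\<sigma>: "0 < \<omega> (1 / \<sigma>)" using \<sigma> by (intro cont_modulus_pos[OF \<omega>]) auto
    have b: "0 < b" using w\<sigma> by (simp add: b_def)
    \<comment> \<open>Degeneracy costs only a linear factor: subadditivity gives \<open>1 / \<omega>
      (1 / \<sigma>) \<le> (\<sigma> + 1) / \<omega> 1\<close>, and weak hyperbolicity bounds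
      \<open>\<sigma>\<close> by a multiple of \<open>\<phi> \<mu>\<close>.\<close>
    have "1 / b \<le> D * (1 + \<phi> \<mu>)"
    proof -
      have "\<omega> (\<sigma> * (1 / \<sigma>)) \<le> (\<sigma> + 1) * \<omega> (1 / \<sigma>)"
        using \<sigma> by (intro cont_modulus_mult[OF \<omega>]) auto
      then have "\<omega> 1 \<le> (\<sigma> + 1) * \<omega> (1 / \<sigma>)" using \<sigma> by simp
      then have "1 / \<omega> (1 / \<sigma>) \<le> (\<sigma> + 1) / \<omega> 1" using w w\<sigma> by (simp add: field_simps)
      moreover have "1 / b \<le> 1 + 1 / \<omega> (1 / \<sigma>)" using w\<sigma> by (auto simp: b_def min_def)
      moreover have "(\<sigma> + 1) / \<omega> 1 \<le> (\<bar>\<Lambda>\<bar> + 1) * (1 + \<phi> \<mu>) / \<omega> 1"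
      proof (rule divide_right_mono)
        show "\<sigma> + 1 \<le> (\<bar>\<Lambda>\<bar> + 1) * (1 + \<phi> \<mu>)" using \<sigma>\<phi> \<phi>\<mu> by (simp add: algebra_simps)
      qed (use w in simp)
      moreover have "D * (1 + \<phi> \<mu>) = 1 + \<phi> \<mu> + (\<bar>\<Lambda>\<bar> + 1) * (1 + \<phi> \<mu>) / \<omega> 1"
        unfolding D_def by (simp add: algebra_simps add_divide_distrib)
      ultimately show ?thesis using \<phi>\<mu> by linarith
    qed
    then have bD: "1 \<le> b * (D * (1 + \<phi> \<mu>))" using b by (simp add: field_simps)
    have e: "exp ((2 * ((L + 1) * \<sigma>) + 1) * t) \<le> exp ((2 * ((L + 1) * \<bar>\<Lambda>\<bar> * \<phi> \<mu>) + 1) * t)"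
      using \<sigma>\<phi> \<open>0 \<le> L\<close> t by (auto intro!: mult_right_mono simp: mult.assoc mult_left_mono)
    have "b * ((q t)\<^sup>2 + \<mu>\<^sup>2 * (p t)\<^sup>2) \<le> 2 * A * exp ((2 * ((L + 1) * \<sigma>) + 1) * t) * R"
      using cb \<nu> mode_bound_weak[OF \<omega> \<open>0 \<le> L\<close> c mode \<sigma> \<mu>\<sigma> _ B t, of M]
      unfolding b_def A_def R_def by blast
    also have "\<dots> \<le> 2 * A * exp ((2 * ((L + 1) * \<bar>\<Lambda>\<bar> * \<phi> \<mu>) + 1) * t) * R"
      using e R A by (intro mult_right_mono mult_left_mono) auto
    also have "\<dots> \<le> (b * (D * (1 + \<phi> \<mu>))) *
        (2 * A * exp ((2 * ((L + 1) * \<bar>\<Lambda>\<bar> * \<phi> \<mu>) + 1) * t) * R)"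
      using mult_right_mono[OF bD, of "2 * A * exp ((2 * ((L + 1) * \<bar>\<Lambda>\<bar> * \<phi> \<mu>) + 1) * t) * R"] R A by simp
    finally have "b * ((q t)\<^sup>2 + \<mu>\<^sup>2 * (p t)\<^sup>2) \<le>
        b * (2 * A * D * (1 + \<phi> \<mu>) * exp ((2 * ((L + 1) * \<bar>\<Lambda>\<bar> * \<phi> \<mu>) + 1) * t) * R)"
      by (simp only: mult_ac)
    then show "(q t)\<^sup>2 + \<mu>\<^sup>2 * (p t)\<^sup>2 \<le> 2 * A * D * (1 + \<phi> \<mu>) *
        exp ((2 * ((L + 1) * \<bar>\<Lambda>\<bar> * \<phi> \<mu>) + 1) * t) * ((q 0)\<^sup>2 + \<mu>\<^sup>2 * (p 0)\<^sup>2 + t * B)"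
      unfolding R_def[symmetric] using b by simp
  qed simp
qed

text \<open>An arbitrarily small \<open>\<eta>\<close> is possible because the rate
  \<open>K * \<phi> \<mu>\<close> is multiplied by the time. Half of \<open>\<eta>\<close> pays for
  this growth on a short interval, the other half absorbs the factor
  \<open>1 + \<phi> \<mu>\<close>.\<close>

lemma mode_bound:
  assumes \<omega>: "cont_modulus \<omega>" and "0 \<le> L" "0 \<le> M" and \<phi>: "\<forall>\<sigma>\<ge>0. \<phi> \<sigma> > 0"
    and hyp: "hyperbolicity \<omega> \<phi> \<nu>" and "0 < \<eta>"
  obtains C \<tau> \<mu>0 where "0 < C" "0 < \<tau>" "1 \<le> \<mu>0"
    "\<And>\<mu> c \<delta> B p q t. \<lbrakk>forced_mode \<mu> c \<delta> B p q; 0 \<le> \<mu>; \<And>s. \<nu> \<le> c s \<and> c s \<le> M;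
      \<And>s t. \<bar>c s - c t\<bar> \<le> L * \<omega> \<bar>s - t\<bar>; 0 \<le> B; \<delta> \<le> \<tau>; t \<in> {0..\<delta>}\<rbrakk> \<Longrightarrow>
      (q t)\<^sup>2 + \<mu>\<^sup>2 * (p t)\<^sup>2 \<le>
        C * exp (\<eta> * growth_weight \<phi> \<mu>0 \<mu>) * ((q 0)\<^sup>2 + \<mu>\<^sup>2 * (p 0)\<^sup>2 + t * B)"
proof -
  obtain C K \<mu>0 where C: "0 < C" and K: "0 \<le> K" and \<mu>0: "1 \<le> \<mu>0" and high:
    "\<And>\<mu> c \<delta> B p q t. \<lbrakk>forced_mode \<mu> c \<delta> B p q; \<mu>0 < \<mu>; \<And>s. \<nu> \<le> c s \<and> c s \<le> M;
      \<And>s t. \<bar>c s - c t\<bar> \<le> L * \<omega> \<bar>s - t\<bar>; 0 \<le> B; t \<in> {0..\<delta>}\<rbrakk> \<Longrightarrow>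
      (q t)\<^sup>2 + \<mu>\<^sup>2 * (p t)\<^sup>2 \<le>
        C * (1 + \<phi> \<mu>) * exp ((2 * (K * \<phi> \<mu>) + 1) * t) * ((q 0)\<^sup>2 + \<mu>\<^sup>2 * (p 0)\<^sup>2 + t * B)"
    using mode_bound_high[OF \<omega> \<open>0 \<le> L\<close> \<open>0 \<le> M\<close> \<phi> hyp] by metis
  have \<nu>: "0 \<le> \<nu>" using hyp by (auto simp: hyperbolicity_def)
  define \<kappa> where "\<kappa> = 2 * ((1 + M) * \<mu>0) + 1"
  have \<kappa>: "0 \<le> \<kappa>" using \<mu>0 \<open>0 \<le> M\<close> by (simp add: \<kappa>_def)
  \<comment> \<open>Chosen so that \<open>2 * K * \<tau> \<le> \<eta> / 2\<close>; the
    \<open>+ 1\<close> avoids division by zero, and the cap at 1 leaves a plain factor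
    \<open>exp 1\<close>.\<close>
  define \<tau> where "\<tau> = min 1 (\<eta> / (4 * (K + 1)))"
  have \<tau>: "0 < \<tau>" "\<tau> \<le> 1" "\<tau> \<le> \<eta> / (4 * (K + 1))" using \<open>0 < \<eta>\<close> K by (auto simp: \<tau>_def)
  have "\<tau> * (4 * (K + 1)) \<le> \<eta>" using \<tau>(3) K by (simp add: pos_le_divide_eq)
  then have \<tau>K: "2 * K * \<tau> \<le> \<eta> / 2" using K \<tau> by (simp add: algebra_simps)
  define C' where "C' = 2 * exp \<kappa> + C * exp 1 * (1 + 2 / \<eta>)"
  have C2: "0 < C * exp 1 * (1 + 2 / \<eta>)" using C \<open>0 < \<eta>\<close> by (intro mult_pos_pos) (auto intro: add_pos_pos)
  have C': "0 < C'" "2 * exp \<kappa> \<le> C'" "C * exp 1 * (1 + 2 / \<eta>) \<le> C'"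
    using C2 exp_gt_zero[of \<kappa>] unfolding C'_def by linarith+
  show ?thesis
  proof (rule that[of C' \<tau> \<mu>0])
    fix \<mu> c \<delta> B p q t
    assume mode: "forced_mode \<mu> c \<delta> B p q" and \<mu>: "0 \<le> \<mu>" and cb: "\<And>s. \<nu> \<le> c s \<and> c s \<le> M"
      and c: "\<And>s t. \<bar>c s - c t\<bar> \<le> L * \<omega> \<bar>s - t\<bar>" and B: "0 \<le> B" and \<delta>: "\<delta> \<le> \<tau>"
      and t: "t \<in> {0..\<delta>}"
    define R where "R = (q 0)\<^sup>2 + \<mu>\<^sup>2 * (p 0)\<^sup>2 + t * B"
    have R: "0 \<le> R" unfolding R_def using B t by auto
    have t01: "0 \<le> t" "t \<le> 1" "t \<le> \<tau>" using t \<delta> \<tau> by auto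
    show "(q t)\<^sup>2 + \<mu>\<^sup>2 * (p t)\<^sup>2 \<le>
        C' * exp (\<eta> * growth_weight \<phi> \<mu>0 \<mu>) * ((q 0)\<^sup>2 + \<mu>\<^sup>2 * (p 0)\<^sup>2 + t * B)"
      unfolding R_def[symmetric]
    proof (cases "\<mu> \<le> \<mu>0")
      case True
      have cb0: "0 \<le> c s \<and> c s \<le> M" for s using cb[of s] \<nu> by linarith
      have "(q t)\<^sup>2 + \<mu>\<^sup>2 * (p t)\<^sup>2 \<le> 2 * exp (\<kappa> * t) * R"
        using mode_bound_low[OF mode \<mu> True cb0 B t] by (simp add: R_def \<kappa>_def)
      also have "\<dots> \<le> 2 * exp \<kappa> * R"
        using \<kappa> t01 R mult_left_mono[of t 1 \<kappa>] by (intro mult_right_mono mult_left_mono) auto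
      also have "\<dots> \<le> C' * R" using C' R by (intro mult_right_mono) auto
      finally show "(q t)\<^sup>2 + \<mu>\<^sup>2 * (p t)\<^sup>2 \<le> C' * exp (\<eta> * growth_weight \<phi> \<mu>0 \<mu>) * R"
        using True by (simp add: growth_weight_def)
    next
      case False
      have \<phi>\<mu>: "0 < \<phi> \<mu>" using \<phi> \<mu> by simp
      have "(2 * (K * \<phi> \<mu>) + 1) * t = 2 * K * t * \<phi> \<mu> + t" by (simp add: algebra_simps)
      also have "\<dots> \<le> 2 * K * \<tau> * \<phi> \<mu> + 1"
        using t01 K \<phi>\<mu> by (intro add_mono mult_right_mono mult_left_mono) auto
      also have "\<dots> \<le> \<eta> / 2 * \<phi> \<mu> + 1"
        using \<tau>K \<phi>\<mu> by (intro add_mono mult_right_mono) auto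
      finally have 1: "exp ((2 * (K * \<phi> \<mu>) + 1) * t) \<le> exp (\<eta> / 2 * \<phi> \<mu>) * exp 1"
        by (simp add: exp_add[symmetric])
      have "1 + \<phi> \<mu> \<le> (1 + 2 / \<eta>) * (1 + \<eta> / 2 * \<phi> \<mu>)"
        using \<open>0 < \<eta>\<close> \<phi>\<mu> by (simp add: field_simps)
      also have "\<dots> \<le> (1 + 2 / \<eta>) * exp (\<eta> / 2 * \<phi> \<mu>)"
        using \<open>0 < \<eta>\<close> by (intro mult_left_mono exp_ge_add_one_self) auto
      finally have 2: "1 + \<phi> \<mu> \<le> (1 + 2 / \<eta>) * exp (\<eta> / 2 * \<phi> \<mu>)" .
      have "(q t)\<^sup>2 + \<mu>\<^sup>2 * (p t)\<^sup>2 \<le> C * (1 + \<phi> \<mu>) * exp ((2 * (K * \<phi> \<mu>) + 1) * t) * R"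
        using high[OF mode _ cb c B t] False by (simp add: R_def)
      also have "\<dots> \<le> C * ((1 + 2 / \<eta>) * exp (\<eta> / 2 * \<phi> \<mu>)) * (exp (\<eta> / 2 * \<phi> \<mu>) * exp 1) * R"
        using 1 2 C R \<phi>\<mu> \<open>0 < \<eta>\<close> by (intro mult_right_mono mult_mono mult_left_mono) auto
      also have "\<dots> = C * exp 1 * (1 + 2 / \<eta>) * (exp (\<eta> / 2 * \<phi> \<mu>) * exp (\<eta> / 2 * \<phi> \<mu>)) * R"
        by (simp only: mult_ac)
      also have "exp (\<eta> / 2 * \<phi> \<mu>) * exp (\<eta> / 2 * \<phi> \<mu>) = exp (\<eta> * \<phi> \<mu>)"
        by (simp add: exp_add[symmetric])
      also have "C * exp 1 * (1 + 2 / \<eta>) * exp (\<eta> * \<phi> \<mu>) * R \<le> C' * exp (\<eta> * \<phi> \<mu>) * R"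
        using C' R by (intro mult_right_mono) auto
      finally show "(q t)\<^sup>2 + \<mu>\<^sup>2 * (p t)\<^sup>2 \<le> C' * exp (\<eta> * growth_weight \<phi> \<mu>0 \<mu>) * R"
        using False by (simp add: growth_weight_def)
    qed
  qed (use C' \<tau> \<mu>0 in auto)
qed

section \<open>Change of time between two monotone functions\<close>

definition C2_on :: "real \<Rightarrow> (real \<Rightarrow> real) \<Rightarrow> (real \<Rightarrow> real) \<Rightarrow> (real \<Rightarrow> real) \<Rightarrow> bool"
  where "C2_on \<tau> f f' f'' \<longleftrightarrow>
    (\<forall>t\<in>{0..\<tau>}. (f has_real_derivative f' t) (at t within {0..\<tau>})) \<and>
    (\<forall>t\<in>{0..\<tau>}. (f' has_real_derivative f'' t) (at t within {0..\<tau>})) \<and>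
    continuous_on {0..\<tau>} f''"

lemma C2_on_cont:
  assumes "C2_on \<tau> f f' f''"
  shows "continuous_on {0..\<tau>} f" "continuous_on {0..\<tau>} f'" "continuous_on {0..\<tau>} f''"
  using assms unfolding C2_on_def by (auto intro: DERIV_continuous_on)

lemma C2_on_interior:
  assumes "C2_on \<tau> f f' f''" "0 < t" "t < \<tau>"
  shows "(f has_real_derivative f' t) (at t)" "(f' has_real_derivative f'' t) (at t)"
proof -
  have "(f has_real_derivative f' t) (at t within {0..\<tau>})"
    "(f' has_real_derivative f'' t) (at t within {0..\<tau>})"
    using assms unfolding C2_on_def by auto
  then show "(f has_real_derivative f' t) (at t)" "(f' has_real_derivative f'' t) (at t)"
    using assms by (simp_all add: at_within_Icc_at)
qed

lemma continuous_on_gt_near_zero: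
  assumes "continuous_on {0..\<tau>} g" "0 < \<tau>" "k < g (0::real)"
  obtains d where "0 < d" "d \<le> \<tau>" "\<And>t. t \<in> {0..d} \<Longrightarrow> k < (g t :: real)"
proof -
  have "(g \<longlongrightarrow> g 0) (at 0 within {0..\<tau>})"
    using assms by (simp add: continuous_on_def)
  then have "eventually (\<lambda>t. k < g t) (at 0 within {0..\<tau>})"
    using assms(3) by (rule order_tendstoD)
  then obtain d where d: "0 < d" "\<And>t. t \<in> {0..\<tau>} \<Longrightarrow> t \<noteq> 0 \<Longrightarrow> dist t 0 < d \<Longrightarrow> k < g t"
    unfolding eventually_at by auto
  show ?thesis
  proof (rule that[of "min \<tau> (d / 2)"])
    fix t assume "t \<in> {0..min \<tau> (d / 2)}"
    then show "k < g t" using d(1) d(2)[of t] assms(3) by (cases "t = 0") auto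
  qed (use d assms in auto)
qed

text \<open>The case \<open>f' 0 = 0\<close> comes from integrating \<open>(f'\<^sup>2 - 2 k f)' = 2 f' (f'' - k) \<ge> 0\<close>, where
  \<open>f'' \<ge> k > 0\<close> near \<open>0\<close>.\<close>

lemma increment_le_deriv_square:
  assumes f: "C2_on \<tau> f f' f''" and "0 < \<tau>"
    and nd: "f' 0 > 0 \<or> f' 0 = 0 \<and> f'' 0 > 0"
  obtains d C where "0 < d" "d \<le> \<tau>" "0 \<le> C"
    "\<And>t. t \<in> {0<..d} \<Longrightarrow> 0 < f' t" "\<And>t. t \<in> {0<..d} \<Longrightarrow> f t - f 0 \<le> C * (f' t)\<^sup>2"
  using nd
proof (elim disjE conjE)
  assume p: "f' 0 > 0"
  obtain d1 where d1: "0 < d1" "d1 \<le> \<tau>" "\<And>t. t \<in> {0..d1} \<Longrightarrow> f' 0 / 2 < f' t"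
    using continuous_on_gt_near_zero[OF C2_on_cont(2)[OF f] \<open>0 < \<tau>\<close>, of "f' 0 / 2"] p by auto
  have "continuous_on {0..\<tau>} (\<lambda>t. - f t)" by (intro continuous_intros C2_on_cont(1)[OF f])
  then obtain d2 where d2: "0 < d2" "d2 \<le> \<tau>" "\<And>t. t \<in> {0..d2} \<Longrightarrow> - f 0 - 1 < - f t"
    using continuous_on_gt_near_zero[of \<tau> "\<lambda>t. - f t" "- f 0 - 1"] \<open>0 < \<tau>\<close> by auto
  show ?thesis
  \<comment> \<open>On this interval \<open>f\<close> grows by at most 1 while \<open>f'\<close>
    stays above \<open>f' 0 / 2\<close>; the quotient is the constant.\<close>
  proof (rule that[of "min d1 d2" "4 / (f' 0)\<^sup>2"])
    fix t assume t: "t \<in> {0<..min d1 d2}"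
    then have 1: "f' 0 / 2 < f' t" using d1(3)[of t] by auto
    then show "0 < f' t" using p by linarith
    have "f t - f 0 \<le> 1" using d2(3)[of t] t by auto
    also have "1 = 4 / (f' 0)\<^sup>2 * (f' 0 / 2)\<^sup>2" using p by (simp add: field_simps power2_eq_square)
    also have "\<dots> \<le> 4 / (f' 0)\<^sup>2 * (f' t)\<^sup>2"
      using 1 p by (intro mult_left_mono power_mono) auto
    finally show "f t - f 0 \<le> 4 / (f' 0)\<^sup>2 * (f' t)\<^sup>2" .
  qed (use d1 d2 in auto)
next
  assume z: "f' 0 = 0" and p: "f'' 0 > 0"
  define k where "k = f'' 0 / 2"
  have k: "0 < k" "k < f'' 0" using p by (auto simp: k_def)
  obtain d where d: "0 < d" "d \<le> \<tau>" "\<And>t. t \<in> {0..d} \<Longrightarrow> k < f'' t"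
    using continuous_on_gt_near_zero[OF C2_on_cont(3)[OF f] \<open>0 < \<tau>\<close>, of k] k by auto
  have pos: "0 < f' t" if t: "t \<in> {0<..d}" for t
  proof -
    have "f' 0 < f' t"
    proof (rule DERIV_pos_imp_increasing_open[where f = f'])
      show "continuous_on {0..t} f'"
        using C2_on_cont(2)[OF f] by (rule continuous_on_subset) (use t d in auto)
      fix x assume x: "0 < x" "x < t"
      then show "\<exists>y. (f' has_real_derivative y) (at x) \<and> 0 < y"
        using C2_on_interior(2)[OF f, of x] d(3)[of x] k(1) t d(2)
        by (intro exI[of _ "f'' x"]) auto
    qed (use t in auto)
    then show ?thesis using z by simp
  qed
  show ?thesis
  proof (rule that[of d "1 / (2 * k)"])
    fix t assume t: "t \<in> {0<..d}"
    show "0 < f' t" by (rule pos[OF t])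
    have "(f' 0)\<^sup>2 - 2 * k * f 0 \<le> (f' t)\<^sup>2 - 2 * k * f t"
    proof (rule DERIV_nonneg_imp_increasing_open[where f = "\<lambda>t. (f' t)\<^sup>2 - 2 * k * f t"])
      have "{0..t} \<subseteq> {0..\<tau>}" using t d by auto
      then show "continuous_on {0..t} (\<lambda>t. (f' t)\<^sup>2 - 2 * k * f t)"
        using C2_on_cont(1,2)[OF f] by (auto intro!: continuous_intros intro: continuous_on_subset)
      fix x assume x: "0 < x" "x < t"
      have "((\<lambda>t. (f' t)\<^sup>2 - 2 * k * f t) has_real_derivative 2 * (f' x * (f'' x - k))) (at x)"
        using C2_on_interior[OF f, of x] x t d
        by (auto intro!: derivative_eq_intros simp: algebra_simps)
      moreover have "0 \<le> 2 * (f' x * (f'' x - k))"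
        using pos[of x] d(3)[of x] x t by auto
      ultimately show "\<exists>y. ((\<lambda>t. (f' t)\<^sup>2 - 2 * k * f t) has_real_derivative y) (at x) \<and> 0 \<le> y"
        by blast
    qed (use t in auto)
    then show "f t - f 0 \<le> 1 / (2 * k) * (f' t)\<^sup>2" using z k by (simp add: field_simps)
  qed (use d k in auto)
qed

text \<open>\<open>h\<close> is the inverse of \<open>f2\<close> after \<open>f1\<close>, and
  \<open>d\<close> keeps \<open>f1\<close> below \<open>f2 a\<close>, inside the range of
  \<open>f2\<close>. The derivative formula is confined to interior times because \<open>f2'\<close>
  may vanish at 0.\<close>

lemma time_change:
  assumes f1: "C2_on \<tau> f1 f1' f1''" and f2: "C2_on \<tau> f2 f2' f2''"
    and a: "0 < a" "a \<le> \<tau>" and f0: "f1 0 = f2 0"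
    and p1: "\<And>t. t \<in> {0<..a} \<Longrightarrow> 0 < f1' t" and p2: "\<And>t. t \<in> {0<..a} \<Longrightarrow> 0 < f2' t"
  obtains d h where "0 < d" "d \<le> a" "h 0 = 0" "continuous_on {0..d} h"
    "\<And>t. t \<in> {0..d} \<Longrightarrow> h t \<in> {0..a} \<and> f2 (h t) = f1 t"
    "\<And>t. t \<in> {0<..<d} \<Longrightarrow> 0 < h t \<and> h t < a"
    "\<And>t. t \<in> {0<..<d} \<Longrightarrow> (h has_real_derivative f1' t / f2' (h t)) (at t)"
proof -
  have incr: "f x < f y" if f: "C2_on \<tau> f f' f''" and p: "\<And>t. t \<in> {0<..a} \<Longrightarrow> 0 < f' t"
    and xy: "0 \<le> x" "x < y" "y \<le> a" for f f' f'' x y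
  proof (rule DERIV_pos_imp_increasing_open[OF xy(2)])
    show "continuous_on {x..y} f"
      using C2_on_cont(1)[OF f] by (rule continuous_on_subset) (use xy a in auto)
    fix z assume z: "x < z" "z < y"
    then show "\<exists>y. (f has_real_derivative y) (at z) \<and> 0 < y"
      using C2_on_interior(1)[OF f, of z] p[of z] xy a by (intro exI[of _ "f' z"]) auto
  qed
  have i1: "f1 x < f1 y" if "0 \<le> x" "x < y" "y \<le> a" for x y by (rule incr[OF f1 p1]) (use that in auto)
  have i2: "f2 x < f2 y" if "0 \<le> x" "x < y" "y \<le> a" for x y by (rule incr[OF f2 p2]) (use that in auto)
  have c1: "continuous_on {0..a} f1" and c2: "continuous_on {0..a} f2"
    using C2_on_cont(1)[OF f1] C2_on_cont(1)[OF f2] a by (auto intro: continuous_on_subset)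
  have inj: "inj_on f2 {0..a}"
  proof (rule inj_onI)
    fix x y assume "x \<in> {0..a}" "y \<in> {0..a}" "f2 x = f2 y"
    then show "x = y" using i2[of x y] i2[of y x] by (cases x y rule: linorder_cases) auto
  qed
  have surj: "y \<in> f2 ` {0..a}" if "f2 0 \<le> y" "y \<le> f2 a" for y
    using IVT'[of f2 0 y a] that c2 a by auto
  have "continuous_on {0..a} (\<lambda>t. - f1 t)" by (intro continuous_intros c1)
  moreover have "- f2 a < - f1 0" using i2[of 0 a] a f0 by simp
  ultimately obtain d where d: "0 < d" "d \<le> a" "\<And>t. t \<in> {0..d} \<Longrightarrow> - f2 a < - f1 t"
    using continuous_on_gt_near_zero[of a "\<lambda>t. - f1 t" "- f2 a"] a by auto
  have r: "f2 0 \<le> f1 t \<and> f1 t < f2 a" if "t \<in> {0..d}" for t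
    using d(3)[OF that] i1[of 0 t] that d f0 by (cases "t = 0") auto
  define g where "g = the_inv_into {0..a} f2"
  have g: "g y \<in> {0..a} \<and> f2 (g y) = y" if "f2 0 \<le> y" "y \<le> f2 a" for y
    using surj[OF that] the_inv_into_into[OF inj, of y "{0..a}"] f_the_inv_into_f[OF inj, of y]
    by (auto simp: g_def)
  have cg: "continuous_on {f2 0..f2 a} g"
  proof -
    have "continuous_on (f2 ` {0..a}) g" unfolding g_def
      by (rule continuous_on_inv_into[OF c2 _ inj]) simp
    then show ?thesis by (rule continuous_on_subset) (use surj in auto)
  qed
  define h where "h t = g (f1 t)" for t
  have h: "h t \<in> {0..a} \<and> f2 (h t) = f1 t" if "t \<in> {0..d}" for t
    unfolding h_def using g[of "f1 t"] r[OF that] by auto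
  have hi: "0 < h t \<and> h t < a" if t: "t \<in> {0<..<d}" for t
  proof -
    have "f2 0 < f1 t" using i1[of 0 t] t d f0 by auto
    moreover have "f1 t < f2 a" using r[of t] t by auto
    ultimately have "h t \<noteq> 0" "h t \<noteq> a" using h[of t] t by auto
    then show ?thesis using h[of t] t by auto
  qed
  show ?thesis
  proof (rule that[of d h])
    show "h 0 = 0" unfolding h_def g_def f0 using the_inv_into_f_f[OF inj, of 0] a by simp
    show "continuous_on {0..d} h" unfolding h_def
    proof (rule continuous_on_compose2[OF cg])
      show "continuous_on {0..d} f1" using c1 d by (auto intro: continuous_on_subset)
    qed (use r in force)
    fix t assume t: "t \<in> {0<..<d}"
    have lt: "f2 0 < f1 t" "f1 t < f2 a" using i1[of 0 t] t d f0 r[of t] by auto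
    have "(g has_real_derivative inverse (f2' (h t))) (at (f1 t))"
    proof (rule DERIV_inverse_function[where a = "f2 0" and b = "f2 a"])
      show "(f2 has_real_derivative f2' (h t)) (at (g (f1 t)))"
        using C2_on_interior(1)[OF f2, of "h t"] hi[OF t] a by (simp add: h_def)
      show "f2' (h t) \<noteq> 0" using p2[of "h t"] hi[OF t] by auto
      show "isCont g (f1 t)"
        using continuous_on_interior[OF cg] lt by auto
    qed (use lt g in auto)
    from DERIV_chain2[OF this C2_on_interior(1)[OF f1, of t]] t d a
    show "(h has_real_derivative f1' t / f2' (h t)) (at t)"
      unfolding h_def by (simp add: field_simps)
  qed (use d h hi in auto)
qed

text \<open>The point is that \<open>(f1'\<^sup>2 - (f2' \<circ> h)\<^sup>2)' = 2 f1' (f1'' - f2'' \<circ> h)\<close>.\<close>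

lemma time_change_deriv_bound:
  assumes f1: "C2_on \<tau> f1 f1' f1''" and f2: "C2_on \<tau> f2 f2' f2''"
    and a: "d \<le> a" "a \<le> \<tau>" and f0: "f1 0 = f2 0" "f1' 0 = f2' 0"
    and p1: "\<And>t. t \<in> {0<..a} \<Longrightarrow> 0 < f1' t" and p2: "\<And>t. t \<in> {0<..a} \<Longrightarrow> 0 < f2' t"
    and C: "\<And>t. t \<in> {0<..a} \<Longrightarrow> f2 t - f2 0 \<le> C * (f2' t)\<^sup>2"
    and h0: "h 0 = 0" and ch: "continuous_on {0..d} h"
    and h: "\<And>t. t \<in> {0..d} \<Longrightarrow> h t \<in> {0..a} \<and> f2 (h t) = f1 t"
    and hi: "\<And>t. t \<in> {0<..<d} \<Longrightarrow> 0 < h t \<and> h t < a"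
    and dh: "\<And>t. t \<in> {0<..<d} \<Longrightarrow> (h has_real_derivative f1' t / f2' (h t)) (at t)"
    and Q: "\<And>t. t \<in> {0<..<d} \<Longrightarrow> \<bar>f1'' t - f2'' (h t)\<bar> \<le> Q" and t: "t \<in> {0<..<d}"
  shows "\<bar>1 - f1' t / f2' (h t)\<bar> \<le> 2 * C * Q"
proof -
  define P where "P s = (f1' s)\<^sup>2 - (f2' (h s))\<^sup>2" for s
  have dP: "(P has_real_derivative 2 * (f1' s * (f1'' s - f2'' (h s)))) (at s)"
    if s: "s \<in> {0<..<d}" for s
  proof -
    have "f2' (h s) > 0" using p2[of "h s"] hi[OF s] by auto
    have 1: "((\<lambda>s. (f1' s)\<^sup>2) has_real_derivative 2 * (f1' s * f1'' s)) (at s)"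
      using DERIV_power[OF C2_on_interior(2)[OF f1, of s], of 2] s a by (simp add: mult_ac)
    have "((\<lambda>s. f2' (h s)) has_real_derivative f2'' (h s) * (f1' s / f2' (h s))) (at s)"
      using hi[OF s] a by (intro DERIV_chain2[OF C2_on_interior(2)[OF f2] dh[OF s]]) auto
    from DERIV_power[OF this, of 2]
    have "((\<lambda>s. (f2' (h s))\<^sup>2) has_real_derivative 2 * (f1' s * f2'' (h s))) (at s)"
      using \<open>f2' (h s) > 0\<close> by (simp add: mult_ac)
    from DERIV_diff[OF 1 this] show ?thesis unfolding P_def by (simp add: algebra_simps)
  qed
  have cP: "continuous_on {0..t} P" "continuous_on {0..t} f1"
  proof -
    have sub: "{0..t} \<subseteq> {0..d}" "{0..t} \<subseteq> {0..\<tau>}" using t a by auto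
    have "continuous_on {0..t} (\<lambda>s. f2' (h s))"
    proof (rule continuous_on_compose2[OF C2_on_cont(2)[OF f2]])
      show "continuous_on {0..t} h" using ch sub by (auto intro: continuous_on_subset)
      show "h ` {0..t} \<subseteq> {0..\<tau>}" using h sub a by force
    qed
    then show "continuous_on {0..t} P" "continuous_on {0..t} f1" unfolding P_def
      using C2_on_cont(1,2)[OF f1] sub by (auto intro!: continuous_intros intro: continuous_on_subset)
  qed
  \<comment> \<open>The sign \<open>s\<close> yields both bounds at once. Since \<open>f1'\<close>
    is positive, the derivative of \<open>P\<close> is at most \<open>2 * Q * f1'\<close> in
    absolute value; it integrates to an increment of \<open>f1\<close>, with no division by
    \<open>f1'\<close>.\<close>
  have b: "s * P t \<le> 2 * Q * (f1 t - f1 0)" if s: "\<bar>s\<bar> = 1" for s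
  proof -
    have "s * P t - 2 * Q * f1 t \<le> s * P 0 - 2 * Q * f1 0"
    proof (rule DERIV_nonpos_imp_decreasing_open[where f = "\<lambda>t. s * P t - 2 * Q * f1 t"])
      show "continuous_on {0..t} (\<lambda>t. s * P t - 2 * Q * f1 t)"
        by (intro continuous_intros cP)
      fix x assume x: "0 < x" "x < t"
      then have x': "x \<in> {0<..<d}" using t by auto
      have "((\<lambda>t. s * P t - 2 * Q * f1 t) has_real_derivative
          s * (2 * (f1' x * (f1'' x - f2'' (h x)))) - 2 * Q * f1' x) (at x)"
        using x' a by (intro DERIV_diff DERIV_cmult dP C2_on_interior(1)[OF f1]) auto
      moreover have "s * (2 * (f1' x * (f1'' x - f2'' (h x)))) - 2 * Q * f1' x \<le> 0"
      proof -
        have "s * (f1'' x - f2'' (h x)) \<le> \<bar>s * (f1'' x - f2'' (h x))\<bar>" by simp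
        also have "\<dots> \<le> Q" using Q[OF x'] s by (simp add: abs_mult)
        finally have "f1' x * (s * (f1'' x - f2'' (h x))) \<le> f1' x * Q"
          using p1[of x] x' a by (intro mult_left_mono) auto
        then show ?thesis by (simp add: algebra_simps)
      qed
      ultimately show "\<exists>y. ((\<lambda>t. s * P t - 2 * Q * f1 t) has_real_derivative y) (at x) \<and> y \<le> 0"
        by blast
    qed (use t in auto)
    moreover have "P 0 = 0" by (simp add: P_def h0 f0)
    ultimately show ?thesis by (simp add: algebra_simps)
  qed
  have "0 \<le> Q" using Q[OF t] by linarith
  have hp: "0 < h t" "h t \<le> a" using hi[OF t] by auto
  have pos: "0 < f2' (h t)" "0 < f1' t" using p2[of "h t"] hp p1[of t] t a by auto
  have "\<bar>P t\<bar> \<le> 2 * Q * (f1 t - f1 0)" using b[of 1] b[of "-1"] by auto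
  also have "f1 t - f1 0 = f2 (h t) - f2 0" using h[of t] t f0 by auto
  also have "2 * Q * (f2 (h t) - f2 0) \<le> 2 * Q * (C * (f2' (h t))\<^sup>2)"
    using C[of "h t"] hp \<open>0 \<le> Q\<close> by (intro mult_left_mono) auto
  finally have PQ: "\<bar>P t\<bar> \<le> 2 * C * Q * f2' (h t) * f2' (h t)" by (simp add: power2_eq_square mult_ac)
  \<comment> \<open>Factoring \<open>P\<close> leaves one power of \<open>f2'\<close> on this side,
    while \<open>P\<close> is bounded by its square. Cancelling once bounds the difference by a
    multiple of \<open>f2'\<close>, so the ratio stays controlled as \<open>f2'\<close> tends to
    0.\<close>
  have "\<bar>f2' (h t) - f1' t\<bar> * f2' (h t) \<le> \<bar>f2' (h t) - f1' t\<bar> * (f2' (h t) + f1' t)"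
    using pos by (intro mult_left_mono) auto
  also have "\<dots> = \<bar>P t\<bar>"
  proof -
    have "\<bar>f2' (h t) - f1' t\<bar> * (f2' (h t) + f1' t) = \<bar>(f2' (h t) - f1' t) * (f2' (h t) + f1' t)\<bar>"
      using pos by (simp add: abs_mult)
    also have "(f2' (h t) - f1' t) * (f2' (h t) + f1' t) = - P t"
      unfolding P_def by (simp add: power2_eq_square algebra_simps)
    finally show ?thesis by simp
  qed
  also note PQ
  finally have "\<bar>f2' (h t) - f1' t\<bar> \<le> 2 * C * Q * f2' (h t)" using pos by simp
  moreover have "\<bar>1 - f1' t / f2' (h t)\<bar> = \<bar>f2' (h t) - f1' t\<bar> / f2' (h t)"
  proof -
    have "1 - f1' t / f2' (h t) = (f2' (h t) - f1' t) / f2' (h t)" using pos by (simp add: field_simps)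
    then show ?thesis using pos by simp
  qed
  ultimately show ?thesis using pos by (simp add: pos_divide_le_eq)
qed

section \<open>Systems of modes\<close>

definition stiffness :: "(nat \<Rightarrow> real) \<Rightarrow> (nat \<Rightarrow> real \<Rightarrow> real) \<Rightarrow> real \<Rightarrow> real"
  where "stiffness lam x t = (\<Sum>k. (lam k)\<^sup>2 * (x k t)\<^sup>2)"

definition stiffness' :: "(nat \<Rightarrow> real) \<Rightarrow> (nat \<Rightarrow> real \<Rightarrow> real) \<Rightarrow> (nat \<Rightarrow> real \<Rightarrow> real) \<Rightarrow> real \<Rightarrow> real"
  where "stiffness' lam x y t = (\<Sum>k. 2 * ((lam k)\<^sup>2 * (x k t * y k t)))"

text \<open>The acceleration is eliminated through the equation, so the value depends on positions
  and velocities at time \<open>t\<close> alone. Half of it is the second bracket of the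
  nondegeneracy quantity in coordinates.\<close>

definition stiffness'' :: "(nat \<Rightarrow> real) \<Rightarrow> (real \<Rightarrow> real) \<Rightarrow> (nat \<Rightarrow> real \<Rightarrow> real) \<Rightarrow>
    (nat \<Rightarrow> real \<Rightarrow> real) \<Rightarrow> real \<Rightarrow> real"
  where "stiffness'' lam m x y t =
    (\<Sum>k. 2 * ((lam k)\<^sup>2 * ((y k t)\<^sup>2 - m (stiffness lam x t) * ((lam k)\<^sup>2 * (x k t)\<^sup>2))))"

text \<open>The Lipschitz clause makes the coefficient \<open>m (stiffness lam x t)\<close>
  \<open>\<omega>\<close>-continuous in time before any second derivative is available; the energy
  estimates, and through them the C2 regularity, rest on it.\<close>

definition kirchhoff_modes :: "(nat \<Rightarrow> real) \<Rightarrow> (real \<Rightarrow> real) \<Rightarrow> real \<Rightarrow>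
    (nat \<Rightarrow> real \<Rightarrow> real) \<Rightarrow> (nat \<Rightarrow> real \<Rightarrow> real) \<Rightarrow> bool"
  where "kirchhoff_modes lam m \<tau> x y \<longleftrightarrow>
    (\<forall>t\<in>{0..\<tau>}. summable (\<lambda>k. (lam k)\<^sup>2 * (x k t)\<^sup>2) \<and>
      (\<forall>k. (x k has_real_derivative y k t) (at t within {0..\<tau>}) \<and>
           (y k has_real_derivative - (m (stiffness lam x t) * (lam k)\<^sup>2 * x k t))
             (at t within {0..\<tau>}))) \<and>
    (\<exists>K. \<forall>s\<in>{0..\<tau>}. \<forall>t\<in>{0..\<tau>}. \<bar>stiffness lam x s - stiffness lam x t\<bar> \<le> K * \<bar>s - t\<bar>)"

lemma kirchhoff_modes_subinterval:
  assumes "kirchhoff_modes lam m \<tau> x y" "\<tau>' \<le> \<tau>"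
  shows "kirchhoff_modes lam m \<tau>' x y"
proof -
  have sub: "{0..\<tau>'} \<subseteq> {0..\<tau>}" using assms by auto
  show ?thesis
    using assms sub unfolding kirchhoff_modes_def by (meson DERIV_subset subset_iff)
qed

lemma kirchhoff_modes_interior:
  assumes "kirchhoff_modes lam m \<tau> x y" "0 < t" "t < \<tau>"
  shows "(x k has_real_derivative y k t) (at t)"
    "(y k has_real_derivative - (m (stiffness lam x t) * (lam k)\<^sup>2 * x k t)) (at t)"
proof -
  have "t \<in> {0..\<tau>}" "at t within {0..\<tau>} = at t" using assms by (auto simp: at_within_Icc_at)
  then show "(x k has_real_derivative y k t) (at t)"
    "(y k has_real_derivative - (m (stiffness lam x t) * (lam k)\<^sup>2 * x k t)) (at t)"
    using assms(1) unfolding kirchhoff_modes_def by metis+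
qed

lemma kirchhoff_modes_continuous:
  assumes "kirchhoff_modes lam m \<tau> x y"
  shows "continuous_on {0..\<tau>} (x k)" "continuous_on {0..\<tau>} (y k)"
proof -
  have d: "(x k has_real_derivative y k t) (at t within {0..\<tau>})"
    "(y k has_real_derivative - (m (stiffness lam x t) * (lam k)\<^sup>2 * x k t)) (at t within {0..\<tau>})"
    if "t \<in> {0..\<tau>}" for t
    using assms that unfolding kirchhoff_modes_def by auto
  show "continuous_on {0..\<tau>} (x k)" by (rule DERIV_continuous_on[OF d(1)])
  show "continuous_on {0..\<tau>} (y k)" by (rule DERIV_continuous_on[OF d(2)])
qed

lemma stiffness_nonneg:
  assumes "kirchhoff_modes lam m \<tau> x y" "t \<in> {0..\<tau>}"
  shows "0 \<le> stiffness lam x t"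
  using assms unfolding kirchhoff_modes_def stiffness_def by (intro suminf_nonneg) auto

text \<open>Clamping the time extends the coefficient to the whole line, because the averages look
  beyond the end of the interval.\<close>

definition propagation :: "(nat \<Rightarrow> real) \<Rightarrow> (real \<Rightarrow> real) \<Rightarrow> real \<Rightarrow> (nat \<Rightarrow> real \<Rightarrow> real) \<Rightarrow> real \<Rightarrow> real"
  where "propagation lam m \<tau> x t = m (stiffness lam x (max 0 (min \<tau> t)))"

lemma propagation_eq: "t \<in> {0..\<tau>} \<Longrightarrow> propagation lam m \<tau> x t = m (stiffness lam x t)"
  by (simp add: propagation_def)

text \<open>A modulus composed with a Lipschitz function: the clamp does not increase distances, and
  the Lipschitz constant \<open>K\<close> of the stiffness leaves \<open>\<omega>\<close> as the
  factor \<open>K + 1\<close>.\<close>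

lemma propagation_modulus:
  assumes \<omega>: "cont_modulus \<omega>" and m: "omega_continuous \<omega> m" and \<nu>: "\<forall>\<sigma>\<ge>0. \<nu> \<le> m \<sigma>"
    and modes: "kirchhoff_modes lam m \<tau> x y" and "0 \<le> \<tau>"
  obtains L M where "0 \<le> L" "0 \<le> M"
    "\<And>s t. \<bar>propagation lam m \<tau> x s - propagation lam m \<tau> x t\<bar> \<le> L * \<omega> \<bar>s - t\<bar>"
    "\<And>s. \<nu> \<le> propagation lam m \<tau> x s \<and> propagation lam m \<tau> x s \<le> M"
proof -
  obtain L0 where L0: "\<forall>a\<ge>0. \<forall>b\<ge>0. \<bar>m a - m b\<bar> \<le> L0 * \<omega> \<bar>a - b\<bar>"
    using m unfolding omega_continuous_def by blast
  obtain K0 where K0: "\<forall>s\<in>{0..\<tau>}. \<forall>t\<in>{0..\<tau>}. \<bar>stiffness lam x s - stiffness lam x t\<bar> \<le> K0 * \<bar>s - t\<bar>"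
    using modes unfolding kirchhoff_modes_def by blast
  define K where "K = \<bar>K0\<bar>"
  define cl where "cl t = max 0 (min \<tau> t)" for t
  have cl: "cl t \<in> {0..\<tau>}" for t using \<open>0 \<le> \<tau>\<close> by (auto simp: cl_def)
  have lip: "\<bar>cl s - cl t\<bar> \<le> \<bar>s - t\<bar>" for s t by (auto simp: cl_def max_def min_def abs_if)
  have \<omega>nn: "0 \<le> \<omega> x" if "0 \<le> x" for x using \<omega> that by (simp add: cont_modulus_def)
  have nn: "0 \<le> stiffness lam x (cl t)" for t by (rule stiffness_nonneg[OF modes cl])
  have c: "\<bar>propagation lam m \<tau> x s - propagation lam m \<tau> x t\<bar> \<le> \<bar>L0\<bar> * (K + 1) * \<omega> \<bar>s - t\<bar>" for s t
  proof -
    let ?d = "\<bar>stiffness lam x (cl s) - stiffness lam x (cl t)\<bar>"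
    have "?d \<le> K0 * \<bar>cl s - cl t\<bar>" using K0 cl by blast
    also have "\<dots> \<le> K * \<bar>s - t\<bar>" unfolding K_def using lip by (intro mult_mono) auto
    finally have d: "?d \<le> K * \<bar>s - t\<bar>" .
    have "\<bar>propagation lam m \<tau> x s - propagation lam m \<tau> x t\<bar> \<le> L0 * \<omega> ?d"
      unfolding propagation_def cl_def[symmetric] using L0 nn by blast
    also have "\<dots> \<le> \<bar>L0\<bar> * \<omega> ?d" using \<omega>nn by (intro mult_right_mono) auto
    also have "\<dots> \<le> \<bar>L0\<bar> * \<omega> (K * \<bar>s - t\<bar>)"
      by (intro mult_left_mono cont_modulus_mono[OF \<omega>] d) auto
    also have "\<dots> \<le> \<bar>L0\<bar> * ((K + 1) * \<omega> \<bar>s - t\<bar>)"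
      by (intro mult_left_mono cont_modulus_mult[OF \<omega>]) (auto simp: K_def)
    finally show ?thesis by (simp add: mult.assoc)
  qed
  have L: "0 \<le> \<bar>L0\<bar> * (K + 1)" by (simp add: K_def)
  have cc: "propagation lam m \<tau> x (cl s) = propagation lam m \<tau> x s" for s
    unfolding propagation_def using \<open>0 \<le> \<tau>\<close> by (simp add: cl_def)
  \<comment> \<open>The value at 0 plus the largest oscillation over an interval of length
    \<open>\<tau>\<close>.\<close>
  define M where "M = \<bar>propagation lam m \<tau> x 0\<bar> + \<bar>L0\<bar> * (K + 1) * \<omega> \<tau>"
  show ?thesis
  proof (rule that[OF L _ c])
    show "0 \<le> M" unfolding M_def using L \<omega>nn[OF \<open>0 \<le> \<tau>\<close>] by simp
    fix s
    have "\<bar>propagation lam m \<tau> x (cl s) - propagation lam m \<tau> x 0\<bar> \<le> \<bar>L0\<bar> * (K + 1) * \<omega> \<bar>cl s - 0\<bar>" by (rule c)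
    also have "\<dots> \<le> \<bar>L0\<bar> * (K + 1) * \<omega> \<tau>"
      using cl[of s] by (intro mult_left_mono[OF _ L] cont_modulus_mono[OF \<omega>]) auto
    finally have "propagation lam m \<tau> x s \<le> M" unfolding cc M_def by linarith
    moreover have "\<nu> \<le> propagation lam m \<tau> x s"
      unfolding propagation_def cl_def[symmetric] using \<nu> nn by blast
    ultimately show "\<nu> \<le> propagation lam m \<tau> x s \<and> propagation lam m \<tau> x s \<le> M" by simp
  qed
qed

lemma kirchhoff_modes_forced:
  assumes "kirchhoff_modes lam m \<tau> x y"
  shows "forced_mode (lam k) (propagation lam m \<tau> x) \<tau> 0 (x k) (y k)"
  unfolding forced_mode_def
proof (intro conjI ballI kirchhoff_modes_continuous[OF assms])
  fix t assume t: "t \<in> {0<..<\<tau>}"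
  then show "\<exists>F G. (x k has_real_derivative y k t + F) (at t) \<and>
       (y k has_real_derivative G - propagation lam m \<tau> x t * (lam k)\<^sup>2 * x k t) (at t) \<and>
       (lam k)\<^sup>2 * F\<^sup>2 \<le> 0 \<and> G\<^sup>2 \<le> 0"
    using kirchhoff_modes_interior[OF assms, of t k] propagation_eq[of t \<tau> lam m x]
    by (intro exI[of _ 0]) auto
qed

text \<open>For the mixed product one factor \<open>l\<close> is given to \<open>x\<close> and the
  other stays outside, where \<open>l \<le> 1 + l\<^sup>2\<close>.\<close>

lemma mode_products_bound:
  fixes l x y R :: real
  assumes "y\<^sup>2 + l\<^sup>2 * x\<^sup>2 \<le> R" "0 \<le> l"
  shows "l\<^sup>2 * x\<^sup>2 \<le> R" "y\<^sup>2 \<le> R" "0 \<le> R" "\<bar>2 * (l\<^sup>2 * (x * y))\<bar> \<le> (1 + l\<^sup>2) * R"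
proof -
  have p: "0 \<le> l\<^sup>2 * x\<^sup>2" by simp
  show 1: "l\<^sup>2 * x\<^sup>2 \<le> R" "y\<^sup>2 \<le> R" "0 \<le> R"
    using assms p zero_le_power2[of y] by linarith+
  have "\<bar>2 * (l\<^sup>2 * (x * y))\<bar> = l * (2 * \<bar>y\<bar> * \<bar>l * x\<bar>)"
    using assms(2) by (simp add: abs_mult power2_eq_square)
  also have "\<dots> \<le> l * (\<bar>y\<bar>\<^sup>2 + \<bar>l * x\<bar>\<^sup>2)"
    using sum_squares_bound[of "\<bar>y\<bar>" "\<bar>l * x\<bar>"] assms(2) by (intro mult_left_mono) auto
  also have "\<dots> \<le> l * R" using assms by (intro mult_left_mono) (auto simp: power_mult_distrib)
  also have "\<dots> \<le> (1 + l\<^sup>2) * R"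
  proof (rule mult_right_mono)
    show "l \<le> 1 + l\<^sup>2" using sum_squares_bound[of 1 l] assms(2) by simp
  qed (rule 1)
  finally show "\<bar>2 * (l\<^sup>2 * (x * y))\<bar> \<le> (1 + l\<^sup>2) * R" .
qed

text \<open>Termwise differentiation, applied twice. The time-independent energy bounds
  \<open>R k\<close> give the majorant \<open>(1 + (lam k)\<^sup>2) * R k\<close> of both derived
  series, so the Weierstrass test applies.\<close>

lemma stiffness_C2:
  assumes modes: "kirchhoff_modes lam m \<tau> x y" and "0 < \<tau>" and lam: "\<forall>k. 0 \<le> lam k"
    and cm: "continuous_on {0..\<tau>} (\<lambda>t. m (stiffness lam x t))"
    and M: "\<And>t. t \<in> {0..\<tau>} \<Longrightarrow> \<bar>m (stiffness lam x t)\<bar> \<le> M"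
    and R: "\<And>k t. t \<in> {0..\<tau>} \<Longrightarrow> (y k t)\<^sup>2 + (lam k)\<^sup>2 * (x k t)\<^sup>2 \<le> R k"
    and sR: "summable (\<lambda>k. (1 + (lam k)\<^sup>2) * R k)"
  shows "C2_on \<tau> (stiffness lam x) (stiffness' lam x y) (stiffness'' lam m x y)"
    "\<And>t. t \<in> {0..\<tau>} \<Longrightarrow> \<bar>stiffness'' lam m x y t\<bar> \<le> 2 * (1 + M) * (\<Sum>k. (1 + (lam k)\<^sup>2) * R k)"
    "\<And>t. t \<in> {0..\<tau>} \<Longrightarrow>
      summable (\<lambda>k. 2 * ((lam k)\<^sup>2 * ((y k t)\<^sup>2 - m (stiffness lam x t) * ((lam k)\<^sup>2 * (x k t)\<^sup>2))))"
proof -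
  let ?c = "\<lambda>t. m (stiffness lam x t)"
  let ?f1 = "\<lambda>k t. 2 * ((lam k)\<^sup>2 * (x k t * y k t))"
  let ?f2 = "\<lambda>k t. 2 * ((lam k)\<^sup>2 * ((y k t)\<^sup>2 - ?c t * ((lam k)\<^sup>2 * (x k t)\<^sup>2)))"
  have dx: "(x k has_real_derivative y k t) (at t within {0..\<tau>})"
    and dy: "(y k has_real_derivative - (?c t * (lam k)\<^sup>2 * x k t)) (at t within {0..\<tau>})"
    if "t \<in> {0..\<tau>}" for k t
    using modes that unfolding kirchhoff_modes_def by auto
  have M0: "0 \<le> M" using M[of 0] \<open>0 < \<tau>\<close> by auto
  have b1: "norm (?f1 k t) \<le> (1 + (lam k)\<^sup>2) * R k" if "t \<in> {0..\<tau>}" for k t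
    using mode_products_bound(4)[OF R[OF that] lam[rule_format]] by simp
  have b2: "norm (?f2 k t) \<le> 2 * (1 + M) * ((1 + (lam k)\<^sup>2) * R k)" if t: "t \<in> {0..\<tau>}" for k t
  proof -
    note B = mode_products_bound[OF R[OF t, of k] lam[rule_format]]
    have "\<bar>?c t * ((lam k)\<^sup>2 * (x k t)\<^sup>2)\<bar> \<le> M * R k"
      unfolding abs_mult using B(1,3) M[OF t] by (intro mult_mono) auto
    then have "\<bar>(y k t)\<^sup>2 - ?c t * ((lam k)\<^sup>2 * (x k t)\<^sup>2)\<bar> \<le> (1 + M) * R k"
    proof -
      have "(1 + M) * R k = R k + M * R k" by (simp add: distrib_right)
      with \<open>\<bar>?c t * ((lam k)\<^sup>2 * (x k t)\<^sup>2)\<bar> \<le> M * R k\<close> show ?thesis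
        using B(2) zero_le_power2[of "y k t"] by linarith
    qed
    then have "norm (?f2 k t) \<le> 2 * ((1 + (lam k)\<^sup>2) * ((1 + M) * R k))"
      unfolding real_norm_def abs_mult using B(3) M0
      by (intro mult_mono) auto
    then show ?thesis by (simp only: mult_ac)
  qed
  have sR': "summable (\<lambda>k. 2 * (1 + M) * ((1 + (lam k)\<^sup>2) * R k))" by (rule summable_mult[OF sR])
  have u1: "uniform_limit {0..\<tau>} (\<lambda>n t. \<Sum>k<n. ?f1 k t) (stiffness' lam x y) sequentially"
    unfolding stiffness'_def by (rule Weierstrass_m_test[OF b1 sR])
  have u2: "uniform_limit {0..\<tau>} (\<lambda>n t. \<Sum>k<n. ?f2 k t) (stiffness'' lam m x y) sequentially"
    unfolding stiffness''_def by (rule Weierstrass_m_test[OF b2 sR'])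
  have zero: "0 \<in> {0..\<tau>}" using \<open>0 < \<tau>\<close> by simp
  obtain g1 where g1: "\<And>t. t \<in> {0..\<tau>} \<Longrightarrow> (\<lambda>k. (lam k)\<^sup>2 * (x k t)\<^sup>2) sums g1 t \<and>
      (g1 has_real_derivative stiffness' lam x y t) (at t within {0..\<tau>})"
  proof -
    have d: "((\<lambda>t. (lam k)\<^sup>2 * (x k t)\<^sup>2) has_real_derivative ?f1 k t) (at t within {0..\<tau>})"
      if "t \<in> {0..\<tau>}" for k t
      using DERIV_cmult[OF DERIV_power[OF dx[OF that], where n = 2], of "(lam k)\<^sup>2"] by (simp add: mult_ac)
    have "summable (\<lambda>k. (lam k)\<^sup>2 * (x k 0)\<^sup>2)" using modes zero unfolding kirchhoff_modes_def by auto
    from has_field_derivative_series[OF convex_real_interval(5) d u1 zero this] that show ?thesis by blast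
  qed
  obtain g2 where g2: "\<And>t. t \<in> {0..\<tau>} \<Longrightarrow> (\<lambda>k. ?f1 k t) sums g2 t \<and>
      (g2 has_real_derivative stiffness'' lam m x y t) (at t within {0..\<tau>})"
  proof -
    have d: "((\<lambda>t. ?f1 k t) has_real_derivative ?f2 k t) (at t within {0..\<tau>})"
      if "t \<in> {0..\<tau>}" for k t
    proof -
      have "((\<lambda>t. x k t * y k t) has_real_derivative
          y k t * y k t + - (?c t * (lam k)\<^sup>2 * x k t) * x k t) (at t within {0..\<tau>})"
        by (rule DERIV_mult[OF dx[OF that] dy[OF that]])
      from DERIV_cmult[OF DERIV_cmult[OF this, of "(lam k)\<^sup>2"], of 2]
      show ?thesis by (rule DERIV_cong) (simp add: power2_eq_square algebra_simps)
    qed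
    have "summable (\<lambda>k. ?f1 k 0)"
      by (rule summable_comparison_test'[OF sR b1[OF zero]])
    from has_field_derivative_series[OF convex_real_interval(5) d u2 zero this] that show ?thesis by blast
  qed
  have e1: "g1 t = stiffness lam x t" if "t \<in> {0..\<tau>}" for t
    unfolding stiffness_def using g1[OF that] by (simp add: sums_iff)
  have e2: "g2 t = stiffness' lam x y t" if "t \<in> {0..\<tau>}" for t
    unfolding stiffness'_def using g2[OF that] by (simp add: sums_iff)
  show "C2_on \<tau> (stiffness lam x) (stiffness' lam x y) (stiffness'' lam m x y)"
    unfolding C2_on_def
  proof (intro conjI ballI)
    fix t assume t: "t \<in> {0..\<tau>}"
    show "(stiffness lam x has_real_derivative stiffness' lam x y t) (at t within {0..\<tau>})"
      by (rule has_field_derivative_transform_within[of g1 _ _ _ 1]) (use g1[OF t] e1 t in auto)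
    show "(stiffness' lam x y has_real_derivative stiffness'' lam m x y t) (at t within {0..\<tau>})"
      by (rule has_field_derivative_transform_within[of g2 _ _ _ 1]) (use g2[OF t] e2 t in auto)
  next
    show "continuous_on {0..\<tau>} (stiffness'' lam m x y)"
      by (rule uniform_limit_theorem[OF _ u2])
        (auto intro!: continuous_intros cm kirchhoff_modes_continuous[OF modes] always_eventually)
  qed
  fix t assume t: "t \<in> {0..\<tau>}"
  show "summable (\<lambda>k. ?f2 k t)" by (rule summable_comparison_test'[OF sR' b2[OF t]])
  have "norm (\<Sum>k. ?f2 k t) \<le> (\<Sum>k. 2 * (1 + M) * ((1 + (lam k)\<^sup>2) * R k))"
    by (rule norm_suminf_le[OF b2[OF t] sR'])
  then show "\<bar>stiffness'' lam m x y t\<bar> \<le> 2 * (1 + M) * (\<Sum>k. (1 + (lam k)\<^sup>2) * R k)"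
    unfolding stiffness''_def by (simp add: suminf_mult[OF sR])
qed

text \<open>Below \<open>\<mu>0\<close> the weight is 1 and the powers are bounded, so the norms in
  \<open>H\<close> suffice. Above it \<open>lam k \<ge> 1\<close> gives
  \<open>1 + lam k ^ 4 \<le> 2 * lam k ^ 4\<close>, and the extra \<open>(lam k)\<^sup>2\<close> on
  the position makes the power 6.\<close>

lemma summable_initial_energy:
  assumes lam: "\<forall>k. 0 \<le> lam k" and "0 < r" "1 \<le> \<mu>0"
    and s: "summable (\<lambda>k. (x0 k)\<^sup>2)" "summable (\<lambda>k. (y0 k)\<^sup>2)"
      "summable (\<lambda>k. (lam k) ^ 6 * (x0 k)\<^sup>2 * exp (r * \<phi> (lam k)))"
      "summable (\<lambda>k. (lam k) ^ 4 * (y0 k)\<^sup>2 * exp (r * \<phi> (lam k)))"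
  shows "summable (\<lambda>k. (1 + lam k ^ 4) * exp (r * growth_weight \<phi> \<mu>0 (lam k)) *
    ((y0 k)\<^sup>2 + (lam k)\<^sup>2 * (x0 k :: real)\<^sup>2))"
proof (rule summable_comparison_test')
  let ?X = "\<lambda>k. lam k ^ 6 * (x0 k)\<^sup>2 * exp (r * \<phi> (lam k))"
  let ?Y = "\<lambda>k. lam k ^ 4 * (y0 k)\<^sup>2 * exp (r * \<phi> (lam k))"
  show "summable (\<lambda>k. (1 + \<mu>0 ^ 4) * ((y0 k)\<^sup>2 + \<mu>0\<^sup>2 * (x0 k)\<^sup>2) + 2 * (?Y k + ?X k))"
    by (intro summable_add summable_mult s)
  fix k
  define l where "l = lam k"
  have l: "0 \<le> l" using lam by (simp add: l_def)
  have XY: "0 \<le> ?X k" "0 \<le> ?Y k" using lam by auto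
  have "(1 + l ^ 4) * exp (r * growth_weight \<phi> \<mu>0 l) * ((y0 k)\<^sup>2 + l\<^sup>2 * (x0 k)\<^sup>2) \<le>
     (1 + \<mu>0 ^ 4) * ((y0 k)\<^sup>2 + \<mu>0\<^sup>2 * (x0 k)\<^sup>2) + 2 * (?Y k + ?X k)"
  proof (cases "l \<le> \<mu>0")
    case True
    then have "l ^ 4 \<le> \<mu>0 ^ 4" "l\<^sup>2 \<le> \<mu>0\<^sup>2" using l by (auto intro: power_mono)
    then have 1: "(1 + l ^ 4) * ((y0 k)\<^sup>2 + l\<^sup>2 * (x0 k)\<^sup>2) \<le> (1 + \<mu>0 ^ 4) * ((y0 k)\<^sup>2 + \<mu>0\<^sup>2 * (x0 k)\<^sup>2)"
      using l \<open>1 \<le> \<mu>0\<close> by (intro mult_mono add_mono mult_right_mono) auto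
    have 2: "0 \<le> 2 * (?Y k + ?X k)" by (intro mult_nonneg_nonneg add_nonneg_nonneg XY) simp
    have "growth_weight \<phi> \<mu>0 l = 0" using True by (simp add: growth_weight_def)
    with add_mono[OF 1 2] show ?thesis
      by (simp only: mult_zero_right exp_zero mult_1_right add_0_right)
  next
    case False
    then have "1 \<le> l" using \<open>1 \<le> \<mu>0\<close> by simp
    then have "1 \<le> l ^ 4" by (rule one_le_power)
    then have "(1 + l ^ 4) * exp (r * \<phi> l) * ((y0 k)\<^sup>2 + l\<^sup>2 * (x0 k)\<^sup>2) \<le>
        (2 * l ^ 4) * exp (r * \<phi> l) * ((y0 k)\<^sup>2 + l\<^sup>2 * (x0 k)\<^sup>2)"
      by (intro mult_right_mono) auto
    also have "\<dots> = 2 * (?Y k + ?X k)"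
    proof -
      have "l ^ 6 = l ^ 4 * l\<^sup>2" by (simp flip: power_add)
      then show ?thesis unfolding l_def[symmetric] by (simp add: algebra_simps)
    qed
    also have "\<dots> \<le> (1 + \<mu>0 ^ 4) * ((y0 k)\<^sup>2 + \<mu>0\<^sup>2 * (x0 k)\<^sup>2) + 2 * (?Y k + ?X k)"
      using \<open>1 \<le> \<mu>0\<close> by simp
    finally show ?thesis using False by (simp add: growth_weight_def)
  qed
  then show "norm ((1 + lam k ^ 4) * exp (r * growth_weight \<phi> \<mu>0 (lam k)) *
      ((y0 k)\<^sup>2 + (lam k)\<^sup>2 * (x0 k)\<^sup>2)) \<le>
      (1 + \<mu>0 ^ 4) * ((y0 k)\<^sup>2 + \<mu>0\<^sup>2 * (x0 k)\<^sup>2) + 2 * (?Y k + ?X k)"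
    using lam by (simp add: l_def abs_mult)
qed

section \<open>Comparison of two mode systems after the change of time\<close>

lemma forced_mode_subinterval:
  assumes "forced_mode \<mu> c \<delta> B p q" "\<delta>' \<le> \<delta>"
  shows "forced_mode \<mu> c \<delta>' B p q"
proof -
  have sub: "{0..\<delta>'} \<subseteq> {0..\<delta>}" "{0<..<\<delta>'} \<subseteq> {0<..<\<delta>}" using assms(2) by auto
  show ?thesis
    using assms(1) sub continuous_on_subset[OF _ sub(1)] unfolding forced_mode_def
    by (meson subset_iff)
qed

lemma C2_on_scale:
  assumes "C2_on \<tau> f f' f''"
  shows "C2_on \<tau> (\<lambda>t. s * f t) (\<lambda>t. s * f' t) (\<lambda>t. s * f'' t)"
  using assms unfolding C2_on_def by (auto intro!: DERIV_cmult continuous_intros)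

text \<open>Equal stiffness at \<open>t\<close> and \<open>h t\<close> gives both modes the same
  coefficient, so the homogeneous parts subtract exactly. What remains is \<open>f\<close> times
  \<open>y2\<close> and \<open>f\<close> times \<open>c (lam k)\<^sup>2 x2\<close>; the latter
  exceeds the energy by one factor \<open>lam k\<close>, hence \<open>(lam k)\<^sup>2 * R\<close> in
  the bound on squares.\<close>

lemma difference_forced_mode:
  assumes modes1: "kirchhoff_modes lam m \<tau> x1 y1" and modes2: "kirchhoff_modes lam m \<tau> x2 y2"
    and \<delta>: "\<delta> \<le> \<tau>" "\<tau>' \<le> \<tau>"
    and ch: "continuous_on {0..\<delta>} h" and h: "\<And>t. t \<in> {0..\<delta>} \<Longrightarrow> h t \<in> {0..\<tau>'}"
    and st: "\<And>t. t \<in> {0..\<delta>} \<Longrightarrow> stiffness lam x2 (h t) = stiffness lam x1 t"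
    and hi: "\<And>t. t \<in> {0<..<\<delta>} \<Longrightarrow> 0 < h t \<and> h t < \<tau>'"
    and dh: "\<And>t. t \<in> {0<..<\<delta>} \<Longrightarrow> (h has_real_derivative 1 - f t) (at t)"
    and f: "\<And>t. t \<in> {0<..<\<delta>} \<Longrightarrow> \<bar>f t\<bar> \<le> S"
    and M: "\<And>t. \<bar>propagation lam m \<tau> x1 t\<bar> \<le> M"
    and R: "\<And>t. t \<in> {0..\<tau>'} \<Longrightarrow> (y2 k t)\<^sup>2 + (lam k)\<^sup>2 * (x2 k t)\<^sup>2 \<le> R" and "0 \<le> lam k"
  shows "forced_mode (lam k) (propagation lam m \<tau> x1) \<delta> (S\<^sup>2 * (1 + M\<^sup>2) * ((lam k)\<^sup>2 * R))
    (\<lambda>t. x1 k t - x2 k (h t)) (\<lambda>t. y1 k t - y2 k (h t))"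
  unfolding forced_mode_def
proof (intro conjI ballI)
  have sub: "{0..\<delta>} \<subseteq> {0..\<tau>}" "h ` {0..\<delta>} \<subseteq> {0..\<tau>}" using \<delta> h by force+
  note c1 = kirchhoff_modes_continuous[OF modes1] and c2 = kirchhoff_modes_continuous[OF modes2]
  show "continuous_on {0..\<delta>} (\<lambda>t. x1 k t - x2 k (h t))"
    by (intro continuous_on_diff continuous_on_subset[OF c1(1) sub(1)]
        continuous_on_compose2[OF c2(1) ch sub(2)])
  show "continuous_on {0..\<delta>} (\<lambda>t. y1 k t - y2 k (h t))"
    by (intro continuous_on_diff continuous_on_subset[OF c1(2) sub(1)]
        continuous_on_compose2[OF c2(2) ch sub(2)])
  fix t assume t: "t \<in> {0<..<\<delta>}"
  define c where "c = propagation lam m \<tau> x1 t"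
  have t': "t \<in> {0..\<delta>}" using t by auto
  have c: "c = m (stiffness lam x1 t)" "c = m (stiffness lam x2 (h t))"
    unfolding c_def using propagation_eq[of t \<tau> lam m x1] t \<delta> st[OF t'] by auto
  have it: "0 < t" "t < \<tau>" "0 < h t" "h t < \<tau>" using t \<delta> hi[OF t] by auto
  note d1 = kirchhoff_modes_interior[OF modes1 it(1,2), of k]
  note d2 = kirchhoff_modes_interior[OF modes2 it(3,4), of k]
  define F where "F = f t * y2 k (h t)"
  define G where "G = - (f t * c * (lam k)\<^sup>2 * x2 k (h t))"
  have "((\<lambda>t. x1 k t - x2 k (h t)) has_real_derivative y1 k t - y2 k (h t) * (1 - f t)) (at t)"
    by (rule DERIV_diff[OF d1(1) DERIV_chain2[OF d2(1) dh[OF t]]])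
  then have dp: "((\<lambda>t. x1 k t - x2 k (h t)) has_real_derivative y1 k t - y2 k (h t) + F) (at t)"
    by (rule DERIV_cong) (simp add: F_def algebra_simps)
  have "((\<lambda>t. y1 k t - y2 k (h t)) has_real_derivative
      - (c * (lam k)\<^sup>2 * x1 k t) - - (c * (lam k)\<^sup>2 * x2 k (h t)) * (1 - f t)) (at t)"
    using DERIV_diff[OF d1(2) DERIV_chain2[OF d2(2) dh[OF t]]] unfolding c(1)[symmetric] c(2)[symmetric] .
  then have dq: "((\<lambda>t. y1 k t - y2 k (h t)) has_real_derivative
      G - c * (lam k)\<^sup>2 * (x1 k t - x2 k (h t))) (at t)"
    by (rule DERIV_cong) (simp add: G_def algebra_simps)
  note B = mode_products_bound[OF R[OF h[OF t']] \<open>0 \<le> lam k\<close>]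
  have f2: "(f t)\<^sup>2 \<le> S\<^sup>2" using f[OF t] by (meson abs_ge_zero power2_le_iff_abs_le order_trans)
  have c2': "c\<^sup>2 \<le> M\<^sup>2" using M[of t] unfolding c_def by (meson abs_ge_zero power2_le_iff_abs_le order_trans)
  have F: "F\<^sup>2 \<le> S\<^sup>2 * R" unfolding F_def power_mult_distrib using f2 B by (intro mult_mono) auto
  have "(lam k)\<^sup>2 * F\<^sup>2 \<le> (lam k)\<^sup>2 * (S\<^sup>2 * R)" by (intro mult_left_mono F) auto
  also have "\<dots> = S\<^sup>2 * 1 * ((lam k)\<^sup>2 * R)" by simp
  also have "\<dots> \<le> S\<^sup>2 * (1 + M\<^sup>2) * ((lam k)\<^sup>2 * R)" using B(3) by (intro mult_right_mono mult_left_mono) auto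
  finally have F': "(lam k)\<^sup>2 * F\<^sup>2 \<le> S\<^sup>2 * (1 + M\<^sup>2) * ((lam k)\<^sup>2 * R)" .
  have "G\<^sup>2 = (f t)\<^sup>2 * c\<^sup>2 * ((lam k)\<^sup>2 * ((lam k)\<^sup>2 * (x2 k (h t))\<^sup>2))"
    unfolding G_def by (simp add: power2_eq_square)
  also have "\<dots> \<le> S\<^sup>2 * M\<^sup>2 * ((lam k)\<^sup>2 * R)"
    using f2 c2' B by (intro mult_mono) auto
  also have "\<dots> \<le> S\<^sup>2 * (1 + M\<^sup>2) * ((lam k)\<^sup>2 * R)" using B(3) by (intro mult_right_mono mult_left_mono) auto
  finally have "G\<^sup>2 \<le> S\<^sup>2 * (1 + M\<^sup>2) * ((lam k)\<^sup>2 * R)" .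
  with dp dq F' show "\<exists>F G. ((\<lambda>t. x1 k t - x2 k (h t)) has_real_derivative y1 k t - y2 k (h t) + F) (at t) \<and>
       ((\<lambda>t. y1 k t - y2 k (h t)) has_real_derivative
         G - propagation lam m \<tau> x1 t * (lam k)\<^sup>2 * (x1 k t - x2 k (h t))) (at t) \<and>
       (lam k)\<^sup>2 * F\<^sup>2 \<le> S\<^sup>2 * (1 + M\<^sup>2) * ((lam k)\<^sup>2 * R) \<and> G\<^sup>2 \<le> S\<^sup>2 * (1 + M\<^sup>2) * ((lam k)\<^sup>2 * R)"
    unfolding c_def by blast
qed

text \<open>Factor \<open>a\<^sup>2 - b\<^sup>2\<close> and use
  \<open>2uv \<le> u\<^sup>2 + v\<^sup>2\<close> after dividing \<open>\<bar>a - b\<bar>\<close> by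
  \<open>\<theta>\<close>. The small parameter then comes out linearly, and mode by mode only the
  summable \<open>W + 4 * R\<close> is left.\<close>

lemma square_difference_bound:
  fixes a b \<theta> W R :: real
  assumes "0 < \<theta>" "(a - b)\<^sup>2 \<le> \<theta>\<^sup>2 * W" "a\<^sup>2 \<le> R" "b\<^sup>2 \<le> R"
  shows "\<bar>2 * (a\<^sup>2 - b\<^sup>2)\<bar> \<le> \<theta> * (W + 4 * R)"
proof -
  define u where "u = \<bar>a - b\<bar> / \<theta>"
  define v where "v = \<bar>a + b\<bar>"
  have "u\<^sup>2 \<le> W" using assms by (simp add: u_def power_divide pos_divide_le_eq mult_ac)
  moreover have "v\<^sup>2 \<le> 4 * R"
  proof -
    have "v\<^sup>2 = 2 * a\<^sup>2 + 2 * b\<^sup>2 - (a - b)\<^sup>2" by (simp add: v_def power2_eq_square algebra_simps)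
    then show ?thesis using assms(3,4) zero_le_power2[of "a - b"] by linarith
  qed
  ultimately have "2 * u * v \<le> W + 4 * R" using sum_squares_bound[of u v] by linarith
  then have "\<theta> * (2 * u * v) \<le> \<theta> * (W + 4 * R)" using \<open>0 < \<theta>\<close> by simp
  moreover have "\<bar>2 * (a\<^sup>2 - b\<^sup>2)\<bar> = \<theta> * (2 * u * v)"
  proof -
    have "a\<^sup>2 - b\<^sup>2 = (a - b) * (a + b)" by (simp add: power2_eq_square algebra_simps)
    then show ?thesis using \<open>0 < \<theta>\<close> by (simp add: u_def v_def abs_mult)
  qed
  ultimately show ?thesis by simp
qed

text \<open>With equal stiffness one number \<open>c\<close> multiplies both series, so only
  differences of squares have to be estimated and \<open>m\<close> is never compared at two
  points.\<close>

lemma stiffness''_difference: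
  assumes lam: "\<forall>k. 0 \<le> lam k" and "0 < \<theta>"
    and st: "stiffness lam x1 t = stiffness lam x2 s" and M: "\<bar>m (stiffness lam x1 t)\<bar> \<le> M"
    and diff: "\<And>k. (y1 k t - y2 k s)\<^sup>2 + (lam k)\<^sup>2 * (x1 k t - x2 k s)\<^sup>2 \<le> \<theta>\<^sup>2 * W k"
    and R1: "\<And>k. (y1 k t)\<^sup>2 + (lam k)\<^sup>2 * (x1 k t)\<^sup>2 \<le> R k"
    and R2: "\<And>k. (y2 k s)\<^sup>2 + (lam k)\<^sup>2 * (x2 k s)\<^sup>2 \<le> R k"
    and summable: "summable (\<lambda>k. (lam k)\<^sup>2 * (W k + 4 * R k))"
      "summable (\<lambda>k. 2 * ((lam k)\<^sup>2 * ((y1 k t)\<^sup>2 - m (stiffness lam x1 t) * ((lam k)\<^sup>2 * (x1 k t)\<^sup>2))))"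
      "summable (\<lambda>k. 2 * ((lam k)\<^sup>2 * ((y2 k s)\<^sup>2 - m (stiffness lam x2 s) * ((lam k)\<^sup>2 * (x2 k s)\<^sup>2))))"
  shows "\<bar>stiffness'' lam m x1 y1 t - stiffness'' lam m x2 y2 s\<bar> \<le>
    \<theta> * (1 + M) * (\<Sum>k. (lam k)\<^sup>2 * (W k + 4 * R k))"
proof -
  define c where "c = m (stiffness lam x1 t)"
  let ?D = "\<lambda>k. 2 * ((lam k)\<^sup>2 * ((y1 k t)\<^sup>2 - c * ((lam k)\<^sup>2 * (x1 k t)\<^sup>2))) -
    2 * ((lam k)\<^sup>2 * ((y2 k s)\<^sup>2 - c * ((lam k)\<^sup>2 * (x2 k s)\<^sup>2)))"
  have eq: "stiffness'' lam m x1 y1 t - stiffness'' lam m x2 y2 s = (\<Sum>k. ?D k)"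
    unfolding stiffness''_def using summable(2,3) unfolding st[symmetric] c_def[symmetric]
    by (rule suminf_diff)
  have b: "norm (?D k) \<le> \<theta> * (1 + M) * ((lam k)\<^sup>2 * (W k + 4 * R k))" for k
  proof -
    let ?A = "2 * ((y1 k t)\<^sup>2 - (y2 k s)\<^sup>2)" and ?B = "2 * ((lam k * x1 k t)\<^sup>2 - (lam k * x2 k s)\<^sup>2)"
    have d: "(y1 k t - y2 k s)\<^sup>2 \<le> \<theta>\<^sup>2 * W k" "(lam k * x1 k t - lam k * x2 k s)\<^sup>2 \<le> \<theta>\<^sup>2 * W k"
      using mode_products_bound(1,2)[OF diff[of k] lam[rule_format]]
      by (simp_all add: power_mult_distrib flip: right_diff_distrib)
    have r1: "(y1 k t)\<^sup>2 \<le> R k" "(lam k * x1 k t)\<^sup>2 \<le> R k"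
      using mode_products_bound(1,2)[OF R1[of k] lam[rule_format]] by (simp_all add: power_mult_distrib)
    have r2: "(y2 k s)\<^sup>2 \<le> R k" "(lam k * x2 k s)\<^sup>2 \<le> R k"
      using mode_products_bound(1,2)[OF R2[of k] lam[rule_format]] by (simp_all add: power_mult_distrib)
    have A: "\<bar>?A\<bar> \<le> \<theta> * (W k + 4 * R k)"
      by (rule square_difference_bound[OF \<open>0 < \<theta>\<close> d(1) r1(1) r2(1)])
    have B: "\<bar>?B\<bar> \<le> \<theta> * (W k + 4 * R k)"
      by (rule square_difference_bound[OF \<open>0 < \<theta>\<close> d(2) r1(2) r2(2)])
    have cB: "\<bar>c * ?B\<bar> \<le> M * (\<theta> * (W k + 4 * R k))"
      unfolding abs_mult[of c] using M B c_def by (intro mult_mono) auto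
    have "\<bar>?A - c * ?B\<bar> \<le> (1 + M) * (\<theta> * (W k + 4 * R k))"
      using abs_triangle_ineq4[of ?A "c * ?B"] A cB by (simp only: distrib_right mult_1_left)
    then have "(lam k)\<^sup>2 * \<bar>?A - c * ?B\<bar> \<le> (lam k)\<^sup>2 * ((1 + M) * (\<theta> * (W k + 4 * R k)))"
      by (intro mult_left_mono) auto
    moreover have "norm (?D k) = (lam k)\<^sup>2 * \<bar>?A - c * ?B\<bar>"
    proof -
      have "?D k = (lam k)\<^sup>2 * (?A - c * ?B)" by (simp add: power_mult_distrib algebra_simps)
      then show ?thesis by (simp add: abs_mult)
    qed
    ultimately show ?thesis by (simp only: mult_ac)
  qed
  have "norm (\<Sum>k. ?D k) \<le> (\<Sum>k. \<theta> * (1 + M) * ((lam k)\<^sup>2 * (W k + 4 * R k)))"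
    by (rule norm_suminf_le[OF b summable_mult[OF summable(1)]])
  also have "\<dots> = \<theta> * (1 + M) * (\<Sum>k. (lam k)\<^sup>2 * (W k + 4 * R k))"
    by (rule suminf_mult[OF summable(1)])
  finally show ?thesis unfolding eq by simp
qed

text \<open>The unknown is \<open>f = 1 - h'\<close>. A bound \<open>S\<close> on it bounds the
  energy of the difference by \<open>\<delta> * S\<^sup>2 * W k\<close>, hence the difference of the
  second derivatives by \<open>sqrt \<delta> * S * (1 + M) * N\<close>, and returns as
  \<open>S / 2\<close>. Repeated halving leaves only \<open>f = 0\<close>.\<close>

lemma local_uniqueness:
  assumes \<omega>: "cont_modulus \<omega>" and m: "omega_continuous \<omega> m" and \<nu>: "\<forall>\<sigma>\<ge>0. \<nu> \<le> m \<sigma>"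
    and \<phi>: "\<forall>\<sigma>\<ge>0. \<phi> \<sigma> > 0" and hyp: "hyperbolicity \<omega> \<phi> \<nu>" and lam: "\<forall>k. 0 \<le> lam k"
    and "0 < \<tau>" "0 < r"
    and modes1: "kirchhoff_modes lam m \<tau> x1 y1" and modes2: "kirchhoff_modes lam m \<tau> x2 y2"
    and init: "\<And>k. x1 k 0 = x0 k" "\<And>k. y1 k 0 = y0 k" "\<And>k. x2 k 0 = x0 k" "\<And>k. y2 k 0 = y0 k"
    and s: "summable (\<lambda>k. (x0 k)\<^sup>2)" "summable (\<lambda>k. (y0 k)\<^sup>2)"
      "summable (\<lambda>k. (lam k) ^ 6 * (x0 k)\<^sup>2 * exp (r * \<phi> (lam k)))"
      "summable (\<lambda>k. (lam k) ^ 4 * (y0 k)\<^sup>2 * exp (r * \<phi> (lam k)))"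
    and nondeg: "stiffness' lam x1 y1 0 \<noteq> 0 \<or> stiffness'' lam m x1 y1 0 \<noteq> 0"
  obtains \<delta> where "0 < \<delta>" "\<delta> \<le> \<tau>" "\<And>k t. t \<in> {0..\<delta>} \<Longrightarrow> x1 k t = x2 k t"
proof -
  have "0 \<le> \<tau>" using \<open>0 < \<tau>\<close> by simp
  have \<omega>nn: "0 \<le> \<omega> x" if "0 \<le> x" for x using \<omega> that by (simp add: cont_modulus_def)
  have \<nu>0: "0 \<le> \<nu>" using hyp by (auto simp: hyperbolicity_def)
  obtain L1 M1 where LM1: "0 \<le> L1" "0 \<le> M1"
    "\<And>s t. \<bar>propagation lam m \<tau> x1 s - propagation lam m \<tau> x1 t\<bar> \<le> L1 * \<omega> \<bar>s - t\<bar>"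
    "\<And>s. \<nu> \<le> propagation lam m \<tau> x1 s \<and> propagation lam m \<tau> x1 s \<le> M1"
    by (rule propagation_modulus[OF \<omega> m \<nu> modes1 \<open>0 \<le> \<tau>\<close>]) (rule that)
  obtain L2 M2 where LM2: "0 \<le> L2" "0 \<le> M2"
    "\<And>s t. \<bar>propagation lam m \<tau> x2 s - propagation lam m \<tau> x2 t\<bar> \<le> L2 * \<omega> \<bar>s - t\<bar>"
    "\<And>s. \<nu> \<le> propagation lam m \<tau> x2 s \<and> propagation lam m \<tau> x2 s \<le> M2"
    by (rule propagation_modulus[OF \<omega> m \<nu> modes2 \<open>0 \<le> \<tau>\<close>]) (rule that)
  \<comment> \<open>Constants common to both solutions, so that one time length and one frequency
    threshold serve for both.\<close>
  define L where "L = L1 + L2"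
  define M where "M = M1 + M2"
  have LM: "0 \<le> L" "0 \<le> M" using LM1 LM2 by (auto simp: L_def M_def)
  have cL: "\<bar>propagation lam m \<tau> x s - propagation lam m \<tau> x t\<bar> \<le> L * \<omega> \<bar>s - t\<bar>" if "x \<in> {x1, x2}" for x s t
  proof -
    have "L1 * \<omega> \<bar>s - t\<bar> \<le> L * \<omega> \<bar>s - t\<bar>" "L2 * \<omega> \<bar>s - t\<bar> \<le> L * \<omega> \<bar>s - t\<bar>"
      using LM1(1) LM2(1) \<omega>nn[of "\<bar>s - t\<bar>"] by (auto simp: L_def intro!: mult_right_mono)
    then show ?thesis using LM1(3)[of s t] LM2(3)[of s t] that by auto
  qed
  have cM: "\<nu> \<le> propagation lam m \<tau> x s \<and> propagation lam m \<tau> x s \<le> M" if "x \<in> {x1, x2}" for x s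
    using LM1(2) LM1(4)[of s] LM2(2) LM2(4)[of s] that unfolding M_def by auto
  have cabs: "\<bar>propagation lam m \<tau> x s\<bar> \<le> M" if "x \<in> {x1, x2}" for x s
    using cM[OF that, of s] \<nu>0 by auto
  \<comment> \<open>Half of the weight, since \<open>E k\<close> enters twice: in
    \<open>R k\<close>, and again in \<open>W k\<close>, which contains \<open>R k\<close>. The data
    pay for \<open>E k * E k\<close>.\<close>
  have "0 < r / 2" using \<open>0 < r\<close> by simp
  obtain C \<tau>0 \<mu>0 where C: "0 < C" and "0 < \<tau>0" "1 \<le> \<mu>0" and mode:
    "\<And>\<mu> c \<delta> B p q t. \<lbrakk>forced_mode \<mu> c \<delta> B p q; 0 \<le> \<mu>; \<And>s. \<nu> \<le> c s \<and> c s \<le> M;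
      \<And>s t. \<bar>c s - c t\<bar> \<le> L * \<omega> \<bar>s - t\<bar>; 0 \<le> B; \<delta> \<le> \<tau>0; t \<in> {0..\<delta>}\<rbrakk> \<Longrightarrow>
      (q t)\<^sup>2 + \<mu>\<^sup>2 * (p t)\<^sup>2 \<le>
        C * exp (r / 2 * growth_weight \<phi> \<mu>0 \<mu>) * ((q 0)\<^sup>2 + \<mu>\<^sup>2 * (p 0)\<^sup>2 + t * B)"
    using mode_bound[OF \<omega> LM \<phi> hyp \<open>0 < r / 2\<close>] by metis
  define \<tau>1 where "\<tau>1 = min \<tau> \<tau>0"
  have \<tau>1: "0 < \<tau>1" "\<tau>1 \<le> \<tau>" "\<tau>1 \<le> \<tau>0" using \<open>0 < \<tau>\<close> \<open>0 < \<tau>0\<close> by (auto simp: \<tau>1_def)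
  define E where "E k = exp (r / 2 * growth_weight \<phi> \<mu>0 (lam k))" for k
  define A where "A k = (y0 k)\<^sup>2 + (lam k)\<^sup>2 * (x0 k)\<^sup>2" for k
  define R where "R k = C * E k * A k" for k
  define U where "U k = (1 + lam k ^ 4) * exp (r * growth_weight \<phi> \<mu>0 (lam k)) * A k" for k
  have gw: "0 \<le> growth_weight \<phi> \<mu>0 (lam k)" for k
    using \<phi> lam by (auto simp: growth_weight_def less_imp_le)
  have EE: "E k * E k = exp (r * growth_weight \<phi> \<mu>0 (lam k))" for k
    by (simp add: E_def exp_add[symmetric])
  have E1: "1 \<le> E k" for k using gw[of k] \<open>0 < r\<close> by (simp add: E_def)
  have A0: "0 \<le> A k" for k by (simp add: A_def)
  have R0: "0 \<le> R k" for k using C A0 E1[of k] by (simp add: R_def)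
  have sU: "summable U" unfolding U_def A_def
    by (rule summable_initial_energy[OF lam \<open>0 < r\<close> \<open>1 \<le> \<mu>0\<close> s])
  have UE: "U k = (1 + lam k ^ 4) * (E k * E k) * A k" for k unfolding U_def EE ..
  have sR: "summable (\<lambda>k. (1 + (lam k)\<^sup>2) * R k)"
  proof (rule summable_comparison_test'[OF summable_mult[OF sU, of "2 * C"]])
    fix k
    have "2 * (lam k)\<^sup>2 \<le> 1 + lam k ^ 4"
      using sum_squares_bound[of 1 "(lam k)\<^sup>2"] by (simp flip: power_mult)
    moreover have "1 + p \<le> 2 * (1 + q)" if "2 * p \<le> 1 + q" "0 \<le> q" for p q :: real
      using that by auto
    ultimately have l: "1 + (lam k)\<^sup>2 \<le> 2 * (1 + lam k ^ 4)"
      using zero_le_power[OF lam[rule_format], of k 4] by blast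
    have "(1 + (lam k)\<^sup>2) * (C * (E k * 1 * A k)) \<le> 2 * (1 + lam k ^ 4) * (C * (E k * E k * A k))"
      using l C E1[of k] A0[of k] by (intro mult_mono mult_left_mono mult_right_mono) auto
    moreover have "norm ((1 + (lam k)\<^sup>2) * R k) = (1 + (lam k)\<^sup>2) * R k"
      using R0[of k] by (simp add: abs_mult)
    ultimately show "norm ((1 + (lam k)\<^sup>2) * R k) \<le> 2 * C * U k"
      unfolding UE by (simp add: R_def mult_ac)
  qed
  have R: "(y k t)\<^sup>2 + (lam k)\<^sup>2 * (x k t)\<^sup>2 \<le> R k"
    if xy: "(x, y) \<in> {(x1, y1), (x2, y2)}" and t: "t \<in> {0..\<tau>1}" for x y k t
  proof -
    have ms: "kirchhoff_modes lam m \<tau> x y" and x: "x \<in> {x1, x2}" and i: "x k 0 = x0 k" "y k 0 = y0 k"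
      using xy modes1 modes2 init by auto
    have "forced_mode (lam k) (propagation lam m \<tau> x) \<tau>1 0 (x k) (y k)"
      by (rule forced_mode_subinterval[OF kirchhoff_modes_forced[OF ms] \<tau>1(2)])
    from mode[OF this lam[rule_format] cM[OF x] cL[OF x] order_refl \<tau>1(3) t]
    show ?thesis by (simp add: i R_def E_def A_def)
  qed
  note R1 = R[of x1 y1, simplified] and R2 = R[of x2 y2, simplified]
  define \<Sigma> where "\<Sigma> = 2 * (1 + M) * (\<Sum>k. (1 + (lam k)\<^sup>2) * R k)"
  have \<Sigma>: "C2_on \<tau>1 (stiffness lam x) (stiffness' lam x y) (stiffness'' lam m x y) \<and>
      (\<forall>t\<in>{0..\<tau>1}. \<bar>m (stiffness lam x t)\<bar> \<le> M) \<and>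
      (\<forall>t\<in>{0..\<tau>1}. \<bar>stiffness'' lam m x y t\<bar> \<le> \<Sigma>) \<and> (\<forall>t\<in>{0..\<tau>1}.
      summable (\<lambda>k. 2 * ((lam k)\<^sup>2 * ((y k t)\<^sup>2 - m (stiffness lam x t) * ((lam k)\<^sup>2 * (x k t)\<^sup>2)))))"
    if xy: "(x, y) \<in> {(x1, y1), (x2, y2)}" for x y
  proof -
    have ms: "kirchhoff_modes lam m \<tau>1 x y" and x: "x \<in> {x1, x2}"
      using xy kirchhoff_modes_subinterval[OF modes1 \<tau>1(2)] kirchhoff_modes_subinterval[OF modes2 \<tau>1(2)]
      by auto
    have ce: "propagation lam m \<tau> x t = m (stiffness lam x t)" if "t \<in> {0..\<tau>1}" for t
      using propagation_eq[of t \<tau>] that \<tau>1 by auto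
    have "continuous_on {0..\<tau>1} (propagation lam m \<tau> x)"
      using omega_continuous_imp_continuous[OF \<omega> cL[OF x]] by (rule continuous_on_subset) simp
    then have cc: "continuous_on {0..\<tau>1} (\<lambda>t. m (stiffness lam x t))"
      by (rule continuous_on_eq[OF _ ce])
    have mM: "\<bar>m (stiffness lam x t)\<bar> \<le> M" if "t \<in> {0..\<tau>1}" for t
      using cabs[OF x, of t] ce[OF that] by simp
    note S = stiffness_C2[OF ms \<tau>1(1) lam cc mM R[OF xy] sR]
    show ?thesis unfolding \<Sigma>_def
      by (intro conjI ballI)
        (rule S(1), assumption+, rule mM, assumption, rule S(2), assumption+, rule S(3), assumption+)
  qed
  have xy1: "(x1, y1) \<in> {(x1, y1), (x2, y2)}" and xy2: "(x2, y2) \<in> {(x1, y1), (x2, y2)}" by auto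
  note stiffness_c2 = \<Sigma>[THEN conjunct1]
    and m_bound = \<Sigma>[THEN conjunct2, THEN conjunct1, THEN bspec]
    and stiffness''_bound = \<Sigma>[THEN conjunct2, THEN conjunct2, THEN conjunct1, THEN bspec]
    and stiffness''_summable = \<Sigma>[THEN conjunct2, THEN conjunct2, THEN conjunct2, THEN bspec]
  have same0: "stiffness lam x2 0 = stiffness lam x1 0" "stiffness' lam x2 y2 0 = stiffness' lam x1 y1 0"
    "stiffness'' lam m x2 y2 0 = stiffness'' lam m x1 y1 0"
    unfolding stiffness_def stiffness'_def stiffness''_def by (simp_all add: init)
  \<comment> \<open>The sign making the first nonvanishing one of the two derivatives positive at 0.
    Both solutions share it because the initial data determine these values.\<close>
  define s where "s = (if stiffness' lam x1 y1 0 \<noteq> 0 then sgn (stiffness' lam x1 y1 0)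
    else sgn (stiffness'' lam m x1 y1 0))"
  have s1: "\<bar>s\<bar> = 1" using nondeg by (auto simp: s_def abs_sgn_eq)
  have nd: "s * stiffness' lam x1 y1 0 > 0 \<or>
      s * stiffness' lam x1 y1 0 = 0 \<and> s * stiffness'' lam m x1 y1 0 > 0"
    using nondeg by (auto simp: s_def sgn_if)
  define f1 where "f1 t = s * stiffness lam x1 t" for t
  define f1' where "f1' t = s * stiffness' lam x1 y1 t" for t
  define f1'' where "f1'' t = s * stiffness'' lam m x1 y1 t" for t
  define f2 where "f2 t = s * stiffness lam x2 t" for t
  define f2' where "f2' t = s * stiffness' lam x2 y2 t" for t
  define f2'' where "f2'' t = s * stiffness'' lam m x2 y2 t" for t
  have C1: "C2_on \<tau>1 f1 f1' f1''" and C2: "C2_on \<tau>1 f2 f2' f2''"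
    unfolding f1_def f1'_def f1''_def f2_def f2'_def f2''_def by (intro C2_on_scale stiffness_c2 xy1 xy2)+
  have f0: "f1 0 = f2 0" "f1' 0 = f2' 0"
    by (simp_all add: f1_def f2_def f1'_def f2'_def same0)
  have nd1: "f1' 0 > 0 \<or> f1' 0 = 0 \<and> f1'' 0 > 0" using nd by (simp add: f1'_def f1''_def)
  have nd2: "f2' 0 > 0 \<or> f2' 0 = 0 \<and> f2'' 0 > 0" using nd by (simp add: f2'_def f2''_def same0)
  obtain d1 where d1: "0 < d1" "d1 \<le> \<tau>1" "\<And>t. t \<in> {0<..d1} \<Longrightarrow> 0 < f1' t"
    using increment_le_deriv_square[OF C1 \<tau>1(1) nd1] by metis
  obtain d2 K where d2: "0 < d2" "d2 \<le> \<tau>1" "0 \<le> K" "\<And>t. t \<in> {0<..d2} \<Longrightarrow> 0 < f2' t"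
    "\<And>t. t \<in> {0<..d2} \<Longrightarrow> f2 t - f2 0 \<le> K * (f2' t)\<^sup>2"
    using increment_le_deriv_square[OF C2 \<tau>1(1) nd2] by metis
  define a where "a = min d1 d2"
  have a: "0 < a" "a \<le> \<tau>1" using d1 d2 by (auto simp: a_def)
  have p1: "0 < f1' t" if "t \<in> {0<..a}" for t using that d1 by (auto simp: a_def)
  have p2: "0 < f2' t" if "t \<in> {0<..a}" for t using that d2 by (auto simp: a_def)
  have K: "f2 t - f2 0 \<le> K * (f2' t)\<^sup>2" if "t \<in> {0<..a}" for t using that d2 by (auto simp: a_def)
  obtain d h where d: "0 < d" "d \<le> a" and h0: "h 0 = 0" and ch: "continuous_on {0..d} h"
    and h: "\<And>t. t \<in> {0..d} \<Longrightarrow> h t \<in> {0..a} \<and> f2 (h t) = f1 t"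
    and hi: "\<And>t. t \<in> {0<..<d} \<Longrightarrow> 0 < h t \<and> h t < a"
    and dh: "\<And>t. t \<in> {0<..<d} \<Longrightarrow> (h has_real_derivative f1' t / f2' (h t)) (at t)"
    using time_change[OF C1 C2 a f0(1) p1 p2] by blast
  define f where "f t = 1 - f1' t / f2' (h t)" for t
  \<comment> \<open>The linear estimate for the difference, with the factor
    \<open>\<delta> * S\<^sup>2\<close> taken out.\<close>
  define W where "W k = C * E k * (1 + M\<^sup>2) * ((lam k)\<^sup>2 * R k)" for k
  have sW: "summable (\<lambda>k. (lam k)\<^sup>2 * (W k + 4 * R k))"
  proof (rule summable_comparison_test')
    show "summable (\<lambda>k. C * C * (1 + M\<^sup>2) * U k + 4 * ((1 + (lam k)\<^sup>2) * R k))"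
      by (intro summable_add summable_mult sU sR)
    fix k
    have W0: "0 \<le> W k" using C E1[of k] R0[of k] by (simp add: W_def)
    have "(lam k)\<^sup>2 * W k = C * C * (1 + M\<^sup>2) * (lam k ^ 4 * (E k * E k) * A k)"
      unfolding W_def R_def by (simp add: power2_eq_square power4_eq_xxxx)
    also have "\<dots> \<le> C * C * (1 + M\<^sup>2) * U k"
      unfolding UE using C E1[of k] A0[of k] by (intro mult_left_mono mult_right_mono) auto
    finally have "(lam k)\<^sup>2 * W k \<le> C * C * (1 + M\<^sup>2) * U k" .
    moreover have "(lam k)\<^sup>2 * (4 * R k) \<le> 4 * ((1 + (lam k)\<^sup>2) * R k)"
      using R0[of k] by (simp add: algebra_simps)
    ultimately have "(lam k)\<^sup>2 * (W k + 4 * R k) \<le> C * C * (1 + M\<^sup>2) * U k + 4 * ((1 + (lam k)\<^sup>2) * R k)"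
      by (simp only: distrib_left)
    then show "norm ((lam k)\<^sup>2 * (W k + 4 * R k)) \<le>
        C * C * (1 + M\<^sup>2) * U k + 4 * ((1 + (lam k)\<^sup>2) * R k)"
      using W0 R0[of k] by (simp add: abs_mult)
  qed
  define N where "N = (\<Sum>k. (lam k)\<^sup>2 * (W k + 4 * R k))"
  have N0: "0 \<le> N" unfolding N_def using C E1 R0 less_imp_le[OF C] order_trans[OF zero_le_one E1]
    by (intro suminf_nonneg sW) (simp add: W_def)
  \<comment> \<open>Twice the constant \<open>2 * K * (1 + M) * N\<close> gained in one turn, so
    that a turn multiplies \<open>S\<close> by \<open>sqrt \<delta> * D / 2\<close>.\<close>
  define D where "D = 4 * K * ((1 + M) * N)"
  have D0: "0 \<le> D" using d2(3) N0 LM by (simp add: D_def)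
  \<comment> \<open>This gives \<open>sqrt \<delta> * D \<le> D / (D + 1) \<le> 1\<close>; the
    \<open>+ 1\<close> covers \<open>D = 0\<close>.\<close>
  define \<delta> where "\<delta> = min d ((1 / (D + 1))\<^sup>2)"
  have \<delta>: "0 < \<delta>" "\<delta> \<le> d" using d D0 by (auto simp: \<delta>_def)
  have "sqrt \<delta> \<le> 1 / (D + 1)" using D0 by (intro real_le_lsqrt) (auto simp: \<delta>_def)
  then have "sqrt \<delta> * D \<le> 1 / (D + 1) * D" using D0 by (rule mult_right_mono)
  also have "\<dots> \<le> 1" using D0 by simp
  finally have \<delta>D: "sqrt \<delta> * D \<le> 1" .
  have \<delta>\<tau>: "\<delta> \<le> \<tau>" "\<delta> \<le> \<tau>1" "\<delta> \<le> \<tau>0" "\<delta> \<le> a" using \<delta> d a \<tau>1 by auto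
  have ch': "continuous_on {0..\<delta>} h" by (rule continuous_on_subset[OF ch]) (use \<delta> in auto)
  have h1: "h t \<in> {0..\<tau>1}" if "t \<in> {0..\<delta>}" for t using h[of t] that \<delta> a by auto
  have st: "stiffness lam x2 (h t) = stiffness lam x1 t" if "t \<in> {0..\<delta>}" for t
    using h[of t] that \<delta> s1 by (auto simp: f1_def f2_def)
  have hi1: "0 < h t \<and> h t < \<tau>1" if "t \<in> {0<..<\<delta>}" for t using hi[of t] that \<delta> a by auto
  have dh1: "(h has_real_derivative 1 - f t) (at t)" if "t \<in> {0<..<\<delta>}" for t
    using dh[of t] that \<delta> by (simp add: f_def)
  have f_bound: "\<bar>f t\<bar> \<le> 2 * K * Q"
    if Q: "\<And>t. t \<in> {0<..<\<delta>} \<Longrightarrow> \<bar>stiffness'' lam m x1 y1 t - stiffness'' lam m x2 y2 (h t)\<bar> \<le> Q"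
    and t: "t \<in> {0<..<\<delta>}" for Q t
    unfolding f_def
  proof (rule time_change_deriv_bound[OF C1 C2 \<delta>\<tau>(4) a(2) f0 p1 p2 K h0 ch' _ _ _ _ t])
    fix t assume "t \<in> {0<..<\<delta>}"
    then have "\<bar>s\<bar> * \<bar>stiffness'' lam m x1 y1 t - stiffness'' lam m x2 y2 (h t)\<bar> \<le> Q"
      using Q s1 by simp
    then show "\<bar>f1'' t - f2'' (h t)\<bar> \<le> Q"
      unfolding f1''_def f2''_def right_diff_distrib[symmetric] abs_mult .
  qed (use h hi dh \<delta> in auto)
  \<comment> \<open>Because \<open>h 0 = 0\<close> and the data agree, the difference starts from
    zero and only the accumulated forcing is left; its factor \<open>t\<close> is the source of the
    small \<open>\<delta>\<close>.\<close>
  have diff: "(y1 k t - y2 k (h t))\<^sup>2 + (lam k)\<^sup>2 * (x1 k t - x2 k (h t))\<^sup>2 \<le> \<delta> * S\<^sup>2 * W k"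
    if f: "\<And>t. t \<in> {0<..<\<delta>} \<Longrightarrow> \<bar>f t\<bar> \<le> S" and t: "t \<in> {0..\<delta>}" for S t k
  proof -
    let ?B = "S\<^sup>2 * (1 + M\<^sup>2) * ((lam k)\<^sup>2 * R k)"
    have B0: "0 \<le> ?B" using R0[of k] by simp
    have x: "x1 \<in> {x1, x2}" by simp
    have "forced_mode (lam k) (propagation lam m \<tau> x1) \<delta> ?B
        (\<lambda>t. x1 k t - x2 k (h t)) (\<lambda>t. y1 k t - y2 k (h t))"
      by (rule difference_forced_mode[OF modes1 modes2 \<delta>\<tau>(1) \<tau>1(2) ch' h1 st hi1 dh1 f cabs[OF x] R2 lam[rule_format]])
        auto
    from mode[OF this lam[rule_format] cM[OF x] cL[OF x] B0 \<delta>\<tau>(3) t]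
    have "(y1 k t - y2 k (h t))\<^sup>2 + (lam k)\<^sup>2 * (x1 k t - x2 k (h t))\<^sup>2 \<le> C * E k * (t * ?B)"
      by (simp add: h0 init E_def)
    also have "\<dots> \<le> C * E k * (\<delta> * ?B)"
      using C E1[of k] B0 t by (intro mult_left_mono mult_right_mono) auto
    also have "\<dots> = \<delta> * S\<^sup>2 * W k" unfolding W_def by (simp only: mult_ac)
    finally show ?thesis .
  qed
  have halve: "\<bar>f t\<bar> \<le> S / 2"
    if "0 < S" and f: "\<And>t. t \<in> {0<..<\<delta>} \<Longrightarrow> \<bar>f t\<bar> \<le> S" and t: "t \<in> {0<..<\<delta>}" for S t
  proof -
    have "\<bar>f t\<bar> \<le> 2 * K * (sqrt \<delta> * S * (1 + M) * N)"
    proof (rule f_bound[OF _ t])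
      fix t assume t: "t \<in> {0<..<\<delta>}"
      then have t': "t \<in> {0..\<delta>}" "t \<in> {0..\<tau>1}" using \<delta>\<tau> by auto
      show "\<bar>stiffness'' lam m x1 y1 t - stiffness'' lam m x2 y2 (h t)\<bar> \<le> sqrt \<delta> * S * (1 + M) * N"
        unfolding N_def
      proof (rule stiffness''_difference[OF lam])
        show "0 < sqrt \<delta> * S" using \<delta> \<open>0 < S\<close> by simp
        show "stiffness lam x1 t = stiffness lam x2 (h t)" using st[OF t'(1)] by simp
        show "\<bar>m (stiffness lam x1 t)\<bar> \<le> M" by (rule m_bound[OF xy1 t'(2)])
        show "(y1 k t - y2 k (h t))\<^sup>2 + (lam k)\<^sup>2 * (x1 k t - x2 k (h t))\<^sup>2 \<le> (sqrt \<delta> * S)\<^sup>2 * W k" for k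
          using diff[OF f t'(1)] \<delta> by (simp add: power_mult_distrib)
        show "(y1 k t)\<^sup>2 + (lam k)\<^sup>2 * (x1 k t)\<^sup>2 \<le> R k" for k using R1 t' by auto
        show "(y2 k (h t))\<^sup>2 + (lam k)\<^sup>2 * (x2 k (h t))\<^sup>2 \<le> R k" for k using R2 h1[OF t'(1)] by auto
        show "summable (\<lambda>k. (lam k)\<^sup>2 * (W k + 4 * R k))" by (rule sW)
      qed (rule stiffness''_summable[OF xy1 t'(2)] stiffness''_summable[OF xy2 h1[OF t'(1)]])+
    qed
    also have "\<dots> = sqrt \<delta> * D * (S / 2)" by (simp add: D_def)
    also have "\<dots> \<le> 1 * (S / 2)" using \<delta>D \<open>0 < S\<close> by (intro mult_right_mono) auto
    finally show ?thesis by simp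
  qed
  \<comment> \<open>A finite starting bound comes from the bound \<open>\<Sigma>\<close> on both
    second derivatives; the \<open>+ 1\<close> makes it positive, as halving requires.\<close>
  define S0 where "S0 = 2 * K * (2 * \<Sigma>) + 1"
  have S0: "\<bar>f t\<bar> \<le> S0" if t: "t \<in> {0<..<\<delta>}" for t
  proof -
    have "\<bar>stiffness'' lam m x1 y1 t - stiffness'' lam m x2 y2 (h t)\<bar> \<le> 2 * \<Sigma>"
      if "t \<in> {0<..<\<delta>}" for t
    proof -
      have "t \<in> {0..\<tau>1}" "h t \<in> {0..\<tau>1}" using that \<delta>\<tau> h1[of t] by auto
      then have "\<bar>stiffness'' lam m x1 y1 t\<bar> \<le> \<Sigma>" "\<bar>stiffness'' lam m x2 y2 (h t)\<bar> \<le> \<Sigma>"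
        by (auto intro: stiffness''_bound[OF xy1] stiffness''_bound[OF xy2])
      then show ?thesis by linarith
    qed
    from f_bound[OF this t] show ?thesis by (simp add: S0_def)
  qed
  have "0 \<le> \<Sigma>" using stiffness''_bound[OF xy1, of 0] \<tau>1(1) by auto
  then have S0_pos: "0 < S0" using d2(3) by (simp add: S0_def add_nonneg_pos)
  have iter: "\<forall>t\<in>{0<..<\<delta>}. \<bar>f t\<bar> \<le> S0 / 2 ^ n" for n
  proof (induction n)
    case 0
    then show ?case using S0 by simp
  next
    case (Suc n)
    then show ?case using halve[of "S0 / 2 ^ n"] S0_pos by (auto simp: mult.commute)
  qed
  have f0': "f t = 0" if t: "t \<in> {0<..<\<delta>}" for t
  proof (rule ccontr)
    assume "f t \<noteq> 0"
    then have "0 < \<bar>f t\<bar> / S0" using S0_pos by simp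
    then obtain n where n: "(1 / 2) ^ n < \<bar>f t\<bar> / S0"
      using real_arch_pow_inv[of "\<bar>f t\<bar> / S0" "1 / 2"] by auto
    then have "S0 / 2 ^ n < \<bar>f t\<bar>" using S0_pos by (simp add: field_simps power_divide)
    then show False using bspec[OF iter[of n] t] by linarith
  qed
  have h_id: "h t = t" if t: "t \<in> {0..\<delta>}" for t
  proof -
    have "h t - t = h 0 - 0"
    proof (rule DERIV_isconst2[OF \<delta>(1)])
      show "continuous_on {0..\<delta>} (\<lambda>t. h t - t)" by (intro continuous_intros ch')
      fix t assume "0 < t" "t < \<delta>"
      then show "((\<lambda>t. h t - t) has_real_derivative 0) (at t)"
        using DERIV_diff[OF dh1[of t] DERIV_ident] f0'[of t] by simp
    qed (use t in auto)
    then show ?thesis by (simp add: h0)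
  qed
  \<comment> \<open>Velocities come first: the energy controls \<open>lam k * x\<close>, which says
    nothing about \<open>x\<close> when \<open>lam k = 0\<close>. Positions then follow by
    integration from equal data.\<close>
  have y_eq: "y1 k t = y2 k t" if t: "t \<in> {0..\<delta>}" for k t
  proof -
    have "(y1 k t - y2 k (h t))\<^sup>2 + (lam k)\<^sup>2 * (x1 k t - x2 k (h t))\<^sup>2 \<le> \<delta> * 0\<^sup>2 * W k"
      by (rule diff[OF _ t]) (simp add: f0')
    then have "(y1 k t - y2 k (h t))\<^sup>2 \<le> 0"
      using mode_products_bound(2)[OF _ lam[rule_format]] by fastforce
    then show ?thesis using h_id[OF t] by simp
  qed
  have x_eq: "x1 k t = x2 k t" if t: "t \<in> {0..\<delta>}" for k t
  proof -
    have "x1 k t - x2 k t = x1 k 0 - x2 k 0"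
    proof (rule DERIV_isconst2[OF \<delta>(1)])
      show "continuous_on {0..\<delta>} (\<lambda>t. x1 k t - x2 k t)"
        using kirchhoff_modes_continuous(1)[OF kirchhoff_modes_subinterval[OF modes1 \<delta>\<tau>(1)], of k]
          kirchhoff_modes_continuous(1)[OF kirchhoff_modes_subinterval[OF modes2 \<delta>\<tau>(1)], of k]
        by (rule continuous_on_diff)
      fix t assume "0 < t" "t < \<delta>"
      then show "((\<lambda>t. x1 k t - x2 k t) has_real_derivative 0) (at t)"
        using DERIV_diff[OF kirchhoff_modes_interior(1)[OF modes1, of t k]
            kirchhoff_modes_interior(1)[OF modes2, of t k]] \<delta>\<tau>(1) y_eq[of t k] by simp
    qed (use t in auto)
    then show ?thesis by (simp add: init)
  qed
  show ?thesis by (rule that[OF \<delta>(1) \<delta>\<tau>(1) x_eq])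
qed

section \<open>Solutions in the Hilbert space\<close>

lemma lampow_simps:
  assumes "0 \<le> l"
  shows "lampow l 1 = l" "lampow l 2 = l\<^sup>2" "lampow l 4 = l ^ 4" "lampow l 6 = l ^ 6"
  using assms by (simp_all add: lampow_def)

lemma hilbert_basis_inner_sums:
  assumes "hilbert_basis e"
  shows "(\<lambda>k. inner u (e k) * inner w (e k)) sums inner u w"
proof -
  have "(\<lambda>n. \<Sum>k<n. inner u (e k) *\<^sub>R e k) \<longlonglongrightarrow> u" using assms by (simp add: hilbert_basis_def)
  then have "(\<lambda>n. inner (\<Sum>k<n. inner u (e k) *\<^sub>R e k) w) \<longlonglongrightarrow> inner u w"
    by (intro tendsto_intros)
  then show ?thesis by (simp add: sums_def inner_sum_left inner_commute[of w])
qed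

lemma hilbert_basis_norm_sums:
  assumes "hilbert_basis e"
  shows "(\<lambda>k. (inner u (e k))\<^sup>2) sums (norm u)\<^sup>2"
  using hilbert_basis_inner_sums[OF assms, of u u] by (simp add: power2_eq_square power2_norm_eq_inner[symmetric])

lemma hilbert_basis_bessel:
  assumes "hilbert_basis e"
  shows "(\<Sum>k<n. (inner u (e k))\<^sup>2) \<le> (norm u)\<^sup>2"
  using hilbert_basis_norm_sums[OF assms, of u] sum_le_suminf[of "\<lambda>k. (inner u (e k))\<^sup>2" "{..<n}"]
  by (auto simp: sums_iff)

lemma hilbert_basis_eqI:
  assumes "hilbert_basis e" "\<And>k. inner u (e k) = inner w (e k)"
  shows "u = w"
proof -
  have "(\<lambda>n. \<Sum>k<n. inner u (e k) *\<^sub>R e k) \<longlonglongrightarrow> u" "(\<lambda>n. \<Sum>k<n. inner w (e k) *\<^sub>R e k) \<longlonglongrightarrow> w"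
    using assms(1) by (auto simp: hilbert_basis_def)
  then show ?thesis using assms(2) by (auto intro: LIMSEQ_unique)
qed

text \<open>Riesz-Fischer, from Pythagoras and completeness. The series defining \<open>Apow\<close>
  has meaningful coordinates only once it converges.\<close>

lemma hilbert_basis_summable:
  fixes e :: "nat \<Rightarrow> 'a::{real_inner,complete_space}"
  assumes e: "hilbert_basis e" and a: "summable (\<lambda>k. (a k)\<^sup>2)"
  shows "summable (\<lambda>k. a k *\<^sub>R e k)"
proof -
  have "Cauchy (\<lambda>n. \<Sum>k<n. a k *\<^sub>R e k)"
  proof (rule metric_CauchyI)
    fix \<epsilon> :: real assume \<epsilon>: "0 < \<epsilon>"
    have on: "inner (e j) (e k) = (if j = k then 1 else 0)" for j k using e by (simp add: hilbert_basis_def)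
    have n: "(norm (\<Sum>k\<in>{m..<n}. a k *\<^sub>R e k))\<^sup>2 = (\<Sum>k\<in>{m..<n}. (a k)\<^sup>2)" for m n
    proof -
      have "(norm (\<Sum>k\<in>{m..<n}. a k *\<^sub>R e k))\<^sup>2 = (\<Sum>k\<in>{m..<n}. (norm (a k *\<^sub>R e k))\<^sup>2)"
        by (rule norm_sum_Pythagorean) (auto simp: pairwise_def orthogonal_def on)
      also have "\<dots> = (\<Sum>k\<in>{m..<n}. (a k)\<^sup>2)"
        using on by (simp add: power_mult_distrib power2_norm_eq_inner)
      finally show ?thesis .
    qed
    have "0 < \<epsilon>\<^sup>2" using \<epsilon> by simp
    then obtain N where N: "\<forall>m\<ge>N. \<forall>n. norm (\<Sum>k\<in>{m..<n}. (a k)\<^sup>2) < \<epsilon>\<^sup>2"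
      using a unfolding summable_Cauchy by blast
    have "norm (\<Sum>k\<in>{m..<n}. a k *\<^sub>R e k) < \<epsilon>" if "m \<ge> N" for m n
    proof -
      have "norm (\<Sum>k\<in>{m..<n}. (a k)\<^sup>2) < \<epsilon>\<^sup>2" using N that by blast
      then have "(norm (\<Sum>k\<in>{m..<n}. a k *\<^sub>R e k))\<^sup>2 < \<epsilon>\<^sup>2" unfolding n real_norm_def by linarith
      then show ?thesis using \<epsilon> by (rule power2_less_imp_less[OF _ less_imp_le])
    qed
    moreover have "dist (\<Sum>k<m. a k *\<^sub>R e k) (\<Sum>k<n. a k *\<^sub>R e k) = norm (\<Sum>k\<in>{m..<n}. a k *\<^sub>R e k)"
      if "m \<le> n" for m n
      using sum_diff_nat_ivl[of 0 m n "\<lambda>k. a k *\<^sub>R e k"] that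
      by (simp add: dist_norm norm_minus_commute[of "sum _ {..<m}"] atLeast0LessThan)
    ultimately have lt: "dist (\<Sum>k<m. a k *\<^sub>R e k) (\<Sum>k<n. a k *\<^sub>R e k) < \<epsilon>"
      if "m \<le> n" "m \<ge> N" for m n
      using that by simp
    have "dist (\<Sum>k<m. a k *\<^sub>R e k) (\<Sum>k<n. a k *\<^sub>R e k) < \<epsilon>" if "m \<ge> N" "n \<ge> N" for m n
    proof (cases "m \<le> n")
      case True
      then show ?thesis using lt that by blast
    next
      case False
      then show ?thesis using lt[of n m] that by (simp add: dist_commute)
    qed
    then show "\<exists>N. \<forall>m\<ge>N. \<forall>n\<ge>N. dist (\<Sum>k<m. a k *\<^sub>R e k) (\<Sum>k<n. a k *\<^sub>R e k) < \<epsilon>" by blast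
  qed
  then show ?thesis by (simp add: summable_iff_convergent Cauchy_convergent_iff)
qed

lemma inner_Apow:
  fixes e :: "nat \<Rightarrow> 'a::{real_inner,complete_space}"
  assumes e: "hilbert_basis e" and s: "summable (\<lambda>k. (lampow (lam k) (2 * \<alpha>) * inner u (e k))\<^sup>2)"
  shows "inner (Apow e lam \<alpha> u) (e j) = lampow (lam j) (2 * \<alpha>) * inner u (e j)"
proof -
  have on: "inner (e j) (e k) = (if j = k then 1 else 0)" for j k using e by (simp add: hilbert_basis_def)
  have "inner (Apow e lam \<alpha> u) (e j) =
      (\<Sum>k. inner ((lampow (lam k) (2 * \<alpha>) * inner u (e k)) *\<^sub>R e k) (e j))"
    unfolding Apow_def
    by (rule bounded_linear.suminf[OF bounded_linear_inner_left hilbert_basis_summable[OF e s]])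
  also have "\<dots> = (\<Sum>k\<in>{j}. inner ((lampow (lam k) (2 * \<alpha>) * inner u (e k)) *\<^sub>R e k) (e j))"
    by (rule suminf_finite) (auto simp: on)
  finally show ?thesis by (simp add: on)
qed

lemma in_G_imp_summable:
  assumes "in_G e lam \<phi> r \<alpha> u" "0 \<le> r" "\<forall>k. 0 \<le> lam k" "\<forall>\<sigma>\<ge>0. \<phi> \<sigma> > 0"
  shows "summable (\<lambda>k. lampow (lam k) (4 * \<alpha>) * (inner u (e k))\<^sup>2)"
proof (rule summable_comparison_test'[where g = "\<lambda>k. lampow (lam k) (4 * \<alpha>) * (inner u (e k))\<^sup>2 * exp (r * \<phi> (lam k))"])
  fix k
  have l: "0 \<le> lampow (lam k) (4 * \<alpha>) * (inner u (e k))\<^sup>2" by (simp add: lampow_def)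
  have "0 < \<phi> (lam k)" using assms by blast
  then have "1 \<le> exp (r * \<phi> (lam k))" using assms(2) by simp
  from mult_left_mono[OF this l] l
  show "norm (lampow (lam k) (4 * \<alpha>) * (inner u (e k))\<^sup>2) \<le>
      lampow (lam k) (4 * \<alpha>) * (inner u (e k))\<^sup>2 * exp (r * \<phi> (lam k))"
    by simp
qed (use assms(1) in \<open>simp add: in_G_def\<close>)

lemma Apow_half:
  fixes e :: "nat \<Rightarrow> 'a::{real_inner,complete_space}"
  assumes e: "hilbert_basis e" and lam: "\<forall>k. 0 \<le> lam k"
    and s: "summable (\<lambda>k. lampow (lam k) (4 * (1/2)) * (inner u (e k))\<^sup>2)"
  shows "(\<lambda>k. (lam k)\<^sup>2 * (inner u (e k))\<^sup>2) sums (norm (Apow e lam (1/2) u))\<^sup>2"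
proof -
  have "summable (\<lambda>k. (lampow (lam k) (2 * (1/2)) * inner u (e k))\<^sup>2)"
    using s lam by (simp add: lampow_simps power_mult_distrib)
  from inner_Apow[OF e this] have "inner (Apow e lam (1/2) u) (e k) = lam k * inner u (e k)" for k
    using lam by (simp add: lampow_simps)
  then show ?thesis using hilbert_basis_norm_sums[OF e, of "Apow e lam (1/2) u"]
    by (simp add: power_mult_distrib)
qed

lemma Apow_one:
  fixes e :: "nat \<Rightarrow> 'a::{real_inner,complete_space}"
  assumes e: "hilbert_basis e" and lam: "\<forall>k. 0 \<le> lam k"
    and s: "summable (\<lambda>k. lampow (lam k) (4 * 1) * (inner u (e k))\<^sup>2)"
  shows "inner (Apow e lam 1 u) (e k) = (lam k)\<^sup>2 * inner u (e k)"
    "(\<lambda>k. lam k ^ 4 * (inner u (e k))\<^sup>2) sums (norm (Apow e lam 1 u))\<^sup>2"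
    "(\<lambda>k. (lam k)\<^sup>2 * (inner u (e k) * inner w (e k))) sums inner (Apow e lam 1 u) w"
proof -
  have "summable (\<lambda>k. (lampow (lam k) (2 * 1) * inner u (e k))\<^sup>2)"
    using s lam by (simp add: lampow_simps power_mult_distrib flip: power_mult)
  from inner_Apow[OF e this] show 1: "inner (Apow e lam 1 u) (e k) = (lam k)\<^sup>2 * inner u (e k)" for k
    using lam by (simp add: lampow_simps)
  show "(\<lambda>k. lam k ^ 4 * (inner u (e k))\<^sup>2) sums (norm (Apow e lam 1 u))\<^sup>2"
    using hilbert_basis_norm_sums[OF e, of "Apow e lam 1 u"]
    by (simp add: 1 power_mult_distrib flip: power_mult)
  show "(\<lambda>k. (lam k)\<^sup>2 * (inner u (e k) * inner w (e k))) sums inner (Apow e lam 1 u) w"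
    using hilbert_basis_inner_sums[OF e, of "Apow e lam 1 u" w] by (simp add: 1 mult.assoc)
qed

section \<open>Domains of powers and derivatives of coordinates\<close>

definition in_DA :: "(nat \<Rightarrow> 'a::real_inner) \<Rightarrow> (nat \<Rightarrow> real) \<Rightarrow> real \<Rightarrow> 'a \<Rightarrow> bool"
  where "in_DA e lam \<alpha> u \<longleftrightarrow> summable (\<lambda>k. lampow (lam k) (4 * \<alpha>) * (inner u (e k))\<^sup>2)"

lemma in_DA_diff:
  assumes "in_DA e lam \<alpha> u" "in_DA e lam \<alpha> w"
  shows "in_DA e lam \<alpha> (u - w)"
  unfolding in_DA_def
proof (rule summable_comparison_test')
  let ?l = "\<lambda>k. lampow (lam k) (4 * \<alpha>)"
  show "summable (\<lambda>k. 2 * (?l k * (inner u (e k))\<^sup>2) + 2 * (?l k * (inner w (e k))\<^sup>2))"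
    by (intro summable_add summable_mult assms[unfolded in_DA_def])
  fix k
  have l: "0 \<le> ?l k" by (simp add: lampow_def)
  have "(inner u (e k) - inner w (e k))\<^sup>2 \<le> 2 * (inner u (e k))\<^sup>2 + 2 * (inner w (e k))\<^sup>2"
    using zero_le_power2[of "inner u (e k) + inner w (e k)"] by (simp add: power2_eq_square algebra_simps)
  from mult_left_mono[OF this l] l
  show "norm (?l k * (inner (u - w) (e k))\<^sup>2) \<le> 2 * (?l k * (inner u (e k))\<^sup>2) + 2 * (?l k * (inner w (e k))\<^sup>2)"
    by (simp add: inner_diff_left abs_mult distrib_left mult.left_commute)
qed

lemma in_DA_scaleR:
  assumes "in_DA e lam \<alpha> u"
  shows "in_DA e lam \<alpha> (c *\<^sub>R u)"
  using summable_mult[OF assms[unfolded in_DA_def], of "c\<^sup>2"]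
  by (simp add: in_DA_def power_mult_distrib mult.left_commute)

text \<open>Summability matters here: otherwise the series is a junk value, possibly negative.\<close>

lemma DA_seminorm_nonneg:
  assumes "in_DA e lam \<alpha> u"
  shows "0 \<le> DA_seminorm e lam \<alpha> u"
  unfolding DA_seminorm_def
  by (intro real_sqrt_ge_zero suminf_nonneg assms[unfolded in_DA_def]) (simp add: lampow_def)

text \<open>The graph norm dominates the norm of \<open>H\<close> because the domain hypotheses make
  the seminorm part nonnegative; pairing with \<open>e k\<close> then gives the scalar
  derivative.\<close>

lemma deriv_DA_coordinate:
  assumes e: "hilbert_basis e" and d: "deriv_DA e lam \<alpha> T v w" and t: "t \<in> {0..T}"
    and dom: "\<And>s. s \<in> {0..T} \<Longrightarrow> in_DA e lam \<alpha> (v s)" "in_DA e lam \<alpha> (w t)"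
  shows "((\<lambda>s. inner (v s) (e k)) has_real_derivative inner (w t) (e k)) (at t within {0..T})"
proof -
  let ?q = "\<lambda>s. (1 / (s - t)) *\<^sub>R (v s - v t) - w t"
  have "((\<lambda>s. DA_norm e lam \<alpha> (?q s)) \<longlongrightarrow> 0) (at t within {0..T})"
    using d t by (simp add: deriv_DA_def)
  then have "((\<lambda>s. norm (?q s)) \<longlongrightarrow> 0) (at t within {0..T})"
  proof (rule Lim_null_comparison[rotated])
    have "eventually (\<lambda>s. s \<in> {0..T}) (at t within {0..T})" by (simp add: eventually_at_filter)
    then show "eventually (\<lambda>s. norm (norm (?q s)) \<le> DA_norm e lam \<alpha> (?q s)) (at t within {0..T})"
    proof (rule eventually_mono)
      fix s assume "s \<in> {0..T}"
      then have "0 \<le> DA_seminorm e lam \<alpha> (?q s)"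
        by (intro DA_seminorm_nonneg in_DA_diff in_DA_scaleR dom t)
      then show "norm (norm (?q s)) \<le> DA_norm e lam \<alpha> (?q s)" by (simp add: DA_norm_def)
    qed
  qed
  then have "(?q \<longlongrightarrow> 0) (at t within {0..T})" by (rule tendsto_norm_zero_cancel)
  then have "((\<lambda>s. inner (?q s) (e k)) \<longlongrightarrow> inner 0 (e k)) (at t within {0..T})"
    by (intro tendsto_intros)
  then have "((\<lambda>s. (inner (v s) (e k) - inner (v t) (e k)) / (s - t) - inner (w t) (e k)) \<longlongrightarrow> 0)
      (at t within {0..T})"
    by (simp add: inner_diff_left)
  then show ?thesis unfolding has_field_derivative_iff by (rule LIM_zero_cancel)
qed

section \<open>From solutions in the Hilbert space to systems of modes\<close>

lemma hyperbolicity_cases: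
  assumes "\<forall>\<sigma>\<ge>0. m \<sigma> \<ge> (0::real)"
    and "(\<exists>\<nu>>0. (\<forall>\<sigma>\<ge>0. m \<sigma> \<ge> \<nu>) \<and> (\<exists>\<Lambda>. \<forall>\<sigma>>0. \<sigma> * \<omega> (1 / \<sigma>) \<le> \<Lambda> * \<phi> \<sigma>))
              \<or> (\<exists>\<Lambda>. \<forall>\<sigma>>0. \<sigma> \<le> \<Lambda> * \<phi> (\<sigma> / sqrt (\<omega> (1 / \<sigma>))))"
  obtains \<nu> where "hyperbolicity \<omega> \<phi> \<nu>" "\<forall>\<sigma>\<ge>0. \<nu> \<le> m \<sigma>"
  using assms(2)
proof
  assume "\<exists>\<nu>>0. (\<forall>\<sigma>\<ge>0. m \<sigma> \<ge> \<nu>) \<and> (\<exists>\<Lambda>. \<forall>\<sigma>>0. \<sigma> * \<omega> (1 / \<sigma>) \<le> \<Lambda> * \<phi> \<sigma>)"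
  then show ?thesis using that by (auto simp: hyperbolicity_def)
next
  assume "\<exists>\<Lambda>. \<forall>\<sigma>>0. \<sigma> \<le> \<Lambda> * \<phi> (\<sigma> / sqrt (\<omega> (1 / \<sigma>)))"
  then show ?thesis using that[of 0] assms(1) by (simp add: hyperbolicity_def)
qed

text \<open>All but the Lipschitz clause is read off the coordinates. That clause needs
  \<open>v\<close> bounded in \<open>H\<close> and \<open>v'\<close> bounded in \<open>D(A)\<close>;
  continuity of both at \<open>t0\<close> provides this nearby, hence the possibly shorter
  interval.\<close>

lemma solution_modes_near:
  fixes e :: "nat \<Rightarrow> 'a::{real_inner,complete_space}"
  assumes e: "hilbert_basis e" and lam: "\<forall>k. 0 \<le> lam k" and \<phi>: "\<forall>\<sigma>\<ge>0. \<phi> \<sigma> > 0"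
    and r: "\<forall>t\<in>{0..T}. 0 < r t"
    and sc: "sol_class e lam \<phi> r T v v' v''" and ks: "kirchhoff_sol e lam m T u0 u1 v v' v''"
    and t0: "0 \<le> t0" "t0 < T"
  obtains \<tau> where "0 < \<tau>" "\<tau> \<le> T - t0"
    "kirchhoff_modes lam m \<tau> (\<lambda>k s. inner (v (t0 + s)) (e k)) (\<lambda>k s. inner (v' (t0 + s)) (e k))"
proof -
  have sG: "summable (\<lambda>k. (lam k)\<^sup>2 * (inner (v t) (e k))\<^sup>2)"
    "summable (\<lambda>k. lam k ^ 4 * (inner (v t) (e k))\<^sup>2)"
    "summable (\<lambda>k. lam k ^ 4 * (inner (v' t) (e k))\<^sup>2)" if t: "t \<in> {0..T}" for t
  proof -
    have rt: "0 \<le> r t" using r t by (simp add: less_imp_le)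
    have i: "in_G e lam \<phi> (r t) (1/2) (v t)" "in_G e lam \<phi> (r t) 1 (v t)" "in_G e lam \<phi> (r t) 1 (v' t)"
      using sc t unfolding sol_class_def by auto
    show "summable (\<lambda>k. (lam k)\<^sup>2 * (inner (v t) (e k))\<^sup>2)"
      "summable (\<lambda>k. lam k ^ 4 * (inner (v t) (e k))\<^sup>2)"
      "summable (\<lambda>k. lam k ^ 4 * (inner (v' t) (e k))\<^sup>2)"
      using i[THEN in_G_imp_summable[OF _ rt lam \<phi>]] lam by (simp_all add: lampow_simps)
  qed
  have dom1: "in_DA e lam (1/2) (v t)" "in_DA e lam (1/2) (v' t)" "in_DA e lam (1/2) (v'' t)"
    "in_DA e lam (3/2) (v t)" if t: "t \<in> {0..T}" for t
  proof -
    have rt: "0 \<le> r t" using r t by (simp add: less_imp_le)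
    have i: "in_G e lam \<phi> (r t) (1/2) (v t)" "in_G e lam \<phi> (r t) (1/2) (v' t)"
      "in_G e lam \<phi> (r t) (1/2) (v'' t)" "in_G e lam \<phi> (r t) (3/2) (v t)"
      using sc t unfolding sol_class_def by auto
    show "in_DA e lam (1/2) (v t)" "in_DA e lam (1/2) (v' t)" "in_DA e lam (1/2) (v'' t)"
      "in_DA e lam (3/2) (v t)"
      unfolding in_DA_def using i[THEN in_G_imp_summable[OF _ rt lam \<phi>]] by auto
  qed
  have st: "(\<Sum>k. (lam k)\<^sup>2 * (inner (v t) (e k))\<^sup>2) = (norm (Apow e lam (1/2) (v t)))\<^sup>2"
    if t: "t \<in> {0..T}" for t
    using Apow_half[OF e lam, of "v t"] sG(1)[OF t] lam by (simp add: lampow_simps sums_iff)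
  have dx: "((\<lambda>s. inner (v s) (e k)) has_real_derivative inner (v' t) (e k)) (at t within {0..T})"
    if t: "t \<in> {0..T}" for t k
    by (rule deriv_DA_coordinate[OF e _ t, of lam "1/2"])
      (use sc dom1 t in \<open>auto simp: sol_class_def\<close>)
  have dy: "((\<lambda>s. inner (v' s) (e k)) has_real_derivative
      - (m (\<Sum>k. (lam k)\<^sup>2 * (inner (v t) (e k))\<^sup>2) * (lam k)\<^sup>2 * inner (v t) (e k))) (at t within {0..T})"
    if t: "t \<in> {0..T}" for t k
  proof -
    have "v'' t = - (m ((norm (Apow e lam (1/2) (v t)))\<^sup>2) *\<^sub>R Apow e lam 1 (v t))"
      using ks t unfolding kirchhoff_sol_def by (simp add: eq_neg_iff_add_eq_0)
    moreover have "inner (Apow e lam 1 (v t)) (e k) = (lam k)\<^sup>2 * inner (v t) (e k)"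
      using Apow_one(1)[OF e lam, of "v t" k] sG(2)[OF t] lam by (simp add: lampow_simps)
    ultimately have "inner (v'' t) (e k) =
        - (m (\<Sum>k. (lam k)\<^sup>2 * (inner (v t) (e k))\<^sup>2) * (lam k)\<^sup>2 * inner (v t) (e k))"
      by (simp add: st[OF t] mult.assoc)
    moreover have "((\<lambda>s. inner (v' s) (e k)) has_real_derivative inner (v'' t) (e k)) (at t within {0..T})"
      by (rule deriv_DA_coordinate[OF e _ t, of lam "1/2"])
        (use sc dom1 t in \<open>auto simp: sol_class_def\<close>)
    ultimately show ?thesis by simp
  qed
  have t0T: "t0 \<in> {0..T}" using t0 by simp
  have "((\<lambda>s. DA_norm e lam (3/2) (v s - v t0)) \<longlongrightarrow> 0) (at t0 within {0..T})"
    using sc t0T unfolding sol_class_def cont_DA_def by blast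
  then have ev1: "eventually (\<lambda>s. DA_norm e lam (3/2) (v s - v t0) < 1) (at t0 within {0..T})"
    by (rule order_tendstoD) simp
  have "((\<lambda>s. DA_norm e lam 1 (v' s - v' t0)) \<longlongrightarrow> 0) (at t0 within {0..T})"
    using sc t0T unfolding sol_class_def cont_DA_def by blast
  then have ev2: "eventually (\<lambda>s. DA_norm e lam 1 (v' s - v' t0) < 1) (at t0 within {0..T})"
    by (rule order_tendstoD) simp
  obtain d where d: "0 < d" "\<And>s. s \<in> {0..T} \<Longrightarrow> s \<noteq> t0 \<Longrightarrow> dist s t0 < d \<Longrightarrow>
      DA_norm e lam (3/2) (v s - v t0) < 1 \<and> DA_norm e lam 1 (v' s - v' t0) < 1"
    using eventually_conj[OF ev1 ev2] unfolding eventually_at by auto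
  \<comment> \<open>The distances to the values at \<open>t0\<close> are below 1. The second summand
    comes from \<open>a\<^sup>2 \<le> 2 (a - b)\<^sup>2 + 2 b\<^sup>2\<close>, summed with weight
    \<open>lam k ^ 4\<close>.\<close>
  define K where "K = (norm (v t0) + 1)\<^sup>2 + (2 + 2 * (\<Sum>k. lam k ^ 4 * (inner (v' t0) (e k))\<^sup>2))"
  have bound: "(\<Sum>k<n. (inner (v s) (e k))\<^sup>2 + lam k ^ 4 * (inner (v' s) (e k))\<^sup>2) \<le> K"
    if s: "s \<in> {t0..min T (t0 + d / 2)}" for s n
  proof (cases "s = t0")
    case True
    have "(\<Sum>k<n. (inner (v t0) (e k))\<^sup>2) \<le> (norm (v t0))\<^sup>2"
      by (rule hilbert_basis_bessel[OF e])
    also have "\<dots> \<le> (norm (v t0) + 1)\<^sup>2" by (intro power_mono) auto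
    finally have 1: "(\<Sum>k<n. (inner (v t0) (e k))\<^sup>2) \<le> (norm (v t0) + 1)\<^sup>2" .
    have 2: "(\<Sum>k<n. lam k ^ 4 * (inner (v' t0) (e k))\<^sup>2) \<le> (\<Sum>k. lam k ^ 4 * (inner (v' t0) (e k))\<^sup>2)"
      using sG(3)[OF t0T] lam by (intro sum_le_suminf) auto
    have 3: "0 \<le> (\<Sum>k. lam k ^ 4 * (inner (v' t0) (e k))\<^sup>2)"
      using sG(3)[OF t0T] lam by (intro suminf_nonneg) auto
    show ?thesis unfolding True sum.distrib K_def using 1 2 3 by simp
  next
    case False
    have sT: "s \<in> {0..T}" using s t0 by auto
    have "dist s t0 < d" using s d(1) by (auto simp: dist_real_def)
    then have n1: "DA_norm e lam (3/2) (v s - v t0) < 1" "DA_norm e lam 1 (v' s - v' t0) < 1"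
      using d(2)[OF sT False] by auto
    have "norm (v s - v t0) < 1"
      using n1(1) DA_seminorm_nonneg[OF in_DA_diff[OF dom1(4)[OF sT] dom1(4)[OF t0T]]]
      by (simp add: DA_norm_def)
    then have "norm (v s) \<le> norm (v t0) + 1"
      using norm_triangle_ineq2[of "v s" "v t0"] by linarith
    then have "(norm (v s))\<^sup>2 \<le> (norm (v t0) + 1)\<^sup>2" by (intro power_mono) auto
    with hilbert_basis_bessel[OF e] have 1: "(\<Sum>k<n. (inner (v s) (e k))\<^sup>2) \<le> (norm (v t0) + 1)\<^sup>2"
      by (rule order_trans)
    let ?a = "\<lambda>k. inner (v' s) (e k)" and ?b = "\<lambda>k. inner (v' t0) (e k)"
    have sq: "(?a k - ?b k)\<^sup>2 \<le> 2 * (?a k)\<^sup>2 + 2 * (?b k)\<^sup>2" "(?a k)\<^sup>2 \<le> 2 * (?a k - ?b k)\<^sup>2 + 2 * (?b k)\<^sup>2" for k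
      using zero_le_power2[of "?a k + ?b k"] zero_le_power2[of "?a k - 2 * ?b k"]
      by (simp_all add: power2_eq_square algebra_simps)
    have sd: "summable (\<lambda>k. lam k ^ 4 * (?a k - ?b k)\<^sup>2)"
    proof (rule summable_comparison_test')
      show "summable (\<lambda>k. 2 * (lam k ^ 4 * (?a k)\<^sup>2) + 2 * (lam k ^ 4 * (?b k)\<^sup>2))"
        by (intro summable_add summable_mult sG(3) sT t0T)
      show "norm (lam k ^ 4 * (?a k - ?b k)\<^sup>2) \<le> 2 * (lam k ^ 4 * (?a k)\<^sup>2) + 2 * (lam k ^ 4 * (?b k)\<^sup>2)" for k
        using mult_left_mono[OF sq(1)[of k], of "lam k ^ 4"] lam
        by (simp add: abs_mult algebra_simps)
    qed
    have "DA_seminorm e lam 1 (v' s - v' t0) < 1" using n1(2) norm_ge_zero[of "v' s - v' t0"]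
      unfolding DA_norm_def by linarith
    then have "(\<Sum>k. lam k ^ 4 * (?a k - ?b k)\<^sup>2) < 1"
      using lam by (simp add: DA_seminorm_def lampow_simps inner_diff_left)
    moreover have "(\<Sum>k<n. lam k ^ 4 * (?a k - ?b k)\<^sup>2) \<le> (\<Sum>k. lam k ^ 4 * (?a k - ?b k)\<^sup>2)"
      using sd lam by (intro sum_le_suminf) auto
    moreover have "(\<Sum>k<n. lam k ^ 4 * (?b k)\<^sup>2) \<le> (\<Sum>k. lam k ^ 4 * (?b k)\<^sup>2)"
      using sG(3)[OF t0T] lam by (intro sum_le_suminf) auto
    moreover have "(\<Sum>k<n. lam k ^ 4 * (?a k)\<^sup>2) \<le>
        2 * (\<Sum>k<n. lam k ^ 4 * (?a k - ?b k)\<^sup>2) + 2 * (\<Sum>k<n. lam k ^ 4 * (?b k)\<^sup>2)"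
      unfolding sum_distrib_left sum.distrib[symmetric]
    proof (rule sum_mono)
      fix k
      show "lam k ^ 4 * (?a k)\<^sup>2 \<le> 2 * (lam k ^ 4 * (?a k - ?b k)\<^sup>2) + 2 * (lam k ^ 4 * (?b k)\<^sup>2)"
        using mult_left_mono[OF sq(2)[of k], of "lam k ^ 4"] lam by (simp add: distrib_left mult.left_commute)
    qed
    ultimately have 2: "(\<Sum>k<n. lam k ^ 4 * (?a k)\<^sup>2) \<le> 2 + 2 * (\<Sum>k. lam k ^ 4 * (?b k)\<^sup>2)"
      by argo
    show ?thesis unfolding sum.distrib K_def using 1 2 by (rule add_mono)
  qed
  define \<tau> where "\<tau> = min (T - t0) (d / 2)"
  have \<tau>: "0 < \<tau>" "\<tau> \<le> T - t0" "\<tau> \<le> d / 2"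
    using d(1) t0 min.cobounded1[of "T - t0" "d / 2"] min.cobounded2[of "T - t0" "d / 2"]
    unfolding \<tau>_def by (simp_all del: min.cobounded1 min.cobounded2)
  let ?x = "\<lambda>k s. inner (v (t0 + s)) (e k)" and ?y = "\<lambda>k s. inner (v' (t0 + s)) (e k)"
  have shift: "((\<lambda>s. g (t0 + s)) has_real_derivative D) (at s within {0..\<tau>})"
    if "(g has_real_derivative D) (at (t0 + s) within {0..T})" for g D s
  proof -
    have "(+) t0 ` {0..\<tau>} \<subseteq> {0..T}" using t0 \<tau> by auto
    then have "(g has_real_derivative D) (at (t0 + s) within (+) t0 ` {0..\<tau>})"
      by (rule DERIV_subset[OF that])
    moreover have "((+) t0 has_real_derivative 1) (at s within {0..\<tau>})"
      by (auto intro!: derivative_eq_intros)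
    ultimately show ?thesis using DERIV_image_chain[of g D "(+) t0" s "{0..\<tau>}" 1] by (simp add: o_def)
  qed
  have dom: "t0 + s \<in> {0..T}" "t0 + s \<in> {t0..min T (t0 + d / 2)}" if "s \<in> {0..\<tau>}" for s
    using that t0 \<tau> by auto
  have lip: "\<bar>stiffness lam ?x s - stiffness lam ?x t\<bar> \<le> K * \<bar>s - t\<bar>"
    if s: "s \<in> {0..\<tau>}" and t: "t \<in> {0..\<tau>}" for s t
  proof -
    let ?P = "\<lambda>n s. \<Sum>k<n. (lam k)\<^sup>2 * (?x k s)\<^sup>2"
    have lim: "(\<lambda>n. ?P n s) \<longlonglongrightarrow> stiffness lam ?x s" if "s \<in> {0..\<tau>}" for s
      unfolding stiffness_def by (rule summable_LIMSEQ[OF sG(1)[OF dom(1)[OF that]]])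
    \<comment> \<open>The mean value inequality is applied to partial sums with a constant
      independent of \<open>n\<close>, so the limit needs no termwise differentiation. Both factors
      \<open>lam k\<close> go to the velocity, which lies in \<open>D(A)\<close>.\<close>
    have "norm (?P n s - ?P n t) \<le> K * norm (s - t)" for n
    proof (rule field_differentiable_bound[OF convex_real_interval(5) _ _ s t])
      fix z assume z: "z \<in> {0..\<tau>}"
      have "((\<lambda>s. (?x k s)\<^sup>2) has_real_derivative 2 * (?x k z * ?y k z)) (at z within {0..\<tau>})" for k
        using DERIV_power[OF shift[OF dx[OF dom(1)[OF z], of k]], of 2] by (simp add: mult_ac)
      then show "(?P n has_real_derivative (\<Sum>k<n. (lam k)\<^sup>2 * (2 * (?x k z * ?y k z)))) (at z within {0..\<tau>})"
        by (intro DERIV_sum DERIV_cmult)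
      have "norm (\<Sum>k<n. (lam k)\<^sup>2 * (2 * (?x k z * ?y k z))) \<le>
          (\<Sum>k<n. (?x k z)\<^sup>2 + lam k ^ 4 * (?y k z)\<^sup>2)"
      proof (rule sum_norm_le)
        fix k
        have "norm ((lam k)\<^sup>2 * (2 * (?x k z * ?y k z))) = 2 * \<bar>?x k z\<bar> * \<bar>(lam k)\<^sup>2 * ?y k z\<bar>"
          by (simp add: abs_mult)
        also have "\<dots> \<le> \<bar>?x k z\<bar>\<^sup>2 + \<bar>(lam k)\<^sup>2 * ?y k z\<bar>\<^sup>2" by (rule sum_squares_bound)
        also have "\<dots> = (?x k z)\<^sup>2 + lam k ^ 4 * (?y k z)\<^sup>2"
          by (simp add: power_mult_distrib flip: power_mult)
        finally show "norm ((lam k)\<^sup>2 * (2 * (?x k z * ?y k z))) \<le> (?x k z)\<^sup>2 + lam k ^ 4 * (?y k z)\<^sup>2" .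
      qed
      also have "\<dots> \<le> K" by (rule bound[OF dom(2)[OF z]])
      finally show "norm (\<Sum>k<n. (lam k)\<^sup>2 * (2 * (?x k z * ?y k z))) \<le> K" .
    qed
    moreover have "(\<lambda>n. norm (?P n s - ?P n t)) \<longlonglongrightarrow> norm (stiffness lam ?x s - stiffness lam ?x t)"
      by (intro tendsto_intros lim s t)
    ultimately have "norm (stiffness lam ?x s - stiffness lam ?x t) \<le> K * norm (s - t)"
      by (intro LIMSEQ_le_const2) auto
    then show ?thesis by simp
  qed
  have "kirchhoff_modes lam m \<tau> ?x ?y"
    unfolding kirchhoff_modes_def
  proof (intro conjI ballI allI exI[of _ K])
    fix s assume s: "s \<in> {0..\<tau>}"
    show "summable (\<lambda>k. (lam k)\<^sup>2 * (?x k s)\<^sup>2)" by (rule sG(1)[OF dom(1)[OF s]])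
    show "(?x k has_real_derivative ?y k s) (at s within {0..\<tau>})" for k
      by (rule shift[OF dx[OF dom(1)[OF s]]])
    show "(?y k has_real_derivative - (m (stiffness lam ?x s) * (lam k)\<^sup>2 * ?x k s)) (at s within {0..\<tau>})" for k
      unfolding stiffness_def by (rule shift[OF dy[OF dom(1)[OF s]]])
  qed (rule lip)
  with \<tau> that show ?thesis by blast
qed

text \<open>By Parseval the two brackets of the nondegeneracy quantity are half the first and half
  the second derivative of the stiffness.\<close>

lemma degen_quantity_stiffness:
  fixes e :: "nat \<Rightarrow> 'a::{real_inner,complete_space}"
  assumes e: "hilbert_basis e" and lam: "\<forall>k. 0 \<le> lam k"
    and u: "in_DA e lam (1/2) u" "in_DA e lam 1 u" and w: "in_DA e lam (1/2) w"
    and deg: "degen_quantity e lam m u w \<noteq> 0"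
    and x: "\<And>k. x k t = inner u (e k)" and y: "\<And>k. y k t = inner w (e k)"
  shows "stiffness' lam x y t \<noteq> 0 \<or> stiffness'' lam m x y t \<noteq> 0"
proof -
  note hu = Apow_half[OF e lam u(1)[unfolded in_DA_def]] and hw = Apow_half[OF e lam w[unfolded in_DA_def]]
    and ou = Apow_one(2,3)[OF e lam u(2)[unfolded in_DA_def]]
  have s0: "stiffness lam x t = (norm (Apow e lam (1/2) u))\<^sup>2"
    unfolding stiffness_def x using hu by (simp add: sums_iff)
  have s1: "stiffness' lam x y t = 2 * inner (Apow e lam 1 u) w"
    unfolding stiffness'_def x y using sums_mult[OF ou(2)[of w], of 2] by (simp add: sums_iff)
  let ?c = "m ((norm (Apow e lam (1/2) u))\<^sup>2)"
  have "(\<lambda>k. 2 * ((lam k)\<^sup>2 * (inner w (e k))\<^sup>2 - ?c * (lam k ^ 4 * (inner u (e k))\<^sup>2))) sums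
      (2 * ((norm (Apow e lam (1/2) w))\<^sup>2 - ?c * (norm (Apow e lam 1 u))\<^sup>2))"
    by (intro sums_mult sums_diff hw ou(1))
  moreover have "2 * ((lam k)\<^sup>2 * (inner w (e k))\<^sup>2 - ?c * (lam k ^ 4 * (inner u (e k))\<^sup>2)) =
      2 * ((lam k)\<^sup>2 * ((inner w (e k))\<^sup>2 - ?c * ((lam k)\<^sup>2 * (inner u (e k))\<^sup>2)))" for k
    by (simp add: power2_eq_square power4_eq_xxxx algebra_simps)
  ultimately have s2: "stiffness'' lam m x y t =
      2 * ((norm (Apow e lam (1/2) w))\<^sup>2 - ?c * (norm (Apow e lam 1 u))\<^sup>2)"
    unfolding stiffness''_def s0 x y by (simp add: sums_iff)
  show ?thesis using deg unfolding s1 s2 degen_quantity_def by auto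
qed

text \<open>The equation is autonomous and the solution class puts the state at \<open>t0\<close> in
  the spaces with parameter \<open>r t0 > 0\<close>, so the local argument can restart there. The
  same step serves at time 0 and at the end of the common interval.\<close>

lemma uniqueness_step:
  fixes e :: "nat \<Rightarrow> 'a::{real_inner,complete_space}"
  assumes e: "hilbert_basis e" and lam: "\<forall>k. 0 \<le> lam k"
    and \<omega>: "cont_modulus \<omega>" and m: "omega_continuous \<omega> m" and \<nu>: "\<forall>\<sigma>\<ge>0. \<nu> \<le> m \<sigma>"
    and \<phi>: "\<forall>\<sigma>\<ge>0. \<phi> \<sigma> > 0" and hyp: "hyperbolicity \<omega> \<phi> \<nu>"
    and r: "\<forall>t\<in>{0..T}. 0 < r t"
    and sol1: "sol_class e lam \<phi> r T v1 v1' v1''" "kirchhoff_sol e lam m T u0 u1 v1 v1' v1''"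
    and sol2: "sol_class e lam \<phi> r T v2 v2' v2''" "kirchhoff_sol e lam m T u0 u1 v2 v2' v2''"
    and t0: "0 \<le> t0" "t0 < T" and eq: "v1 t0 = v2 t0" "v1' t0 = v2' t0"
    and deg: "degen_quantity e lam m (v1 t0) (v1' t0) \<noteq> 0"
  obtains \<delta> where "0 < \<delta>" "t0 + \<delta> \<le> T" "\<And>t. t \<in> {t0..t0 + \<delta>} \<Longrightarrow> v1 t = v2 t"
proof -
  let ?x1 = "\<lambda>k s. inner (v1 (t0 + s)) (e k)" and ?y1 = "\<lambda>k s. inner (v1' (t0 + s)) (e k)"
  let ?x2 = "\<lambda>k s. inner (v2 (t0 + s)) (e k)" and ?y2 = "\<lambda>k s. inner (v2' (t0 + s)) (e k)"
  obtain \<tau>1 where \<tau>1: "0 < \<tau>1" "\<tau>1 \<le> T - t0" "kirchhoff_modes lam m \<tau>1 ?x1 ?y1"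
    by (rule solution_modes_near[OF e lam \<phi> r sol1 t0]) (rule that)
  obtain \<tau>2 where \<tau>2: "0 < \<tau>2" "\<tau>2 \<le> T - t0" "kirchhoff_modes lam m \<tau>2 ?x2 ?y2"
    by (rule solution_modes_near[OF e lam \<phi> r sol2 t0]) (rule that)
  define \<tau> where "\<tau> = min \<tau>1 \<tau>2"
  have \<tau>: "0 < \<tau>" "\<tau> \<le> \<tau>1" "\<tau> \<le> \<tau>2" using \<tau>1(1) \<tau>2(1) by (auto simp: \<tau>_def)
  have t0T: "t0 \<in> {0..T}" using t0 by simp
  have rt: "0 < r t0" "0 \<le> r t0" using r t0T by (auto simp: less_imp_le)
  have i: "in_G e lam \<phi> (r t0) (1/2) (v1 t0)" "in_G e lam \<phi> (r t0) (1/2) (v1' t0)"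
    "in_G e lam \<phi> (r t0) 1 (v1 t0)" "in_G e lam \<phi> (r t0) 1 (v1' t0)" "in_G e lam \<phi> (r t0) (3/2) (v1 t0)"
    using sol1(1) t0T unfolding sol_class_def by auto
  have dom: "in_DA e lam (1/2) (v1 t0)" "in_DA e lam 1 (v1 t0)" "in_DA e lam (1/2) (v1' t0)"
    unfolding in_DA_def using i[THEN in_G_imp_summable[OF _ rt(2) lam \<phi>]] by auto
  have s6: "summable (\<lambda>k. lam k ^ 6 * (inner (v1 t0) (e k))\<^sup>2 * exp (r t0 * \<phi> (lam k)))"
    using i(5) lam by (simp add: in_G_def lampow_simps)
  have s4: "summable (\<lambda>k. lam k ^ 4 * (inner (v1' t0) (e k))\<^sup>2 * exp (r t0 * \<phi> (lam k)))"
    using i(4) lam by (simp add: in_G_def lampow_simps)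
  have s0: "summable (\<lambda>k. (inner u (e k))\<^sup>2)" for u
    using hilbert_basis_norm_sums[OF e, of u] by (rule sums_summable)
  have nd: "stiffness' lam ?x1 ?y1 0 \<noteq> 0 \<or> stiffness'' lam m ?x1 ?y1 0 \<noteq> 0"
    by (rule degen_quantity_stiffness[OF e lam dom deg]) simp_all
  obtain \<delta> where \<delta>: "0 < \<delta>" "\<delta> \<le> \<tau>" "\<And>k t. t \<in> {0..\<delta>} \<Longrightarrow> ?x1 k t = ?x2 k t"
    by (rule local_uniqueness[OF \<omega> m \<nu> \<phi> hyp lam \<tau>(1) rt(1)
          kirchhoff_modes_subinterval[OF \<tau>1(3) \<tau>(2)] kirchhoff_modes_subinterval[OF \<tau>2(3) \<tau>(3)]
          _ _ _ _ s0 s0 s6 s4 nd]) (use eq that in auto)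
  show ?thesis
  proof (rule that[OF \<delta>(1)])
    show "t0 + \<delta> \<le> T" using \<delta> \<tau> \<tau>1 by simp
    fix t assume "t \<in> {t0..t0 + \<delta>}"
    then show "v1 t = v2 t" using \<delta>(3)[of "t - t0"] by (intro hilbert_basis_eqI[OF e]) auto
  qed
qed

text \<open>At the end of the common interval agreement is known only to the left; the left
  derivative already determines the value. This transfers equality of the solutions to their
  velocities.\<close>

lemma derivs_agree_at_right_end:
  fixes f g :: "real \<Rightarrow> real"
  assumes "(f has_real_derivative f') (at b within {a..c})" "(g has_real_derivative g') (at b within {a..c})"
    and "\<And>t. t \<in> {a..b} \<Longrightarrow> f t = g t" "a < b" "b \<le> c"
  shows "f' = g'"
proof -
  have sub: "{a..b} \<subseteq> {a..c}" using assms by auto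
  have "(f has_real_derivative f') (at b within {a..b})" by (rule DERIV_subset[OF assms(1) sub])
  moreover have "(f has_real_derivative g') (at b within {a..b})"
    by (rule has_field_derivative_transform_within[OF DERIV_subset[OF assms(2) sub], of 1]) (use assms in auto)
  ultimately show ?thesis
    using vector_derivative_unique_within_closed_interval[of a b b f f' g'] \<open>a < b\<close>
    by (simp add: has_real_derivative_iff_has_vector_derivative)
qed

theorem theorem2p1:
  fixes e :: "nat \<Rightarrow> 'a::{real_inner,complete_space}"
    and lam :: "nat \<Rightarrow> real"
    and \<omega> m \<phi> :: "real \<Rightarrow> real"
    and r0 T :: real and r :: "real \<Rightarrow> real"
    and u0 u1 :: 'a
    and v1 v1' v1'' v2 v2' v2'' :: "real \<Rightarrow> 'a"
  assumes basis: "hilbert_basis e"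
    and lam_nonneg: "\<forall>k. lam k \<ge> 0"
    and modulus: "cont_modulus \<omega>"
    and m_nonneg: "\<forall>\<sigma>\<ge>0. m \<sigma> \<ge> 0"
    and m_cont: "omega_continuous \<omega> m"
    and phi_pos: "\<forall>\<sigma>\<ge>0. \<phi> \<sigma> > 0"
    and cases: "(\<exists>\<nu>>0. (\<forall>\<sigma>\<ge>0. m \<sigma> \<ge> \<nu>) \<and> (\<exists>\<Lambda>. \<forall>\<sigma>>0. \<sigma> * \<omega> (1 / \<sigma>) \<le> \<Lambda> * \<phi> \<sigma>))
              \<or> (\<exists>\<Lambda>. \<forall>\<sigma>>0. \<sigma> \<le> \<Lambda> * \<phi> (\<sigma> / sqrt (\<omega> (1 / \<sigma>))))"
    and r0_pos: "r0 > 0"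
    and u0_in: "in_G e lam \<phi> r0 (3/2) u0"
    and u1_in: "in_G e lam \<phi> r0 1 u1"
    and nondeg: "degen_quantity e lam m u0 u1 \<noteq> 0"
    and T_pos: "T > 0"
    and r_range: "\<forall>t\<in>{0..T}. 0 < r t \<and> r t \<le> r0"
    and r_noninc: "antimono_on {0..T} r"
    and sol1: "sol_class e lam \<phi> r T v1 v1' v1'' \<and> kirchhoff_sol e lam m T u0 u1 v1 v1' v1''"
    and sol2: "sol_class e lam \<phi> r T v2 v2' v2'' \<and> kirchhoff_sol e lam m T u0 u1 v2 v2' v2''"
  shows "(\<exists>T1\<in>{0<..T}. \<forall>t\<in>{0..T1}. v1 t = v2 t) \<and>
         (let Ts = Sup {T1\<in>{0<..T}. \<forall>t\<in>{0..T1}. v1 t = v2 t}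
          in (\<forall>t\<in>{0..Ts}. v1 t = v2 t) \<and>
             (Ts = T \<or> degen_quantity e lam m (v1 Ts) (v1' Ts) = 0))"
proof -
  obtain \<nu> where hyp: "hyperbolicity \<omega> \<phi> \<nu>" and \<nu>: "\<forall>\<sigma>\<ge>0. \<nu> \<le> m \<sigma>"
    by (rule hyperbolicity_cases[OF m_nonneg cases])
  have r: "\<forall>t\<in>{0..T}. 0 < r t" using r_range by blast
  note step = uniqueness_step[OF basis lam_nonneg modulus m_cont \<nu> phi_pos hyp r
      sol1[THEN conjunct1] sol1[THEN conjunct2] sol2[THEN conjunct1] sol2[THEN conjunct2]]
  have init: "v1 0 = u0" "v1' 0 = u1" "v2 0 = u0" "v2' 0 = u1"
    using sol1 sol2 by (auto simp: kirchhoff_sol_def)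
  define S where "S = {T1\<in>{0<..T}. \<forall>t\<in>{0..T1}. v1 t = v2 t}"
  obtain \<delta>0 where \<delta>0: "0 < \<delta>0" "0 + \<delta>0 \<le> T" "\<And>t. t \<in> {0..0 + \<delta>0} \<Longrightarrow> v1 t = v2 t"
    using step[of 0] T_pos nondeg by (auto simp: init)
  then have \<delta>0S: "\<delta>0 \<in> S" by (auto simp: S_def)
  have bdd: "bdd_above S" by (rule bdd_aboveI[of _ T]) (simp add: S_def)
  define Ts where "Ts = Sup S"
  have Ts: "0 < Ts" "Ts \<le> T"
  proof -
    show "0 < Ts" using cSup_upper[OF \<delta>0S bdd] \<delta>0(1) unfolding Ts_def by linarith
    show "Ts \<le> T" unfolding Ts_def by (rule cSup_least) (use \<delta>0S in \<open>auto simp: S_def\<close>)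
  qed
  have dom: "in_DA e lam (1/2) (v1 t)" "in_DA e lam (1/2) (v1' t)"
    "in_DA e lam (1/2) (v2 t)" "in_DA e lam (1/2) (v2' t)" if t: "t \<in> {0..T}" for t
  proof -
    have rt: "0 \<le> r t" using r t by (simp add: less_imp_le)
    have i: "in_G e lam \<phi> (r t) (1/2) (v1 t)" "in_G e lam \<phi> (r t) (1/2) (v1' t)"
      "in_G e lam \<phi> (r t) (1/2) (v2 t)" "in_G e lam \<phi> (r t) (1/2) (v2' t)"
      using sol1 sol2 t unfolding sol_class_def by auto
    show "in_DA e lam (1/2) (v1 t)" "in_DA e lam (1/2) (v1' t)"
      "in_DA e lam (1/2) (v2 t)" "in_DA e lam (1/2) (v2' t)"
      unfolding in_DA_def using i[THEN in_G_imp_summable[OF _ rt lam_nonneg phi_pos]] by auto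
  qed
  have d1: "((\<lambda>s. inner (v1 s) (e k)) has_real_derivative inner (v1' t) (e k)) (at t within {0..T})"
    if t: "t \<in> {0..T}" for t k
    by (rule deriv_DA_coordinate[OF basis _ t, of lam "1/2"])
      (use sol1 dom t in \<open>auto simp: sol_class_def\<close>)
  have d2: "((\<lambda>s. inner (v2 s) (e k)) has_real_derivative inner (v2' t) (e k)) (at t within {0..T})"
    if t: "t \<in> {0..T}" for t k
    by (rule deriv_DA_coordinate[OF basis _ t, of lam "1/2"])
      (use sol2 dom t in \<open>auto simp: sol_class_def\<close>)
  \<comment> \<open>Every time before \<open>Ts\<close> lies below an element of \<open>S\<close>;
    \<open>Ts\<close> itself is reached by continuity of each coordinate, so the supremum is
    attained.\<close>
  have eq: "v1 t = v2 t" if t: "t \<in> {0..Ts}" for t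
  proof (rule hilbert_basis_eqI[OF basis])
    fix k
    have sub: "{0..Ts} \<subseteq> {0..T}" using Ts by auto
    have "continuous_on {0..T} (\<lambda>s. inner (v1 s) (e k) - inner (v2 s) (e k))"
      by (intro continuous_on_diff DERIV_continuous_on[OF d1] DERIV_continuous_on[OF d2])
    then have "continuous_on (closure {0..<Ts}) (\<lambda>s. inner (v1 s) (e k) - inner (v2 s) (e k))"
      using Ts sub by (auto intro: continuous_on_subset)
    moreover have "inner (v1 s) (e k) - inner (v2 s) (e k) = 0" if "s \<in> {0..<Ts}" for s
    proof -
      have "s < Sup S" using that by (simp add: Ts_def)
      moreover have "S \<noteq> {}" using \<delta>0S by blast
      ultimately obtain T1 where "T1 \<in> S" "s < T1" using less_cSup_iff[OF _ bdd] by blast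
      then show ?thesis using that by (auto simp: S_def)
    qed
    moreover have "t \<in> closure {0..<Ts}" using t Ts by simp
    ultimately have "inner (v1 t) (e k) - inner (v2 t) (e k) = 0"
      by (rule continuous_constant_on_closure)
    then show "inner (v1 t) (e k) = inner (v2 t) (e k)" by simp
  qed
  have "degen_quantity e lam m (v1 Ts) (v1' Ts) = 0" if "Ts \<noteq> T"
  proof (rule ccontr)
    assume nd: "degen_quantity e lam m (v1 Ts) (v1' Ts) \<noteq> 0"
    have TsT: "Ts \<in> {0..T}" using Ts by simp
    \<comment> \<open>Restarting at \<open>Ts\<close> needs equal velocities as well as equal
      positions; an extension beyond \<open>Ts\<close> would then contradict the supremum.\<close>
    have eq': "v1' Ts = v2' Ts"
    proof (rule hilbert_basis_eqI[OF basis])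
      show "inner (v1' Ts) (e k) = inner (v2' Ts) (e k)" for k
        by (rule derivs_agree_at_right_end[OF d1[OF TsT] d2[OF TsT] _ Ts]) (simp add: eq)
    qed
    have Ts': "0 \<le> Ts" "Ts < T" "v1 Ts = v2 Ts" using Ts that eq[of Ts] by auto
    obtain \<delta> where \<delta>: "0 < \<delta>" "Ts + \<delta> \<le> T"
      "\<And>t. t \<in> {Ts..Ts + \<delta>} \<Longrightarrow> v1 t = v2 t"
      by (rule step[OF Ts' eq' nd]) (rule that)
    have "v1 t = v2 t" if "t \<in> {0..Ts + \<delta>}" for t
      using that eq[of t] \<delta>(3)[of t] by (cases "t \<le> Ts") auto
    then have "Ts + \<delta> \<in> S" using \<delta> Ts by (auto simp: S_def)
    then have "Ts + \<delta> \<le> Ts" unfolding Ts_def by (rule cSup_upper[OF _ bdd])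
    then show False using \<delta>(1) by simp
  qed
  then show ?thesis
    using \<delta>0S eq unfolding Let_def S_def[symmetric] Ts_def[symmetric] by (auto simp: S_def)
qed

end
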